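(* Let $((X_s,Y_s):s\in\mathbb{Z}^N)$ be a strictly stationary process with $X_s\in\mathcal{S}$, $Y_s\in\mathcal{H}$, satisfying $Y_s=\Psi(X_s)+\epsilon_s$, where $\Psi:\mathcal{S}\to\mathcal{H}$ and the $\epsilon_s$ are $\mathcal{H}$-valued with $\mathbb{E}[\epsilon_s|X_s]=0$. Let $\hat\Psi_h$ be the kernel estimator of $\Psi$ with kernel $K$ and bandwidth $h$. Assume: (1) For some $r\in(0,1]$: $\|\Psi(x)-\Psi(y)\|_{\mathcal{H}}\le L_\Psi\|x-y\|_{\mathcal{H}}^r$ for all $x,y\in\mathcal{S}$. For some $\delta>0$, all $0\le u\le\delta$, all $j\in\mathbb{N}$ and all $x\in\mathcal{S}$: $\vartheta_{x,j}(0)=0$, $\vartheta'_{x,j}(u)$ exists, and there is $0<L_{x,j}<\infty$ with $|\vartheta'_{x,j}(u)-\vartheta'_{x,j}(0)|\le L_{x,j}u^r$ for all $0\le u\le\delta$. Moreover $\sup_{x\in\mathcal{S}}\sum_{j}\vartheta'_{x,j}(0)^2<\infty$ and $\sup_{x\in\mathcal{S}}\sum_jL_{x,j}^2<\infty$. (2) $K$ has support in $[0,1]$ and a continuous derivative $K'\le0$ on $[0,1]$; $|K(u)-K(v)|\le L_K|u-v|$ for $u,v\in[0,1]$. (3) $K(1)=0$ (so $K$ is Lipschitz continuous on $[0,\infty)$). (4) $F_x(h)>0$ for all $h>0$, $x\in\mathcal{S}$; the limit $\tau_x(u)=\lim_{h\downarrow0}F_x(hu)/F_x(h)$ exists for all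 $u\in[0,1]$, $x\in\mathcal{S}$, and $\lim_{h\downarrow0}\sup_{x\in\mathcal{S}}\sup_{u\in[0,1]}|F_x(hu)/F_x(h)-\tau_x(u)|=0$. (5) $M_x=K(1)-\int_0^1K'(u)\tau_x(u)\,du>0$ for all $x\in\mathcal{S}$ and $\inf_{x\in\mathcal{S}}M_x>0$. (6) There is $\delta>0$ such that for each fixed $x\in\mathcal{S}$ the map $\mathcal{S}\times[0,1]\ni(z,u)\mapsto F_z(hu)/F_x(h)$ is Lipschitz continuous with a Lipschitz constant $L_x$ which is uniform in $h$ for $h\le\delta$. (7) $\mathbb{P}(\|Y_s\|_{\mathcal{H}}\ge z)\le\kappa_0\exp(-\kappa_1z^\gamma)$ for all $z\ge 0$, for some $\gamma\ge1$ and positive $\kappa_0,\kappa_1$; and there are positive $d_0,d_1$ with $\mathbb{E}[\langle Y_s,e_j\rangle^2]\le d_0\exp(-d_1j)$ for all $j\in\mathbb{N}$. (8) With $\tilde\vartheta_x(u)=\mathbb{E}[\|Y_s\|_{\mathcal{H}}\,|\,\rho(X_s,x)=u]$: $\sup_{x\in\mathcal{S},\|x\|_\infty\le R}\tilde\vartheta_x(0)=\mathcal{O}(R^r)$, and there is $\delta>0$ such that $\tilde\vartheta_x'(u)$ exists for all $x\in\mathcal{S}$, $0\le u\le\delta$, and $\sup_{x\in\mathcal{S},u\le\delta}|\tilde\vartheta'_x(u)|<\infty$. (9) The process is uniformly $\mathcal{C}$-weakly dependent: with $y_{j,s}=\langle Y_s,e_j\rangle$ and $y_{j,s}^{(B)}=\min(B,\max(-B,y_{j,s}))$,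 and with the pseudo-norm $\|g\|^{\sim}=\sup_{x,y\in\mathcal{S},x\ne y}|g(x)-g(y)|/\|x-y\|_{\mathcal{H}}$, $$\sup_{j\in\mathbb{N}}\sup_{B>0}\sum_{i\in\mathbb{N}}\phi_{\mathcal{C},y^{(B)}_{j,s}}(i)<\infty\quad\text{and}\quad\sum_{i\in\mathbb{N}}\phi_{\mathcal{C}}(i)<\infty.$$ Let $(n(k):k\in\mathbb{N})$ be a sequence in $\mathbb{N}^N$ which converges to infinity. Let $R_n$ be a real-valued sequence which has a limit in $(0,\infty]$, and assume that the bandwidth $h=h_n>0$ converges to zero such that $$\frac{R_n^{4d}\,(\log|I_n|)^8}{|I_n|^{\frac1N\cdot\frac1{4d+1}}\ \inf_{x\in\mathcal{G}(R_n)}F_x(h)^2\ h_n}\to0.$$ Then, almost surely, $$\sup_{x\in\mathcal{G}(R_n)}\left\|\hat\Psi_h(x)-\Psi(x)\right\|_{\mathcal{H}}=\mathcal{O}\left(\frac{R_n^{4d}\,(\log|I_n|)^8}{|I_n|^{\frac1N\cdot\frac1{4d+1}}\ \inf_{x\in\mathcal{G}(R_n)}F_x(h)^2\ h_n}\right)+\mathcal{O}(h^r).$$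
   Context: $\mathcal{D}$ is a convex and compact subset of $\mathbb{R}^d$; $\mathcal{H}=L^2(\mathcal{D},\mathcal{B}(\mathcal{D}),\nu)$ (real-valued functions) for a finite measure $\nu$, with $\langle x,y\rangle=\int_{\mathcal{D}}xy\,d\nu$, norm $\|\cdot\|_{\mathcal{H}}$ and an orthonormal basis $\{e_j:j\in\mathbb{N}\}$. $\mathcal{S}$ satisfies $C^0(\mathcal{D})\subseteq\mathcal{S}\subseteq\mathcal{H}$. $\|x\|_\infty$ is the $\nu$-essential supremum of $|x|$ on $\mathcal{D}$. $\rho$ is a pseudo-metric on $\mathcal{S}$ with $\rho(x,y)\le\|x-y\|_{\mathcal{H}}$ for all $x,y\in\mathcal{S}$. $N\ge1$ is an integer. Small ball probability: $F_x(h)=\mathbb{P}(\rho(X_s,x)\le h)$, $h\ge0$. Coordinates: $\psi_j=\langle\Psi(\cdot),e_j\rangle$ and $\vartheta_{x,j}(u)=\mathbb{E}[\psi_j(X_s)-\psi_j(x)\,|\,\rho(X_s,x)=u]$. In assumption (6), Lipschitz continuity in $z$ is with respect to $\rho$. For $n\in\mathbb{N}^N$, $I_n=\{s\in\mathbb{Z}^N:1\le s_i\le n_i,\ i=1,\dots,N\}$, with cardinality $|I_n|$. Estimator: for a kernel $K:[0,\infty)\to\mathbb{R}$ and $K_h=K(\cdot/h)$, $\hat\Psi_h(x)=\hat g_h(x)/\hat f_h(x)$, where $$\hat f_h(x)=\frac1{|I_n|F_x(h)}\sum_{s\in I_n}K_h(\rho(X_s,x))\in\mathbb{R},\qquad\hat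 g_h(x)=\frac1{|I_n|F_x(h)}\sum_{s\in I_n}Y_sK_h(\rho(X_s,x))\in\mathcal{H}.$$ For $R>0$, $\mathcal{G}(R)=\{x\in C^0(\mathcal{D}):\|x\|_{1,C^0(\mathcal{D})}\le R\}$, where $\|x\|_{1,C^0(\mathcal{D})}=\sup_{u\in\mathcal{D}}|x(u)|+\sup_{u,v\in\mathcal{D},u\ne v}|x(u)-x(v)|/\|u-v\|$. "$(n(k))$ converges to infinity" means $\liminf_{k\to\infty}\min_in_i(k)/\max_in_i(k)>0$ and $\lim_{k\to\infty}n_i(k)=\infty$ for all $i$; a sequence indexed by $n$ is indexed by $n=n(k)$, and limits and $\mathcal{O}$-terms are for $k\to\infty$. Weak dependence coefficients: $\mathcal{C}=\{g:\mathcal{S}\to\mathbb{R},\ \sup_{x\in\mathcal{S}}|g(x)|<\infty\}$ and $\mathcal{C}_1=\{g\in\mathcal{C}:\|g\|^\sim\le1\}$. For a stationary process $(X_s,y_s)$ with real-valued $y_s$ bounded by $b:=\|y_s\|_{\mathbb{P},\infty}<\infty$ ($L^\infty(\mathbb{P})$-norm), let $\mathcal{M}_k=\sigma\{(X_s,y_s):1\le\|s\|_{\max}\le k\}$, $k\in\mathbb{N}$, where $\|\cdot\|_{\max}$ is the maximum norm, and for $i\in\mathbb{N}$ $$\phi_{\mathcal{C},y_s}(i)=\sup\left\{\left\|\mathbb{E}\left[\tfrac{y_s}{b}g(X_s)\,\middle|\,\mathcal{M}_k\right]-\mathbb{E}\left[\tfrac{y_s}{b}g(X_s)\right]\right\|_{\mathbb{P},\infty}:\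 g\in\mathcal{C}_1,\ k\in\mathbb{N},\ s\in\mathbb{N}^N,\ \|s\|_{\max}=k+i\right\}.$$ $\phi_{\mathcal{C},y_{j,s}^{(B)}}$ is obtained with $y_s=y_{j,s}^{(B)}$, and $\phi_{\mathcal{C}}$ with $y_s\equiv1$. *)

theory Defs
  imports "HOL-Probability.Probability" "HOL-Library.Landau_Symbols"
begin

section \<open>The Hilbert space of square-integrable functions\<close>

text \<open>
  Elements of \<open>H = L\<^sup>2(D, B(D), \<nu>)\<close> are represented by functions \<open>real ^ 'd \<Rightarrow> real\<close>; two
  representatives denote the same element iff they agree \<open>\<nu>\<close>-almost everywhere. Thus equality in
  \<open>H\<close> is always rendered as \<open>\<nu>\<close>-a.e. equality, and a subset of \<open>H\<close> is a set of
  representatives that is closed under \<open>\<nu>\<close>-a.e. equality. As \<open>\<nu>\<close> has space \<open>D\<close>, the values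
  of a representative outside \<open>D\<close> are irrelevant.
\<close>

type_synonym 'd fld = "real ^ 'd \<Rightarrow> real"

definition l2_space :: "(real ^ 'd) measure \<Rightarrow> 'd fld set" where
  "l2_space \<nu> = {x. x \<in> borel_measurable \<nu> \<and> integrable \<nu> (\<lambda>u. (x u)\<^sup>2)}"

definition l2_inner :: "(real ^ 'd) measure \<Rightarrow> 'd fld \<Rightarrow> 'd fld \<Rightarrow> real" where
  "l2_inner \<nu> x y = (\<integral>u. x u * y u \<partial>\<nu>)"

definition l2_norm :: "(real ^ 'd) measure \<Rightarrow> 'd fld \<Rightarrow> real" where
  "l2_norm \<nu> x = sqrt (l2_inner \<nu> x x)"

definition l2_dist :: "(real ^ 'd) measure \<Rightarrow> 'd fld \<Rightarrow> 'd fld \<Rightarrow> real" where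
  "l2_dist \<nu> x y = l2_norm \<nu> (\<lambda>u. x u - y u)"

definition l2_subset :: "(real ^ 'd) measure \<Rightarrow> 'd fld set \<Rightarrow> bool" where
  "l2_subset \<nu> S \<longleftrightarrow> S \<subseteq> l2_space \<nu> \<and>
     (\<forall>x\<in>S. \<forall>y\<in>l2_space \<nu>. (AE u in \<nu>. x u = y u) \<longrightarrow> y \<in> S)"

definition orthonormal_basis :: "(real ^ 'd) measure \<Rightarrow> (nat \<Rightarrow> 'd fld) \<Rightarrow> bool" where
  "orthonormal_basis \<nu> e \<longleftrightarrow>
     (\<forall>j. e j \<in> l2_space \<nu>) \<and>
     (\<forall>i j. l2_inner \<nu> (e i) (e j) = (if i = j then 1 else 0)) \<and>
     (\<forall>x\<in>l2_space \<nu>.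
        (\<lambda>m. l2_dist \<nu> x (\<lambda>u. \<Sum>j<m. l2_inner \<nu> x (e j) * e j u)) \<longlonglongrightarrow> 0)"

text \<open>Borel \<open>\<sigma>\<close>-algebra of \<open>S\<close> for the topology induced by the norm of \<open>H\<close>.\<close>

definition l2_borel :: "(real ^ 'd) measure \<Rightarrow> 'd fld set \<Rightarrow> 'd fld measure" where
  "l2_borel \<nu> S =
     sigma S {U. U \<subseteq> S \<and> (\<forall>x\<in>U. \<exists>\<epsilon>>0. \<forall>y\<in>S. l2_dist \<nu> x y < \<epsilon> \<longrightarrow> y \<in> U)}"

definition pseudo_metric_on :: "'a set \<Rightarrow> ('a \<Rightarrow> 'a \<Rightarrow> real) \<Rightarrow> bool" where
  "pseudo_metric_on S \<rho> \<longleftrightarrow>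
     (\<forall>x\<in>S. \<rho> x x = 0) \<and>
     (\<forall>x\<in>S. \<forall>y\<in>S. 0 \<le> \<rho> x y \<and> \<rho> x y = \<rho> y x) \<and>
     (\<forall>x\<in>S. \<forall>y\<in>S. \<forall>z\<in>S. \<rho> x z \<le> \<rho> x y + \<rho> y z)"

text \<open>The \<open>L\<^sup>\<infinity>\<close>-norm, used both for \<open>\<nu>\<close> and for the probability measure.\<close>

definition Linf_norm :: "'a measure \<Rightarrow> ('a \<Rightarrow> real) \<Rightarrow> ennreal" where
  "Linf_norm M f = esssup M (\<lambda>\<omega>. ennreal \<bar>f \<omega>\<bar>)"


section \<open>Lipschitz balls\<close>

definition lip_norm :: "(real ^ 'd) set \<Rightarrow> 'd fld \<Rightarrow> ennreal" where
  "lip_norm D x =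
     (SUP u\<in>D. ennreal \<bar>x u\<bar>) +
     (SUP (u, v)\<in>{(u, v). u \<in> D \<and> v \<in> D \<and> u \<noteq> v}. ennreal (\<bar>x u - x v\<bar> / norm (u - v)))"

definition lip_ball :: "(real ^ 'd) set \<Rightarrow> real \<Rightarrow> 'd fld set" where
  "lip_ball D R = {x. continuous_on D x \<and> lip_norm D x \<le> ennreal R}"


section \<open>The lattice\<close>

definition index_box :: "nat ^ 'n \<Rightarrow> (int ^ 'n) set" where
  "index_box n = {s. \<forall>i. 1 \<le> s $ i \<and> s $ i \<le> int (n $ i)}"

definition max_norm :: "int ^ 'n \<Rightarrow> int" where
  "max_norm s = Max (range (\<lambda>i. \<bar>s $ i\<bar>))"

definition converges_to_infinity :: "(nat \<Rightarrow> nat ^ 'n) \<Rightarrow> bool" where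
  "converges_to_infinity n \<longleftrightarrow>
     0 < liminf (\<lambda>k. ereal (real (Min (range (\<lambda>i. n k $ i))) / real (Max (range (\<lambda>i. n k $ i))))) \<and>
     (\<forall>i. filterlim (\<lambda>k. n k $ i) at_top sequentially)"


section \<open>Stationarity and conditional expectations\<close>

definition strictly_stationary ::
  "'w measure \<Rightarrow> 'a measure \<Rightarrow> (int ^ 'n \<Rightarrow> 'w \<Rightarrow> 'a) \<Rightarrow> bool" where
  "strictly_stationary P A Z \<longleftrightarrow>
     (\<forall>J t. finite J \<longrightarrow>
        distr P (PiM J (\<lambda>_. A)) (\<lambda>\<omega>. \<lambda>s\<in>J. Z s \<omega>) =
        distr P (PiM J (\<lambda>_. A)) (\<lambda>\<omega>. \<lambda>s\<in>J. Z (s + t) \<omega>))"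

text \<open>
  \<open>u \<mapsto> E[Z | U = u]\<close> is determined only up to null sets of the law of \<open>U\<close>; the predicate says
  that \<open>m\<close> is one of its versions.
\<close>

definition cond_exp_version ::
  "'w measure \<Rightarrow> ('w \<Rightarrow> real) \<Rightarrow> ('w \<Rightarrow> real) \<Rightarrow> (real \<Rightarrow> real) \<Rightarrow> bool" where
  "cond_exp_version P Z U m \<longleftrightarrow>
     integrable P Z \<and> m \<in> borel_measurable borel \<and>
     (AE \<omega> in P. real_cond_exp P (vimage_algebra (space P) U borel) Z \<omega> = m (U \<omega>))"

text \<open>
  \<open>E[\<epsilon> | X] = 0\<close> for a random element \<open>\<epsilon>\<close> of \<open>H\<close> with integrable norm and a random element
  \<open>X\<close> of the measurable space \<open>A\<close>. The \<open>H\<close>-valued conditional expectation is determined by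
  \<open>\<langle>E[\<epsilon> | X], y\<rangle> = E[\<langle>\<epsilon>, y\<rangle> | X]\<close> for \<open>y \<in> H\<close>.
\<close>

definition l2_cond_mean_zero ::
  "'w measure \<Rightarrow> (real ^ 'd) measure \<Rightarrow> ('w \<Rightarrow> 'd fld) \<Rightarrow> 'a measure \<Rightarrow> ('w \<Rightarrow> 'a) \<Rightarrow> bool" where
  "l2_cond_mean_zero P \<nu> \<epsilon> A X \<longleftrightarrow>
     integrable P (\<lambda>\<omega>. l2_norm \<nu> (\<epsilon> \<omega>)) \<and>
     (\<forall>y\<in>l2_space \<nu>. AE \<omega> in P.
        real_cond_exp P (vimage_algebra (space P) X A) (\<lambda>\<omega>'. l2_inner \<nu> (\<epsilon> \<omega>') y) \<omega> = 0)"


section \<open>Small ball probability and kernel estimator\<close>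

text \<open>By stationarity the choice of the site \<open>0\<close> is immaterial.\<close>

definition small_ball ::
  "'w measure \<Rightarrow> (int ^ 'n \<Rightarrow> 'w \<Rightarrow> 'd fld) \<Rightarrow> ('d fld \<Rightarrow> 'd fld \<Rightarrow> real) \<Rightarrow> 'd fld \<Rightarrow> real \<Rightarrow> real" where
  "small_ball P X \<rho> x h = measure P {\<omega>\<in>space P. \<rho> (X 0 \<omega>) x \<le> h}"

definition f_hat ::
  "'w measure \<Rightarrow> (int ^ 'n \<Rightarrow> 'w \<Rightarrow> 'd fld) \<Rightarrow> ('d fld \<Rightarrow> 'd fld \<Rightarrow> real) \<Rightarrow> (real \<Rightarrow> real) \<Rightarrow>
   nat ^ 'n \<Rightarrow> real \<Rightarrow> 'w \<Rightarrow> 'd fld \<Rightarrow> real" where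
  "f_hat P X \<rho> K n h \<omega> x =
     1 / (real (card (index_box n)) * small_ball P X \<rho> x h) *
     (\<Sum>s\<in>index_box n. K (\<rho> (X s \<omega>) x / h))"

definition g_hat ::
  "'w measure \<Rightarrow> (int ^ 'n \<Rightarrow> 'w \<Rightarrow> 'd fld) \<Rightarrow> (int ^ 'n \<Rightarrow> 'w \<Rightarrow> 'd fld) \<Rightarrow>
   ('d fld \<Rightarrow> 'd fld \<Rightarrow> real) \<Rightarrow> (real \<Rightarrow> real) \<Rightarrow>
   nat ^ 'n \<Rightarrow> real \<Rightarrow> 'w \<Rightarrow> 'd fld \<Rightarrow> 'd fld" where
  "g_hat P X Y \<rho> K n h \<omega> x = (\<lambda>u.
     1 / (real (card (index_box n)) * small_ball P X \<rho> x h) *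
     (\<Sum>s\<in>index_box n. Y s \<omega> u * K (\<rho> (X s \<omega>) x / h)))"

definition Psi_hat ::
  "'w measure \<Rightarrow> (int ^ 'n \<Rightarrow> 'w \<Rightarrow> 'd fld) \<Rightarrow> (int ^ 'n \<Rightarrow> 'w \<Rightarrow> 'd fld) \<Rightarrow>
   ('d fld \<Rightarrow> 'd fld \<Rightarrow> real) \<Rightarrow> (real \<Rightarrow> real) \<Rightarrow>
   nat ^ 'n \<Rightarrow> real \<Rightarrow> 'w \<Rightarrow> 'd fld \<Rightarrow> 'd fld" where
  "Psi_hat P X Y \<rho> K n h \<omega> x =
     (\<lambda>u. g_hat P X Y \<rho> K n h \<omega> x u / f_hat P X \<rho> K n h \<omega> x)"

text \<open>
  In the situation of interest \<open>lip_ball D R\<close> is compact and \<open>x \<mapsto> small_ball P X \<rho> x h\<close> is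
  continuous and positive for small \<open>h\<close>, so the infimum below is positive and no division by zero
  occurs for small \<open>h\<close>.
\<close>

definition unif_rate ::
  "'w measure \<Rightarrow> (int ^ 'n \<Rightarrow> 'w \<Rightarrow> 'd fld) \<Rightarrow> ('d fld \<Rightarrow> 'd fld \<Rightarrow> real) \<Rightarrow> (real ^ 'd) set \<Rightarrow>
   nat ^ 'n \<Rightarrow> real \<Rightarrow> real \<Rightarrow> real" where
  "unif_rate P X \<rho> D n R h =
     R ^ (4 * CARD('d)) * ln (real (card (index_box n))) ^ 8 /
     (real (card (index_box n)) powr (1 / real CARD('n) * (1 / real (4 * CARD('d) + 1))) *
      (INF x\<in>lip_ball D R. (small_ball P X \<rho> x h)\<^sup>2) * h)"


section \<open>Weak dependence coefficients\<close>

text \<open>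
  Bounded functions on \<open>S \<subseteq> H\<close>; the first clause makes \<open>g\<close> a function on \<open>H\<close>, i.e. independent
  of the representatives.
\<close>

definition bdd_funs :: "(real ^ 'd) measure \<Rightarrow> 'd fld set \<Rightarrow> ('d fld \<Rightarrow> real) set" where
  "bdd_funs \<nu> S =
     {g. (\<forall>x\<in>S. \<forall>y\<in>S. (AE u in \<nu>. x u = y u) \<longrightarrow> g x = g y) \<and>
         (SUP x\<in>S. ennreal \<bar>g x\<bar>) < \<infinity>}"

definition lip_pseudo_norm :: "(real ^ 'd) measure \<Rightarrow> 'd fld set \<Rightarrow> ('d fld \<Rightarrow> real) \<Rightarrow> ennreal" where
  "lip_pseudo_norm \<nu> S g =
     (SUP (x, y)\<in>{(x, y). x \<in> S \<and> y \<in> S \<and> \<not> (AE u in \<nu>. x u = y u)}.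
        ennreal (\<bar>g x - g y\<bar> / l2_dist \<nu> x y))"

definition past ::
  "'w measure \<Rightarrow> (real ^ 'd) measure \<Rightarrow> 'd fld set \<Rightarrow>
   (int ^ 'n \<Rightarrow> 'w \<Rightarrow> 'd fld) \<Rightarrow> (int ^ 'n \<Rightarrow> 'w \<Rightarrow> real) \<Rightarrow> nat \<Rightarrow> 'w measure" where
  "past P \<nu> S X y k =
     sigma (space P)
       (\<Union>s\<in>{s. 1 \<le> max_norm s \<and> max_norm s \<le> int k}.
          sets (vimage_algebra (space P) (\<lambda>\<omega>. (X s \<omega>, y s \<omega>)) (l2_borel \<nu> S \<Otimes>\<^sub>M borel)))"

text \<open>
  Here \<open>\<nat> = {1, 2, \<dots>}\<close>, as for the sites of \<open>index_box\<close>. If \<open>y\<close> vanishes almost surely then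
  \<open>y / b\<close> is \<open>0\<close> by the convention \<open>0 / 0 = 0\<close>.
\<close>

definition weak_dep_coeff ::
  "'w measure \<Rightarrow> (real ^ 'd) measure \<Rightarrow> 'd fld set \<Rightarrow>
   (int ^ 'n \<Rightarrow> 'w \<Rightarrow> 'd fld) \<Rightarrow> (int ^ 'n \<Rightarrow> 'w \<Rightarrow> real) \<Rightarrow> nat \<Rightarrow> ennreal" where
  "weak_dep_coeff P \<nu> S X y i =
     Sup {Linf_norm P (\<lambda>\<omega>.
            real_cond_exp P (past P \<nu> S X y k)
              (\<lambda>\<omega>'. y s \<omega>' / enn2real (Linf_norm P (y s)) * g (X s \<omega>')) \<omega> -
            (\<integral>\<omega>'. y s \<omega>' / enn2real (Linf_norm P (y s)) * g (X s \<omega>') \<partial>P))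
          | g k s. g \<in> bdd_funs \<nu> S \<and> lip_pseudo_norm \<nu> S g \<le> 1 \<and> 1 \<le> k \<and>
                   (\<forall>l. 1 \<le> s $ l) \<and> max_norm s = int (k + i)}"

definition truncate :: "real \<Rightarrow> real \<Rightarrow> real" where
  "truncate B y = min B (max (- B) y)"

end

theory Submission
  imports Defs "HOL-Complex_Analysis.Great_Picard" "HOL-Real_Asymp.Real_Asymp"
begin

text \<open>
  Weak dependence only controls the conditional mean of a site given the sites of smaller maximum
  norm, so a kernel sum over a box is split into its shells \<open>max_norm s = k\<close>. Conditioning the whole
  sum on \<open>past k\<close> gives a martingale whose increments are of the order of the largest shell, and
  Azuma's inequality yields an exponential bound with exponent proportional to the side length of
  the box. A sup-norm cover of the Lipschitz ball, whose log-cardinality is polynomially smaller,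
  makes the bound uniform in \<open>x\<close>, the bandwidth and the shape of the box.

  The numerator is treated coordinatewise in the orthonormal basis: finitely many coordinates of the
  truncated response obey the exponential bound, and the remaining coordinates are negligible by the
  exponential decay of their second moments. Since \<open>E[\<epsilon> | X] = 0\<close> and \<open>\<theta> x j u\<close> is of order \<open>u\<close>, the
  bias is \<open>O(h) \<subseteq> O(h powr r)\<close>, and \<open>E K(\<rho>(X, x) / h) = - (\<integral> K'(u) F x (h u) du)\<close> bounds the
  denominator from below by the assumption on \<open>M x\<close>. Parseval's identity puts the coordinates
  together again.
\<close>

section \<open>The Hilbert space of square-integrable functions\<close>

text \<open>The dependence coefficients see only functions of Lipschitz constant one, and the weight
  \<open>K (\<rho> z x / h)\<close> as a function of \<open>z\<close> has constant of order 1/h: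
  this is the factor 1/h of the rate. Dependence is controlled along the maximum norm, so a box of
  side m offers m martingale steps, each as large as a shell of about m^(N-1) sites. A deviation t
  m^N then has probability about exp (- c t^2 m), so that |I|^(1/N) is what counts, not |I|. The
  error is divided by the mean of the kernel, of order F, and F <= 1 lets the squared infimum serve
  as a lower bound for F.

  The factor R^(4d) acts twice. Since the rate tends to zero, it keeps R below a small power of m,
  hence the metric entropy below the Azuma exponent; and it absorbs the growth R^r of the norm of
  \<Psi> on the ball, which multiplies the random error of the denominator. The remaining obstacle
  is the infinite dimension of the response: coordinate bounds must be square summable, so the
  deviation level is taken smaller than m^(-\<beta>) by a power of m that pays for the number of
  retained coordinates.\<close>

lemma l2_spaceD:
  assumes "x \<in> l2_space \<nu>"
  shows "x \<in> borel_measurable \<nu>" "integrable \<nu> (\<lambda>u. (x u)\<^sup>2)"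
  using assms by (auto simp: l2_space_def)

lemma l2_integrable_mult:
  assumes "x \<in> l2_space \<nu>" "y \<in> l2_space \<nu>"
  shows "integrable \<nu> (\<lambda>u. x u * y u)"
proof (rule Bochner_Integration.integrable_bound)
  show "integrable \<nu> (\<lambda>u. (x u)\<^sup>2 + (y u)\<^sup>2)"
    using assms by (intro Bochner_Integration.integrable_add l2_spaceD)
  show "(\<lambda>u. x u * y u) \<in> borel_measurable \<nu>"
    using l2_spaceD(1)[OF assms(1)] l2_spaceD(1)[OF assms(2)] by measurable
  show "AE u in \<nu>. norm (x u * y u) \<le> norm ((x u)\<^sup>2 + (y u)\<^sup>2)"
  proof (rule AE_I2)
    fix u
    have "2 * \<bar>x u * y u\<bar> \<le> (x u)\<^sup>2 + (y u)\<^sup>2"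
      using sum_squares_bound[of "\<bar>x u\<bar>" "\<bar>y u\<bar>"] by (simp add: abs_mult)
    thus "norm (x u * y u) \<le> norm ((x u)\<^sup>2 + (y u)\<^sup>2)"
      using abs_ge_zero[of "x u * y u"] by simp
  qed
qed

lemma l2_add:
  assumes "x \<in> l2_space \<nu>" "y \<in> l2_space \<nu>"
  shows "(\<lambda>u. x u + y u) \<in> l2_space \<nu>"
proof -
  have "integrable \<nu> (\<lambda>u. (x u)\<^sup>2 + (y u)\<^sup>2 + 2 * (x u * y u))"
    using assms l2_integrable_mult[OF assms]
    by (intro Bochner_Integration.integrable_add l2_spaceD Bochner_Integration.integrable_mult_right) auto
  moreover have "(\<lambda>u. (x u + y u)\<^sup>2) = (\<lambda>u. (x u)\<^sup>2 + (y u)\<^sup>2 + 2 * (x u * y u))"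
    by (simp add: power2_sum mult.assoc)
  ultimately show ?thesis
    using l2_spaceD(1)[OF assms(1)] l2_spaceD(1)[OF assms(2)]
    unfolding l2_space_def by simp
qed

lemma l2_scale:
  assumes "x \<in> l2_space \<nu>"
  shows "(\<lambda>u. c * x u) \<in> l2_space \<nu>"
  using assms unfolding l2_space_def by (auto simp: power_mult_distrib)

lemma l2_diff:
  assumes "x \<in> l2_space \<nu>" "y \<in> l2_space \<nu>"
  shows "(\<lambda>u. x u - y u) \<in> l2_space \<nu>"
  using l2_add[OF assms(1) l2_scale[OF assms(2), of "-1"]] by simp

lemma l2_zero: "(\<lambda>u. 0) \<in> l2_space \<nu>"
  by (simp add: l2_space_def)

lemma l2_sum:
  assumes "\<And>i. i \<in> A \<Longrightarrow> x i \<in> l2_space \<nu>"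
  shows "(\<lambda>u. \<Sum>i\<in>A. x i u) \<in> l2_space \<nu>"
  using assms by (induction A rule: infinite_finite_induct) (auto simp: l2_zero l2_add)

lemma l2_inner_commute: "l2_inner \<nu> x y = l2_inner \<nu> y x"
  by (simp add: l2_inner_def mult.commute)

lemma l2_inner_diff_left:
  assumes "x \<in> l2_space \<nu>" "y \<in> l2_space \<nu>" "z \<in> l2_space \<nu>"
  shows "l2_inner \<nu> (\<lambda>u. x u - y u) z = l2_inner \<nu> x z - l2_inner \<nu> y z"
  using l2_integrable_mult[OF assms(1,3)] l2_integrable_mult[OF assms(2,3)]
  by (simp add: l2_inner_def left_diff_distrib)

lemma l2_inner_add_left:
  assumes "x \<in> l2_space \<nu>" "y \<in> l2_space \<nu>" "z \<in> l2_space \<nu>"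
  shows "l2_inner \<nu> (\<lambda>u. x u + y u) z = l2_inner \<nu> x z + l2_inner \<nu> y z"
  using l2_integrable_mult[OF assms(1,3)] l2_integrable_mult[OF assms(2,3)]
  by (simp add: l2_inner_def distrib_right)

lemma l2_inner_scale_left: "l2_inner \<nu> (\<lambda>u. c * x u) z = c * l2_inner \<nu> x z"
  by (simp add: l2_inner_def mult.assoc)

lemma l2_inner_sum_left:
  assumes "\<And>i. i \<in> A \<Longrightarrow> x i \<in> l2_space \<nu>" "z \<in> l2_space \<nu>"
  shows "l2_inner \<nu> (\<lambda>u. \<Sum>i\<in>A. x i u) z = (\<Sum>i\<in>A. l2_inner \<nu> (x i) z)"
  using assms
proof (induction A rule: infinite_finite_induct)
  case (insert a A)
  thus ?case using l2_inner_add_left[of "x a" \<nu> "\<lambda>u. \<Sum>i\<in>A. x i u" z] l2_sum[of A x \<nu>]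
    by simp
qed (auto simp: l2_inner_def)

lemma l2_inner_cong_AE:
  assumes "AE u in \<nu>. x u = x' u" "x \<in> l2_space \<nu>" "x' \<in> l2_space \<nu>" "z \<in> l2_space \<nu>"
  shows "l2_inner \<nu> x z = l2_inner \<nu> x' z"
  unfolding l2_inner_def
proof (rule integral_cong_AE)
  show "AE u in \<nu>. x u * z u = x' u * z u"
    using assms(1) by eventually_elim simp
qed (use l2_spaceD(1)[OF assms(2)] l2_spaceD(1)[OF assms(3)] l2_spaceD(1)[OF assms(4)] in measurable)

lemma l2_inner_self: "l2_inner \<nu> x x = (\<integral>u. (x u)\<^sup>2 \<partial>\<nu>)"
  by (simp add: l2_inner_def power2_eq_square)

lemma l2_inner_self_nonneg [simp]: "0 \<le> l2_inner \<nu> x x"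
  by (simp add: l2_inner_self)

lemma l2_norm_nonneg [simp]: "0 \<le> l2_norm \<nu> x"
  by (simp add: l2_norm_def)

lemma l2_dist_nonneg [simp]: "0 \<le> l2_dist \<nu> x y"
  by (simp add: l2_dist_def)

lemma l2_norm_power2: "(l2_norm \<nu> x)\<^sup>2 = l2_inner \<nu> x x"
  by (simp add: l2_norm_def)

text \<open>Discriminant argument for the nonnegative quadratic t -> |t x + y|^2. It is carried out
  by hand because elements are representatives, for which the form is only semidefinite.\<close>

lemma l2_Cauchy_Schwarz:
  assumes "x \<in> l2_space \<nu>" "y \<in> l2_space \<nu>"
  shows "\<bar>l2_inner \<nu> x y\<bar> \<le> l2_norm \<nu> x * l2_norm \<nu> y"
proof -
  have quad: "0 \<le> l2_inner \<nu> x x * t\<^sup>2 + 2 * l2_inner \<nu> x y * t + l2_inner \<nu> y y" for t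
  proof -
    have "0 \<le> l2_inner \<nu> (\<lambda>u. t * x u + y u) (\<lambda>u. t * x u + y u)" by simp
    also have "\<dots> = (\<integral>u. t\<^sup>2 * (x u)\<^sup>2 + 2 * t * (x u * y u) + (y u)\<^sup>2 \<partial>\<nu>)"
      unfolding l2_inner_self by (rule Bochner_Integration.integral_cong) (auto simp: power2_eq_square algebra_simps)
    also have "\<dots> = t\<^sup>2 * l2_inner \<nu> x x + 2 * t * l2_inner \<nu> x y + l2_inner \<nu> y y"
      using l2_spaceD(2)[OF assms(1)] l2_spaceD(2)[OF assms(2)] l2_integrable_mult[OF assms]
      by (simp add: l2_inner_self l2_inner_def[of \<nu> x y])
    finally show ?thesis by (simp add: mult_ac)
  qed
  have "(l2_inner \<nu> x y)\<^sup>2 \<le> l2_inner \<nu> x x * l2_inner \<nu> y y"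
  proof (cases "l2_inner \<nu> x x = 0")
    case True
    have "l2_inner \<nu> x y = 0"
    proof (rule ccontr)
      assume ne: "l2_inner \<nu> x y \<noteq> 0"
      \<comment> \<open>With vanishing leading coefficient the quadratic is linear, and this t makes
        it equal to -1.\<close>
      have "0 \<le> 2 * l2_inner \<nu> x y * (- (l2_inner \<nu> y y + 1) / (2 * l2_inner \<nu> x y)) + l2_inner \<nu> y y"
        using quad[of "- (l2_inner \<nu> y y + 1) / (2 * l2_inner \<nu> x y)"] True by simp
      thus False using ne by (simp add: field_simps)
    qed
    thus ?thesis by simp
  next
    case False
    hence pos: "0 < l2_inner \<nu> x x" using l2_inner_self_nonneg[of \<nu> x] by linarith
    have "0 \<le> l2_inner \<nu> x x * (- l2_inner \<nu> x y / l2_inner \<nu> x x)\<^sup>2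
            + 2 * l2_inner \<nu> x y * (- l2_inner \<nu> x y / l2_inner \<nu> x x) + l2_inner \<nu> y y"
      by (rule quad)
    also have "\<dots> = l2_inner \<nu> y y - (l2_inner \<nu> x y)\<^sup>2 / l2_inner \<nu> x x"
      using pos by (simp add: field_simps power2_eq_square)
    finally show ?thesis using pos by (simp add: field_simps)
  qed
  hence "sqrt ((l2_inner \<nu> x y)\<^sup>2) \<le> sqrt (l2_inner \<nu> x x * l2_inner \<nu> y y)" by (rule real_sqrt_le_mono)
  thus ?thesis by (simp add: l2_norm_def real_sqrt_mult)
qed

lemma l2_norm_triangle:
  assumes "x \<in> l2_space \<nu>" "y \<in> l2_space \<nu>"
  shows "l2_norm \<nu> (\<lambda>u. x u + y u) \<le> l2_norm \<nu> x + l2_norm \<nu> y"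
proof (rule power2_le_imp_le)
  have "(l2_norm \<nu> (\<lambda>u. x u + y u))\<^sup>2 = (\<integral>u. (x u)\<^sup>2 + 2 * (x u * y u) + (y u)\<^sup>2 \<partial>\<nu>)"
    unfolding l2_norm_power2 l2_inner_self
    by (rule Bochner_Integration.integral_cong) (auto simp: power2_eq_square algebra_simps)
  also have "\<dots> = (l2_norm \<nu> x)\<^sup>2 + 2 * l2_inner \<nu> x y + (l2_norm \<nu> y)\<^sup>2"
    using l2_spaceD(2)[OF assms(1)] l2_spaceD(2)[OF assms(2)] l2_integrable_mult[OF assms]
    by (simp add: l2_inner_self l2_norm_power2 l2_inner_def[of \<nu> x y])
  also have "\<dots> \<le> (l2_norm \<nu> x + l2_norm \<nu> y)\<^sup>2"
    using l2_Cauchy_Schwarz[OF assms] by (simp add: power2_sum)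
  finally show "(l2_norm \<nu> (\<lambda>u. x u + y u))\<^sup>2 \<le> (l2_norm \<nu> x + l2_norm \<nu> y)\<^sup>2" .
qed simp

lemma l2_dist_commute: "l2_dist \<nu> x y = l2_dist \<nu> y x"
  by (simp add: l2_dist_def l2_norm_def l2_inner_self power2_commute)

lemma l2_norm_diff_le:
  assumes "x \<in> l2_space \<nu>" "y \<in> l2_space \<nu>"
  shows "\<bar>l2_norm \<nu> x - l2_norm \<nu> y\<bar> \<le> l2_dist \<nu> x y"
proof -
  have *: "l2_norm \<nu> a \<le> l2_norm \<nu> b + l2_dist \<nu> a b" if "a \<in> l2_space \<nu>" "b \<in> l2_space \<nu>" for a b
    using l2_norm_triangle[OF that(2) l2_diff[OF that]] by (simp add: l2_dist_def)
  show ?thesis using *[OF assms] *[OF assms(2,1)] by (simp add: l2_dist_commute abs_le_iff)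
qed

text \<open>Makes the quotient in \<open>lip_pseudo_norm\<close> a genuine one: the pairs excluded
  there are exactly those at distance zero.\<close>

lemma l2_dist_pos:
  assumes "x \<in> l2_space \<nu>" "y \<in> l2_space \<nu>" "\<not> (AE u in \<nu>. x u = y u)"
  shows "0 < l2_dist \<nu> x y"
proof (rule ccontr)
  assume "\<not> 0 < l2_dist \<nu> x y"
  hence "l2_dist \<nu> x y = 0" using l2_dist_nonneg[of \<nu> x y] by linarith
  hence "(\<integral>u. (x u - y u)\<^sup>2 \<partial>\<nu>) = 0"
    by (simp add: l2_dist_def l2_norm_def l2_inner_self)
  hence "AE u in \<nu>. (x u - y u)\<^sup>2 = 0"
    using l2_spaceD(2)[OF l2_diff[OF assms(1,2)]] by (subst (asm) integral_nonneg_eq_0_iff_AE) auto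
  with assms(3) show False by simp
qed

lemma l2_dist_eq_0:
  assumes "AE u in \<nu>. x u = y u" "x \<in> l2_space \<nu>" "y \<in> l2_space \<nu>"
  shows "l2_dist \<nu> x y = 0"
proof -
  have "AE u in \<nu>. (x u - y u)\<^sup>2 = 0" using assms(1) by eventually_elim simp
  hence "(\<integral>u. (x u - y u)\<^sup>2 \<partial>\<nu>) = 0"
    by (simp add: integral_eq_zero_AE)
  thus ?thesis by (simp add: l2_dist_def l2_norm_def l2_inner_self)
qed

lemma l2_inner_lipschitz:
  assumes "x \<in> l2_space \<nu>" "y \<in> l2_space \<nu>" "z \<in> l2_space \<nu>"
  shows "\<bar>l2_inner \<nu> x z - l2_inner \<nu> y z\<bar> \<le> l2_norm \<nu> z * l2_dist \<nu> x y"
  using l2_Cauchy_Schwarz[OF l2_diff[OF assms(1,2)] assms(3)]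
  by (simp add: l2_inner_diff_left assms l2_dist_def mult.commute)

section \<open>Orthonormal expansions\<close>

lemma orthonormal_basisD:
  assumes "orthonormal_basis \<nu> e"
  shows "e j \<in> l2_space \<nu>" "l2_inner \<nu> (e i) (e j) = (if i = j then 1 else 0)" "l2_norm \<nu> (e j) = 1"
  using assms unfolding orthonormal_basis_def by (auto simp: l2_norm_def)

text \<open>By orthonormality the squared distance from x to its m-th partial sum is |x|^2 minus the
  sum of the first m squared coefficients; completeness of the basis sends that distance to
  zero.\<close>

lemma Parseval:
  assumes e: "orthonormal_basis \<nu> e" and x: "x \<in> l2_space \<nu>"
  shows "(\<lambda>j. (l2_inner \<nu> x (e j))\<^sup>2) sums (l2_norm \<nu> x)\<^sup>2"
proof -
  define c where "c j = l2_inner \<nu> x (e j)" for j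
  define p where "p m = (\<lambda>u. \<Sum>j<m. c j * e j u)" for m :: nat
  note eD = orthonormal_basisD[OF e]
  have p: "p m \<in> l2_space \<nu>" for m unfolding p_def by (intro l2_sum l2_scale eD)
  have pe: "l2_inner \<nu> (p m) (e i) = (if i < m then c i else 0)" for m i
  proof -
    have "l2_inner \<nu> (p m) (e i) = (\<Sum>j<m. c j * l2_inner \<nu> (e j) (e i))"
      unfolding p_def by (subst l2_inner_sum_left) (auto simp: l2_scale eD l2_inner_scale_left)
    also have "\<dots> = (\<Sum>j<m. if j = i then c j else 0)" by (rule sum.cong) (auto simp: eD)
    finally show ?thesis by simp
  qed
  have pz: "l2_inner \<nu> (p m) z = (\<Sum>j<m. c j * l2_inner \<nu> (e j) z)" if "z \<in> l2_space \<nu>" for m z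
    unfolding p_def by (subst l2_inner_sum_left) (auto simp: l2_scale eD l2_inner_scale_left that)
  have *: "(l2_dist \<nu> x (p m))\<^sup>2 = (l2_norm \<nu> x)\<^sup>2 - (\<Sum>j<m. (c j)\<^sup>2)" for m
  proof -
    have "(l2_dist \<nu> x (p m))\<^sup>2 = l2_inner \<nu> x x - l2_inner \<nu> x (p m) - (l2_inner \<nu> (p m) x - l2_inner \<nu> (p m) (p m))"
      unfolding l2_dist_def l2_norm_power2
      by (simp add: l2_inner_diff_left x p l2_diff l2_inner_commute[of \<nu> x "\<lambda>u. x u - p m u"]
             l2_inner_commute[of \<nu> "p m" "\<lambda>u. x u - p m u"] l2_inner_commute[of \<nu> x "p m"])
    also have "l2_inner \<nu> (p m) (p m) = (\<Sum>j<m. (c j)\<^sup>2)"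
      by (subst pz[OF p], rule sum.cong) (auto simp: l2_inner_commute[of \<nu> "e _" "p m"] pe power2_eq_square)
    also have "l2_inner \<nu> (p m) x = (\<Sum>j<m. (c j)\<^sup>2)"
      by (subst pz[OF x], rule sum.cong) (auto simp: l2_inner_commute[of \<nu> "e _" x] c_def power2_eq_square)
    finally show ?thesis using l2_inner_commute[of \<nu> x "p m"] \<open>l2_inner \<nu> (p m) x = _\<close>
      by (simp add: l2_norm_power2)
  qed
  have "(\<lambda>m. l2_dist \<nu> x (p m)) \<longlonglongrightarrow> 0"
    using e x unfolding orthonormal_basis_def p_def c_def by auto
  hence "(\<lambda>m. (l2_norm \<nu> x)\<^sup>2 - (l2_dist \<nu> x (p m))\<^sup>2) \<longlonglongrightarrow> (l2_norm \<nu> x)\<^sup>2 - 0\<^sup>2"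
    by (intro tendsto_intros)
  thus ?thesis unfolding sums_def * c_def by simp
qed

section \<open>Measurability of Lipschitz functions and comparison with the sup norm\<close>

lemma space_l2_borel [simp]: "space (l2_borel \<nu> S) = S"
  unfolding l2_borel_def by (rule space_measure_of) auto

text \<open>Strict superlevel sets are open for the distance of H, hence generators of
  \<open>l2_borel\<close>. The radius is taken with \<bar>C\<bar> + 1 so that C may be zero or
  negative.\<close>

lemma l2_lipschitz_measurable:
  assumes lip: "\<And>x y. x \<in> S \<Longrightarrow> y \<in> S \<Longrightarrow> \<bar>f x - f y\<bar> \<le> C * l2_dist \<nu> x y"
  shows "f \<in> borel_measurable (l2_borel \<nu> S)"
proof (subst borel_measurable_iff_greater, intro allI)
  fix a :: real
  have "\<exists>\<epsilon>>0. \<forall>y\<in>S. l2_dist \<nu> x y < \<epsilon> \<longrightarrow> y \<in> {w \<in> S. a < f w}" if x: "x \<in> S" "a < f x" for x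
  proof (intro exI conjI ballI impI)
    show "0 < (f x - a) / (\<bar>C\<bar> + 1)" using x by simp
    fix y assume y: "y \<in> S" "l2_dist \<nu> x y < (f x - a) / (\<bar>C\<bar> + 1)"
    have "\<bar>f x - f y\<bar> \<le> C * l2_dist \<nu> x y" by (rule lip[OF x(1) y(1)])
    also have "\<dots> \<le> (\<bar>C\<bar> + 1) * l2_dist \<nu> x y" by (intro mult_right_mono) auto
    also have "\<dots> < f x - a" using y(2) by (simp add: field_simps)
    finally show "y \<in> {w \<in> S. a < f w}" using y(1) by auto
  qed
  hence "{w \<in> S. a < f w} \<in> {U. U \<subseteq> S \<and> (\<forall>x\<in>U. \<exists>\<epsilon>>0. \<forall>y\<in>S. l2_dist \<nu> x y < \<epsilon> \<longrightarrow> y \<in> U)}"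
    by blast
  thus "{w \<in> space (l2_borel \<nu> S). a < f w} \<in> sets (l2_borel \<nu> S)"
    unfolding space_l2_borel unfolding l2_borel_def
    by (subst sets_measure_of) auto
qed

lemma l2_norm_measurable: "l2_norm \<nu> \<in> borel_measurable (l2_borel \<nu> (l2_space \<nu>))"
  by (rule l2_lipschitz_measurable[where C = 1]) (simp add: l2_norm_diff_le)

lemma l2_inner_measurable:
  assumes "z \<in> l2_space \<nu>"
  shows "(\<lambda>x. l2_inner \<nu> x z) \<in> borel_measurable (l2_borel \<nu> (l2_space \<nu>))"
  by (rule l2_lipschitz_measurable[where C = "l2_norm \<nu> z"]) (simp add: l2_inner_lipschitz assms)

text \<open>The bridge from uniform estimates on D, such as covers and compactness of Lipschitz
  balls, to the norm of H and thus to \<open>\<rho>\<close>.\<close>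

lemma l2_dist_le_sup:
  assumes "finite_measure \<nu>" "x \<in> l2_space \<nu>" "y \<in> l2_space \<nu>" "0 \<le> c"
    and le: "\<And>u. u \<in> space \<nu> \<Longrightarrow> \<bar>x u - y u\<bar> \<le> c"
  shows "l2_dist \<nu> x y \<le> sqrt (measure \<nu> (space \<nu>)) * c"
proof -
  interpret finite_measure \<nu> by fact
  have "(\<integral>u. (x u - y u)\<^sup>2 \<partial>\<nu>) \<le> (\<integral>u. c\<^sup>2 \<partial>\<nu>)"
    using l2_spaceD(2)[OF l2_diff[OF assms(2,3)]] le assms(4)
    by (intro integral_mono) (auto simp: abs_le_square_iff[symmetric])
  also have "\<dots> = measure \<nu> (space \<nu>) * c\<^sup>2" by simp
  finally have "sqrt (\<integral>u. (x u - y u)\<^sup>2 \<partial>\<nu>) \<le> sqrt (measure \<nu> (space \<nu>) * c\<^sup>2)"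
    by (rule real_sqrt_le_mono)
  thus ?thesis using assms(4) by (simp add: l2_dist_def l2_norm_def l2_inner_self real_sqrt_mult)
qed

section \<open>Azuma's inequality\<close>

lemma sinh_le_mult_cosh:
  assumes "0 \<le> (y::real)" shows "sinh y \<le> y * cosh y"
proof -
  have "(\<lambda>x. x * cosh x - sinh x) 0 \<le> (\<lambda>x. x * cosh x - sinh x) y"
  proof (rule DERIV_nonneg_imp_nondecreasing[OF assms], intro exI conjI)
    fix x :: real assume "0 \<le> x" "x \<le> y"
    show "((\<lambda>x. x * cosh x - sinh x) has_real_derivative x * sinh x) (at x)"
      by (auto intro!: derivative_eq_intros)
    show "0 \<le> x * sinh x" using \<open>0 \<le> x\<close> by simp
  qed
  thus ?thesis by simp
qed

text \<open>The function cosh x exp (- x^2 / 2) is nonincreasing on the positive axis, because its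
  derivative has the sign of sinh x - x cosh x.\<close>

lemma cosh_le_exp_square: "cosh (y::real) \<le> exp (y\<^sup>2 / 2)"
proof -
  have *: "cosh y \<le> exp (y\<^sup>2 / 2)" if "0 \<le> y" for y :: real
  proof -
    have "(\<lambda>x. cosh x * exp (- (x\<^sup>2 / 2))) y \<le> (\<lambda>x. cosh x * exp (- (x\<^sup>2 / 2))) 0"
    proof (rule DERIV_nonpos_imp_nonincreasing[OF that], intro exI conjI)
      fix x :: real assume "0 \<le> x" "x \<le> y"
      show "((\<lambda>x. cosh x * exp (- (x\<^sup>2 / 2))) has_real_derivative
              (sinh x - x * cosh x) * exp (- (x\<^sup>2 / 2))) (at x)"
        by (auto intro!: derivative_eq_intros simp: algebra_simps)
      show "(sinh x - x * cosh x) * exp (- (x\<^sup>2 / 2)) \<le> 0"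
        using sinh_le_mult_cosh[OF \<open>0 \<le> x\<close>] by (intro mult_nonpos_nonneg) auto
    qed
    thus ?thesis by (simp add: exp_minus field_simps)
  qed
  show ?thesis using *[of y] *[of "-y"] by (cases "0 \<le> y") auto
qed

text \<open>Convexity: x is the mixture of -a and a with weights u and 1 - u, and the chord of the
  exponential is affine in x. Its linear part integrates to zero against a martingale
  difference.\<close>

lemma exp_le_cosh_sinh:
  assumes "\<bar>x\<bar> \<le> a" "0 < (a::real)"
  shows "exp (l * x) \<le> cosh (l * a) + x / a * sinh (l * a)"
proof -
  define u where "u = (a - x) / (2 * a)"
  have u: "0 \<le> u" "0 \<le> 1 - u" "u + (1 - u) = 1" using assms by (auto simp: u_def field_simps)
  have conv: "exp (s * p + t * q) \<le> s * exp p + t * exp q"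
    if "0 \<le> s" "0 \<le> t" "s + t = 1" for s t p q :: real
    using convex_on_exp[of 1] that unfolding convex_on_def by simp
  have "exp (u * (- (l * a)) + (1 - u) * (l * a)) \<le> u * exp (- (l * a)) + (1 - u) * exp (l * a)"
    by (rule conv[OF u])
  also have "u * (- (l * a)) + (1 - u) * (l * a) = l * x"
    using assms by (simp add: u_def field_simps)
  also have "u * exp (- (l * a)) + (1 - u) * exp (l * a) = cosh (l * a) + x / a * sinh (l * a)"
    using assms by (simp add: u_def cosh_def sinh_def field_simps)
  finally show ?thesis .
qed

text \<open>
  The orthogonality hypothesis is the only consequence of the martingale difference property that
  the proof uses.
\<close>

lemma (in prob_space) Azuma_mgf:
  fixes \<Delta> :: "nat \<Rightarrow> 'a \<Rightarrow> real"
  assumes meas [measurable]: "\<And>k. k < m \<Longrightarrow> \<Delta> k \<in> borel_measurable M"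
    and bd: "\<And>k. k < m \<Longrightarrow> AE \<omega> in M. \<bar>\<Delta> k \<omega>\<bar> \<le> a" and a: "0 < a"
    and orth: "\<And>k. k < m \<Longrightarrow> (\<integral>\<omega>. exp (l * (\<Sum>i<k. \<Delta> i \<omega>)) * \<Delta> k \<omega> \<partial>M) = 0"
  shows "integrable M (\<lambda>\<omega>. exp (l * (\<Sum>i<m. \<Delta> i \<omega>)))"
    and "(\<integral>\<omega>. exp (l * (\<Sum>i<m. \<Delta> i \<omega>)) \<partial>M) \<le> exp (real m * (l * a)\<^sup>2 / 2)"
proof -
  \<comment> \<open>The induction also carries an almost sure bound of the exponential, which
    supplies the integrability required at the next step.\<close>
  have "k \<le> m \<Longrightarrow> (AE \<omega> in M. exp (l * (\<Sum>i<k. \<Delta> i \<omega>)) \<le> exp (\<bar>l\<bar> * (real k * a))) \<and>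
     (\<integral>\<omega>. exp (l * (\<Sum>i<k. \<Delta> i \<omega>)) \<partial>M) \<le> exp (real k * (l * a)\<^sup>2 / 2)" for k
  proof (induction k)
    case 0
    show ?case by (simp add: prob_space)
  next
    case (Suc k)
    hence k: "k < m" "k \<le> m" by auto
    define T where "T \<omega> = (\<Sum>i<k. \<Delta> i \<omega>)" for \<omega>
    have Tm [measurable]: "T \<in> borel_measurable M" unfolding T_def using k by (intro borel_measurable_sum meas) auto
    note [measurable] = meas[OF k(1)]
    have IH: "AE \<omega> in M. exp (l * T \<omega>) \<le> exp (\<bar>l\<bar> * (real k * a))"
       "(\<integral>\<omega>. exp (l * T \<omega>) \<partial>M) \<le> exp (real k * (l * a)\<^sup>2 / 2)"
      using Suc.IH[OF k(2)] by (auto simp: T_def)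
    have bd1: "AE \<omega> in M. exp (l * \<Delta> k \<omega>) \<le> exp (\<bar>l\<bar> * a)"
      using bd[OF k(1)]
    proof eventually_elim
      case (elim \<omega>)
      have "l * \<Delta> k \<omega> \<le> \<bar>l\<bar> * \<bar>\<Delta> k \<omega>\<bar>" by (simp add: abs_mult[symmetric])
      also have "\<dots> \<le> \<bar>l\<bar> * a" using elim by (intro mult_left_mono) auto
      finally show ?case by simp
    qed
    have bdS: "AE \<omega> in M. exp (l * (\<Sum>i<Suc k. \<Delta> i \<omega>)) \<le> exp (\<bar>l\<bar> * (real (Suc k) * a))"
      using IH(1) bd1
    proof eventually_elim
      case (elim \<omega>)
      have "exp (l * T \<omega>) * exp (l * \<Delta> k \<omega>) \<le> exp (\<bar>l\<bar> * (real k * a)) * exp (\<bar>l\<bar> * a)"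
        using elim by (intro mult_mono) auto
      thus ?case by (simp add: T_def exp_add[symmetric] algebra_simps)
    qed
    have i1: "integrable M (\<lambda>\<omega>. exp (l * T \<omega>))"
      by (rule integrable_const_bound[where B = "exp (\<bar>l\<bar> * (real k * a))"]) (use IH(1) in auto)
    have i2: "integrable M (\<lambda>\<omega>. exp (l * T \<omega>) * \<Delta> k \<omega>)"
    proof (rule integrable_const_bound[where B = "exp (\<bar>l\<bar> * (real k * a)) * a"])
      show "AE \<omega> in M. norm (exp (l * T \<omega>) * \<Delta> k \<omega>) \<le> exp (\<bar>l\<bar> * (real k * a)) * a"
        using IH(1) bd[OF k(1)] by eventually_elim (auto simp: abs_mult intro!: mult_mono)
    qed measurable
    have i3: "integrable M (\<lambda>\<omega>. exp (l * (\<Sum>i<Suc k. \<Delta> i \<omega>)))"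
    proof (rule integrable_const_bound[where B = "exp (\<bar>l\<bar> * (real (Suc k) * a))"])
      have "(\<lambda>\<omega>. \<Sum>i<Suc k. \<Delta> i \<omega>) \<in> borel_measurable M"
        using k by (intro borel_measurable_sum meas) auto
      thus "(\<lambda>\<omega>. exp (l * (\<Sum>i<Suc k. \<Delta> i \<omega>))) \<in> borel_measurable M" by measurable
    qed (use bdS in auto)
    have "(\<integral>\<omega>. exp (l * (\<Sum>i<Suc k. \<Delta> i \<omega>)) \<partial>M)
        \<le> (\<integral>\<omega>. cosh (l * a) * exp (l * T \<omega>) + sinh (l * a) / a * (exp (l * T \<omega>) * \<Delta> k \<omega>) \<partial>M)"
    proof (rule integral_mono_AE[OF i3])
      show "AE \<omega> in M. exp (l * (\<Sum>i<Suc k. \<Delta> i \<omega>))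
         \<le> cosh (l * a) * exp (l * T \<omega>) + sinh (l * a) / a * (exp (l * T \<omega>) * \<Delta> k \<omega>)"
        using bd[OF k(1)]
      proof eventually_elim
        case (elim \<omega>)
        have "exp (l * (\<Sum>i<Suc k. \<Delta> i \<omega>)) = exp (l * T \<omega>) * exp (l * \<Delta> k \<omega>)"
          by (simp add: T_def exp_add[symmetric] algebra_simps)
        also have "\<dots> \<le> exp (l * T \<omega>) * (cosh (l * a) + \<Delta> k \<omega> / a * sinh (l * a))"
          by (intro mult_left_mono exp_le_cosh_sinh elim a) auto
        finally show ?case by (simp add: algebra_simps)
      qed
    qed (use i1 i2 in auto)
    also have "\<dots> = cosh (l * a) * (\<integral>\<omega>. exp (l * T \<omega>) \<partial>M)"
      using i1 i2 orth[OF k(1)] by (simp add: T_def)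
    also have "\<dots> \<le> exp ((l * a)\<^sup>2 / 2) * exp (real k * (l * a)\<^sup>2 / 2)"
      by (intro mult_mono cosh_le_exp_square IH) (auto intro: integral_nonneg_AE)
    also have "\<dots> = exp (real (Suc k) * (l * a)\<^sup>2 / 2)"
      by (simp add: exp_add[symmetric] algebra_simps)
    finally show ?case using bdS by blast
  qed
  from this[of m] have *: "AE \<omega> in M. exp (l * (\<Sum>i<m. \<Delta> i \<omega>)) \<le> exp (\<bar>l\<bar> * (real m * a))"
    "(\<integral>\<omega>. exp (l * (\<Sum>i<m. \<Delta> i \<omega>)) \<partial>M) \<le> exp (real m * (l * a)\<^sup>2 / 2)" by auto
  show "integrable M (\<lambda>\<omega>. exp (l * (\<Sum>i<m. \<Delta> i \<omega>)))"
  proof (rule integrable_const_bound[where B = "exp (\<bar>l\<bar> * (real m * a))"])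
    have "(\<lambda>\<omega>. \<Sum>i<m. \<Delta> i \<omega>) \<in> borel_measurable M"
      by (intro borel_measurable_sum meas) auto
    thus "(\<lambda>\<omega>. exp (l * (\<Sum>i<m. \<Delta> i \<omega>))) \<in> borel_measurable M" by measurable
  qed (use * in auto)
  show "(\<integral>\<omega>. exp (l * (\<Sum>i<m. \<Delta> i \<omega>)) \<partial>M) \<le> exp (real m * (l * a)\<^sup>2 / 2)" by (rule *)
qed

lemma (in prob_space) Azuma_tail:
  fixes \<Delta> :: "nat \<Rightarrow> 'a \<Rightarrow> real"
  assumes meas [measurable]: "\<And>k. k < m \<Longrightarrow> \<Delta> k \<in> borel_measurable M"
    and bd: "\<And>k. k < m \<Longrightarrow> AE \<omega> in M. \<bar>\<Delta> k \<omega>\<bar> \<le> a" and a: "0 < a"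
    and orth: "\<And>k l. k < m \<Longrightarrow> (\<integral>\<omega>. exp (l * (\<Sum>i<k. \<Delta> i \<omega>)) * \<Delta> k \<omega> \<partial>M) = 0"
    and m: "0 < m" and t: "0 \<le> t"
  shows "prob {\<omega>\<in>space M. t \<le> \<bar>\<Sum>i<m. \<Delta> i \<omega>\<bar>} \<le> 2 * exp (- (t\<^sup>2 / (2 * real m * a\<^sup>2)))"
proof -
  define T where "T \<omega> = (\<Sum>i<m. \<Delta> i \<omega>)" for \<omega>
  have Tm [measurable]: "T \<in> borel_measurable M" unfolding T_def by (intro borel_measurable_sum meas) auto
  \<comment> \<open>The minimiser of m (l a)^2 / 2 - l t in the Chernoff bound.\<close>
  define l where "l = t / (real m * a\<^sup>2)"
  have l: "0 \<le> l" using t by (simp add: l_def)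
  have e1: "real m * (l * a)\<^sup>2 / 2 = t\<^sup>2 / (2 * real m * a\<^sup>2)" and e2: "l * t = 2 * (t\<^sup>2 / (2 * real m * a\<^sup>2))"
    using m a by (simp_all add: l_def field_simps power2_eq_square)
  have one_sided: "prob {\<omega>\<in>space M. t \<le> c * T \<omega>} \<le> exp (- (t\<^sup>2 / (2 * real m * a\<^sup>2)))"
    if c: "c = 1 \<or> c = -1" for c
  proof -
    note mgf = Azuma_mgf[OF meas bd a orth, where l = "l * c"]
    have "prob {\<omega>\<in>space M. t \<le> c * T \<omega>} \<le> prob {\<omega>\<in>space M. exp (l * t) \<le> exp (l * c * T \<omega>)}"
      using l by (intro finite_measure_mono) (auto simp: mult.assoc intro: mult_left_mono)
    also have "\<dots> \<le> (\<integral>\<omega>. exp (l * c * T \<omega>) \<partial>M) / exp (l * t)"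
      using mgf(1) by (intro integral_Markov_inequality_measure[where A = "{}"]) (auto simp: T_def)
    also have "\<dots> \<le> exp (real m * (l * c * a)\<^sup>2 / 2) / exp (l * t)"
      using mgf(2) by (intro divide_right_mono) (auto simp: T_def)
    also have "(l * c * a)\<^sup>2 = (l * a)\<^sup>2" using c by (auto simp: power_mult_distrib)
    also have "exp (real m * (l * a)\<^sup>2 / 2) / exp (l * t) = exp (- (t\<^sup>2 / (2 * real m * a\<^sup>2)))"
      unfolding e1 e2 exp_diff[symmetric] by simp
    finally show ?thesis .
  qed
  have "prob {\<omega>\<in>space M. t \<le> \<bar>T \<omega>\<bar>} \<le> prob ({\<omega>\<in>space M. t \<le> 1 * T \<omega>} \<union> {\<omega>\<in>space M. t \<le> (-1) * T \<omega>})"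
    by (intro finite_measure_mono) auto
  also have "\<dots> \<le> prob {\<omega>\<in>space M. t \<le> 1 * T \<omega>} + prob {\<omega>\<in>space M. t \<le> (-1) * T \<omega>}"
    by (intro measure_Un_le) auto
  also have "\<dots> \<le> 2 * exp (- (t\<^sup>2 / (2 * real m * a\<^sup>2)))"
    using one_sided[of 1] one_sided[of "-1"] by auto
  finally show ?thesis by (simp add: T_def)
qed

section \<open>Lattice boxes and their shells\<close>

lemma card_vec_box:
  fixes A :: "'n::finite \<Rightarrow> 'a set"
  assumes "\<And>i. finite (A i)"
  shows "finite {s :: 'a ^ 'n. \<forall>i. s $ i \<in> A i}" "card {s :: 'a ^ 'n. \<forall>i. s $ i \<in> A i} = (\<Prod>i\<in>UNIV. card (A i))"
proof -
  have bij: "bij_betw vec_nth {s :: 'a ^ 'n. \<forall>i. s $ i \<in> A i} (PiE UNIV A)"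
    by (rule bij_betwI[where g = vec_lambda]) (auto simp: PiE_UNIV_domain)
  show "finite {s :: 'a ^ 'n. \<forall>i. s $ i \<in> A i}"
    using bij_betw_finite[OF bij] assms by (auto intro: finite_PiE)
  show "card {s :: 'a ^ 'n. \<forall>i. s $ i \<in> A i} = (\<Prod>i\<in>UNIV. card (A i))"
    using bij_betw_same_card[OF bij] by (simp add: card_PiE)
qed

lemma index_box_eq: "index_box n = {s. \<forall>i. s $ i \<in> {1..int (n $ i)}}"
  by (auto simp: index_box_def)

lemma finite_index_box [simp]: "finite (index_box n)"
  unfolding index_box_eq by (rule card_vec_box) simp

lemma card_index_box: "card (index_box n) = (\<Prod>i\<in>UNIV. n $ i)"
  unfolding index_box_eq by (subst card_vec_box) auto

lemma card_index_box_le: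
  fixes n :: "nat ^ 'n"
  assumes "\<And>i. n $ i \<le> m" shows "card (index_box n) \<le> m ^ CARD('n)"
  using prod_mono[of "UNIV :: 'n set" "\<lambda>i. n $ i" "\<lambda>_. m"] assms by (simp add: card_index_box)

lemma max_norm_attained: "\<exists>i. max_norm s = \<bar>s $ i\<bar>"
proof -
  have "max_norm s \<in> range (\<lambda>i. \<bar>s $ i\<bar>)" unfolding max_norm_def by (rule Max_in) auto
  thus ?thesis by auto
qed

lemma index_box_max_norm:
  assumes "s \<in> index_box n" "\<And>i. n $ i \<le> m"
  shows "1 \<le> max_norm s" "max_norm s \<le> int m"
proof -
  obtain i where i: "max_norm s = \<bar>s $ i\<bar>" using max_norm_attained by blast
  have "1 \<le> s $ i" "s $ i \<le> int (n $ i)" using assms(1) by (auto simp: index_box_def)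
  thus "1 \<le> max_norm s" "max_norm s \<le> int m" using i assms(2)[of i] by auto
qed

text \<open>Some coordinate attains the maximum norm. Inside the box coordinates are positive, so
  this coordinate equals k while the others range over m values; the factor \<open>CARD('n)\<close>
  counts the choices of the coordinate.\<close>

lemma card_shell_le:
  fixes n :: "nat ^ 'n"
  assumes "\<And>i. n $ i \<le> m"
  shows "card {s \<in> index_box n. max_norm s = k} \<le> CARD('n) * m ^ (CARD('n) - 1)"
proof -
  define A where "A i l = (if l = i then {k} else {1..int m})" for i l :: 'n
  have fin: "finite {s :: int ^ 'n. \<forall>l. s $ l \<in> A i l}" for i
    by (rule card_vec_box) (auto simp: A_def)
  have card: "card {s :: int ^ 'n. \<forall>l. s $ l \<in> A i l} = m ^ (CARD('n) - 1)" for i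
  proof -
    have "card {s :: int ^ 'n. \<forall>l. s $ l \<in> A i l} = (\<Prod>l\<in>UNIV. card (A i l))"
      by (rule card_vec_box) (auto simp: A_def)
    also have "\<dots> = card (A i i) * (\<Prod>l\<in>UNIV - {i}. card (A i l))"
      by (rule prod.remove) auto
    also have "(\<Prod>l\<in>UNIV - {i}. card (A i l)) = (\<Prod>l\<in>UNIV - {i}. m)"
      by (rule prod.cong) (auto simp: A_def)
    finally show ?thesis by (simp add: A_def card_Diff_singleton)
  qed
  have "{s \<in> index_box n. max_norm s = k} \<subseteq> (\<Union>i. {s. \<forall>l. s $ l \<in> A i l})"
  proof
    fix s assume s: "s \<in> {s \<in> index_box n. max_norm s = k}"
    obtain i where i: "max_norm s = \<bar>s $ i\<bar>" using max_norm_attained by blast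
    have b: "1 \<le> s $ l \<and> s $ l \<le> int m" for l
    proof -
      have "1 \<le> s $ l" "s $ l \<le> int (n $ l)" using s by (auto simp: index_box_def)
      thus ?thesis using assms[of l] by linarith
    qed
    have "s $ l \<in> A i l" for l using s i b[of l] b[of i] by (auto simp: A_def)
    thus "s \<in> (\<Union>i. {s. \<forall>l. s $ l \<in> A i l})" by blast
  qed
  hence "card {s \<in> index_box n. max_norm s = k} \<le> card (\<Union>i. {s :: int ^ 'n. \<forall>l. s $ l \<in> A i l})"
    by (rule card_mono[rotated]) (auto simp: fin)
  also have "\<dots> \<le> (\<Sum>i\<in>UNIV. card {s :: int ^ 'n. \<forall>l. s $ l \<in> A i l})"
    by (rule card_UN_le) simp
  also have "\<dots> = CARD('n) * m ^ (CARD('n) - 1)" by (simp add: card)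
  finally show ?thesis .
qed

section \<open>Concentration for weakly dependent fields\<close>

text \<open>The response is an arbitrary bounded real field, so that the denominator
  (\<open>y = 1\<close>) and the truncated coordinates of the numerator are both instances. The
  shift \<open>Suc i\<close> makes the lags start at 1.\<close>

locale weakly_dependent_field = prob_space P
  for P :: "'w measure" and \<nu> :: "(real ^ 'd) measure" and S :: "'d fld set"
    and X :: "int ^ 'n \<Rightarrow> 'w \<Rightarrow> 'd fld" and y :: "int ^ 'n \<Rightarrow> 'w \<Rightarrow> real" and B \<Phi> :: real +
  assumes S_l2: "S \<subseteq> l2_space \<nu>"
    and X_meas: "\<And>s. X s \<in> P \<rightarrow>\<^sub>M l2_borel \<nu> S"
    and y_meas: "\<And>s. y s \<in> borel_measurable P"
    and y_bound: "\<And>s \<omega>. \<omega> \<in> space P \<Longrightarrow> \<bar>y s \<omega>\<bar> \<le> B"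
    and weak_dep: "(\<Sum>i. weak_dep_coeff P \<nu> S X y (Suc i)) \<le> ennreal \<Phi>"
    and \<Phi>_nonneg: "0 \<le> \<Phi>"
begin

lemma B_nonneg: "0 \<le> B"
proof -
  obtain \<omega> where "\<omega> \<in> space P" using not_empty by blast
  thus ?thesis using y_bound[of \<omega> 0] abs_ge_zero[of "y 0 \<omega>"] by linarith
qed

lemma X_space: "\<omega> \<in> space P \<Longrightarrow> X s \<omega> \<in> S"
  using measurable_space[OF X_meas] by simp

definition \<phi> :: "nat \<Rightarrow> real" where "\<phi> i = enn2real (weak_dep_coeff P \<nu> S X y i)"

lemma sum_\<phi>_le: "(\<Sum>i\<in>{1..k}. \<phi> i) \<le> \<Phi>"
  and weak_dep_coeff_eq: "1 \<le> i \<Longrightarrow> weak_dep_coeff P \<nu> S X y i = ennreal (\<phi> i)"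
  and \<phi>_nonneg: "0 \<le> \<phi> i"
proof -
  let ?w = "\<lambda>i. weak_dep_coeff P \<nu> S X y i"
  have fin: "?w (Suc i) < \<infinity>" for i
  proof -
    have "?w (Suc i) = sum (\<lambda>i. ?w (Suc i)) {i}" by simp
    also have "\<dots> \<le> (\<Sum>i. ?w (Suc i))" by (rule sum_le_suminf) auto
    also have "\<dots> < \<infinity>" using weak_dep by (rule le_less_trans) simp
    finally show ?thesis .
  qed
  have eq: "?w (Suc i) = ennreal (\<phi> (Suc i))" for i using fin[of i] by (simp add: \<phi>_def)
  thus "1 \<le> i \<Longrightarrow> ?w i = ennreal (\<phi> i)" by (cases i) auto
  show nn: "0 \<le> \<phi> i" for i by (simp add: \<phi>_def)
  have "ennreal (\<Sum>i<k. \<phi> (Suc i)) = (\<Sum>i<k. ?w (Suc i))"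
    by (simp add: eq nn sum_ennreal)
  also have "\<dots> \<le> (\<Sum>i. ?w (Suc i))" by (rule sum_le_suminf) auto
  also have "\<dots> \<le> ennreal \<Phi>" by (rule weak_dep)
  finally have "(\<Sum>i<k. \<phi> (Suc i)) \<le> \<Phi>" using \<Phi>_nonneg by simp
  moreover have "(\<Sum>i\<in>{1..k}. \<phi> i) = (\<Sum>i<k. \<phi> (Suc i))"
    by (simp add: sum.atLeast1_atMost_eq)
  ultimately show "(\<Sum>i\<in>{1..k}. \<phi> i) \<le> \<Phi>" by simp
qed

lemma past_gen:
  "(\<Union>s\<in>{s. 1 \<le> max_norm s \<and> max_norm s \<le> int k}.
      sets (vimage_algebra (space P) (\<lambda>\<omega>. (X s \<omega>, y s \<omega>)) (l2_borel \<nu> S \<Otimes>\<^sub>M borel))) \<subseteq> sets P"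
proof -
  have "(\<lambda>\<omega>. (X s \<omega>, y s \<omega>)) \<in> P \<rightarrow>\<^sub>M l2_borel \<nu> S \<Otimes>\<^sub>M borel" for s
    using X_meas y_meas by measurable
  hence "sets (vimage_algebra (space P) (\<lambda>\<omega>. (X s \<omega>, y s \<omega>)) (l2_borel \<nu> S \<Otimes>\<^sub>M borel)) \<subseteq> sets P" for s
    by (simp add: measurable_iff_sets)
  thus ?thesis by blast
qed

lemma space_past [simp]: "space (past P \<nu> S X y k) = space P"
  unfolding past_def using past_gen sets.space_closed[of P] by (intro space_measure_of) blast

lemma sets_past: "sets (past P \<nu> S X y k) = sigma_sets (space P) (\<Union>s\<in>{s. 1 \<le> max_norm s \<and> max_norm s \<le> int k}.
      sets (vimage_algebra (space P) (\<lambda>\<omega>. (X s \<omega>, y s \<omega>)) (l2_borel \<nu> S \<Otimes>\<^sub>M borel)))"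
  unfolding past_def using past_gen sets.space_closed[of P] by (intro sets_measure_of) blast

lemma subalgebra_past: "subalgebra P (past P \<nu> S X y k)"
  unfolding subalgebra_def using past_gen[of k] by (auto simp: sets_past intro: sets.sigma_sets_subset[THEN subsetD])

lemma past_mono: "sets (past P \<nu> S X y k) \<subseteq> sets (past P \<nu> S X y (Suc k))"
  unfolding sets_past by (rule sigma_sets_mono') auto

lemma finite_measure_subalgebra_past: "finite_measure_subalgebra P (past P \<nu> S X y k)"
  by unfold_locales (rule subalgebra_past)

lemma past_measurable:
  assumes f: "f \<in> borel_measurable (l2_borel \<nu> S)" and s: "1 \<le> max_norm s" "max_norm s \<le> int k"
  shows "(\<lambda>\<omega>. y s \<omega> * f (X s \<omega>)) \<in> borel_measurable (past P \<nu> S X y k)"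
proof -
  let ?V = "vimage_algebra (space P) (\<lambda>\<omega>. (X s \<omega>, y s \<omega>)) (l2_borel \<nu> S \<Otimes>\<^sub>M borel)"
  have "(\<lambda>\<omega>. (X s \<omega>, y s \<omega>)) \<in> ?V \<rightarrow>\<^sub>M (l2_borel \<nu> S \<Otimes>\<^sub>M borel)"
    by (rule measurable_vimage_algebra1) (auto simp: space_pair_measure X_space)
  hence "(\<lambda>\<omega>. (X s \<omega>, y s \<omega>)) \<in> past P \<nu> S X y k \<rightarrow>\<^sub>M (l2_borel \<nu> S \<Otimes>\<^sub>M borel)"
    by (rule measurable_mono[THEN subsetD, rotated -1])
       (use s in \<open>auto simp: sets_past\<close>)
  moreover have "(\<lambda>(x, v). v * f x) \<in> borel_measurable (l2_borel \<nu> S \<Otimes>\<^sub>M borel)"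
    using f by measurable
  ultimately have "(\<lambda>\<omega>. (\<lambda>(x, v). v * f x) (X s \<omega>, y s \<omega>)) \<in> borel_measurable (past P \<nu> S X y k)"
    by (rule measurable_compose)
  thus ?thesis by simp
qed

text \<open>The coefficient bounds the conditional mean of y g / c, where c is the essential
  supremum of y and g has Lipschitz constant at most one. Here g is f / \<Lambda>, and scaling back
  costs c \<Lambda> <= B \<Lambda>.\<close>

lemma cond_exp_past_bound:
  assumes lip: "\<And>z z'. z \<in> S \<Longrightarrow> z' \<in> S \<Longrightarrow> \<bar>f z - f z'\<bar> \<le> \<Lambda> * l2_dist \<nu> z z'" and \<Lambda>: "0 < \<Lambda>"
    and bd: "\<And>z. z \<in> S \<Longrightarrow> \<bar>f z\<bar> \<le> b"
    and s: "\<And>l. 1 \<le> s $ l" "max_norm s = int (k + i)" and k: "1 \<le> k" and i: "1 \<le> i"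
  shows "AE \<omega> in P. \<bar>real_cond_exp P (past P \<nu> S X y k) (\<lambda>\<omega>. y s \<omega> * f (X s \<omega>)) \<omega>
            - (\<integral>\<omega>. y s \<omega> * f (X s \<omega>) \<partial>P)\<bar> \<le> B * \<Lambda> * \<phi> i"
proof -
  interpret finite_measure_subalgebra P "past P \<nu> S X y k" by (rule finite_measure_subalgebra_past)
  define g where "g z = f z / \<Lambda>" for z
  define c where "c = enn2real (Linf_norm P (y s))"
  define V where "V \<omega> = y s \<omega> / c * g (X s \<omega>)" for \<omega>
  have fm [measurable]: "f \<in> borel_measurable (l2_borel \<nu> S)" by (rule l2_lipschitz_measurable) (rule lip)
  note [measurable] = X_meas[of s] y_meas[of s]
  have gm [measurable]: "g \<in> borel_measurable (l2_borel \<nu> S)" unfolding g_def by measurable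
  have glip: "\<bar>g z - g z'\<bar> \<le> l2_dist \<nu> z z'" if "z \<in> S" "z' \<in> S" for z z'
    using lip[OF that] \<Lambda> by (simp add: g_def diff_divide_distrib[symmetric] abs_divide field_simps)
  have g1: "g \<in> bdd_funs \<nu> S" unfolding bdd_funs_def
  proof (intro CollectI conjI ballI impI)
    fix z z' assume "z \<in> S" "z' \<in> S" "AE u in \<nu>. z u = z' u"
    thus "g z = g z'" using glip[of z z'] l2_dist_eq_0[of z z' \<nu>] subsetD[OF S_l2] by auto
  next
    have "(SUP x\<in>S. ennreal \<bar>g x\<bar>) \<le> ennreal (b / \<Lambda>)"
      using bd \<Lambda> by (intro SUP_least ennreal_leI) (simp add: g_def abs_divide divide_right_mono)
    also have "\<dots> < \<infinity>" by simp
    finally show "(SUP x\<in>S. ennreal \<bar>g x\<bar>) < \<infinity>" .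
  qed
  have g2: "lip_pseudo_norm \<nu> S g \<le> 1" unfolding lip_pseudo_norm_def
  proof (rule SUP_least, clarify)
    fix z z' assume z: "z \<in> S" "z' \<in> S" "\<not> (AE u in \<nu>. z u = z' u)"
    have "0 < l2_dist \<nu> z z'" using z S_l2 by (intro l2_dist_pos) auto
    thus "ennreal (\<bar>g z - g z'\<bar> / l2_dist \<nu> z z') \<le> 1" using glip[OF z(1,2)] by simp
  qed
  have Linf: "Linf_norm P (y s) \<le> ennreal B" unfolding Linf_norm_def
    by (rule esssup_I) (auto intro!: AE_I2 ennreal_leI y_bound)
  hence cB: "c \<le> B" unfolding c_def by (rule enn2real_leI[OF B_nonneg])
  have c0: "0 \<le> c" by (simp add: c_def)
  have Lc: "Linf_norm P (y s) = ennreal c"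
    using Linf unfolding c_def by (metis ennreal_enn2real ennreal_less_top le_less_trans)
  have yc: "AE \<omega> in P. \<bar>y s \<omega>\<bar> \<le> c"
    using esssup_AE[of "\<lambda>\<omega>. ennreal \<bar>y s \<omega>\<bar>" P] unfolding Linf_norm_def[symmetric] Lc
    by eventually_elim (use c0 in simp)
  \<comment> \<open>If c = 0, then y vanishes almost surely and both sides are zero, so division by
    zero does no harm.\<close>
  have eq: "AE \<omega> in P. y s \<omega> * f (X s \<omega>) = (c * \<Lambda>) * V \<omega>"
    using yc by eventually_elim (use \<Lambda> in \<open>auto simp: V_def g_def\<close>)
  have Vm [measurable]: "V \<in> borel_measurable P" unfolding V_def by measurable
  have Vi: "integrable P V"
  proof (rule integrable_const_bound[where B = "B / c * (b / \<Lambda>)"])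
    show "AE \<omega> in P. norm (V \<omega>) \<le> B / c * (b / \<Lambda>)"
    proof (rule AE_I2)
      fix \<omega> assume w: "\<omega> \<in> space P"
      have "\<bar>y s \<omega>\<bar> / c * (\<bar>f (X s \<omega>)\<bar> / \<Lambda>) \<le> B / c * (b / \<Lambda>)"
        using y_bound[OF w, of s] bd[OF X_space[OF w, of s]] c0 \<Lambda> B_nonneg
        by (intro mult_mono divide_right_mono) auto
      thus "norm (V \<omega>) \<le> B / c * (b / \<Lambda>)" using c0 \<Lambda> by (simp add: V_def g_def abs_mult abs_divide)
    qed
  qed simp
  have "Linf_norm P (\<lambda>\<omega>. real_cond_exp P (past P \<nu> S X y k) V \<omega> - (\<integral>\<omega>. V \<omega> \<partial>P))
      \<le> weak_dep_coeff P \<nu> S X y i"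
    unfolding weak_dep_coeff_def V_def c_def using g1 g2 s k
    by (intro Sup_upper) blast
  also have "\<dots> = ennreal (\<phi> i)" by (rule weak_dep_coeff_eq[OF i])
  finally have L: "esssup P (\<lambda>\<omega>. ennreal \<bar>real_cond_exp P (past P \<nu> S X y k) V \<omega> - (\<integral>\<omega>. V \<omega> \<partial>P)\<bar>) \<le> ennreal (\<phi> i)"
    by (simp add: Linf_norm_def)
  have V: "AE \<omega> in P. \<bar>real_cond_exp P (past P \<nu> S X y k) V \<omega> - (\<integral>\<omega>. V \<omega> \<partial>P)\<bar> \<le> \<phi> i"
    using esssup_AE[of "\<lambda>\<omega>. ennreal \<bar>real_cond_exp P (past P \<nu> S X y k) V \<omega> - (\<integral>\<omega>. V \<omega> \<partial>P)\<bar>" P]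
  proof eventually_elim
    case (elim \<omega>)
    from elim L have "ennreal \<bar>real_cond_exp P (past P \<nu> S X y k) V \<omega> - (\<integral>\<omega>. V \<omega> \<partial>P)\<bar> \<le> ennreal (\<phi> i)"
      by (rule order_trans)
    thus ?case using \<phi>_nonneg by simp
  qed
  have int: "(\<integral>\<omega>. y s \<omega> * f (X s \<omega>) \<partial>P) = (c * \<Lambda>) * (\<integral>\<omega>. V \<omega> \<partial>P)"
    using integral_cong_AE[OF _ _ eq] by simp
  have "AE \<omega> in P. real_cond_exp P (past P \<nu> S X y k) (\<lambda>\<omega>. y s \<omega> * f (X s \<omega>)) \<omega>
      = real_cond_exp P (past P \<nu> S X y k) (\<lambda>\<omega>. (c * \<Lambda>) * V \<omega>) \<omega>"
    by (rule real_cond_exp_cong[OF eq]) auto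
  moreover have "AE \<omega> in P. real_cond_exp P (past P \<nu> S X y k) (\<lambda>\<omega>. (c * \<Lambda>) * V \<omega>) \<omega>
      = (c * \<Lambda>) * real_cond_exp P (past P \<nu> S X y k) V \<omega>"
    by (rule real_cond_exp_cmult[OF Vi])
  ultimately show ?thesis using V
  proof eventually_elim
    case (elim \<omega>)
    have "\<bar>real_cond_exp P (past P \<nu> S X y k) (\<lambda>\<omega>. y s \<omega> * f (X s \<omega>)) \<omega> - (\<integral>\<omega>. y s \<omega> * f (X s \<omega>) \<partial>P)\<bar>
      = (c * \<Lambda>) * \<bar>real_cond_exp P (past P \<nu> S X y k) V \<omega> - (\<integral>\<omega>. V \<omega> \<partial>P)\<bar>"
      using elim(1,2) c0 \<Lambda> unfolding int by (simp add: right_diff_distrib[symmetric] abs_mult)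
    also have "\<dots> \<le> (B * \<Lambda>) * \<phi> i"
      using elim(3) c0 cB \<Lambda> B_nonneg by (intro mult_mono) auto
    finally show ?case by simp
  qed
qed

text \<open>The martingale E[T | past k] is compared with the sum A of the first k shells. Sites up
  to k are known; a site on shell j > k adds at most B \<Lambda> \<phi>(j - k), and a shell has at
  most c sites, so the two differ by at most c B \<Lambda> \<Phi> whatever k is. The increments are
  therefore those of A up to a constant multiple of the shell size.\<close>

lemma concentration:
  fixes n :: "nat ^ 'n"
  assumes n: "\<And>i. n $ i \<le> m" and m: "1 \<le> m"
    and lip: "\<And>z z'. z \<in> S \<Longrightarrow> z' \<in> S \<Longrightarrow> \<bar>f z - f z'\<bar> \<le> \<Lambda> * l2_dist \<nu> z z'" and \<Lambda>: "0 < \<Lambda>"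
    and bd: "\<And>z. z \<in> S \<Longrightarrow> \<bar>f z\<bar> \<le> b" and b: "0 < b" and B: "0 < B" and t: "0 \<le> t"
  shows "prob {\<omega>\<in>space P. t * real m ^ CARD('n) \<le>
            \<bar>\<Sum>s\<in>index_box n. y s \<omega> * f (X s \<omega>) - (\<integral>\<omega>. y s \<omega> * f (X s \<omega>) \<partial>P)\<bar>}
         \<le> 2 * exp (- (t\<^sup>2 * real m / (8 * (real CARD('n))\<^sup>2 * B\<^sup>2 * (b + \<Lambda> * \<Phi>)\<^sup>2)))"
proof -
  let ?I = "index_box n"
  define rad where "rad s = nat (max_norm s)" for s :: "int ^ 'n"
  have rad: "1 \<le> rad s" "rad s \<le> m" "max_norm s = int (rad s)" if "s \<in> ?I" for s
    using index_box_max_norm[OF that n] by (auto simp: rad_def)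
  define V where "V s \<omega> = y s \<omega> * f (X s \<omega>) - (\<integral>\<omega>. y s \<omega> * f (X s \<omega>) \<partial>P)" for s \<omega>
  define T where "T \<omega> = (\<Sum>s\<in>?I. V s \<omega>)" for \<omega>
  define c where "c = real (CARD('n) * m ^ (CARD('n) - 1))"
  have c: "0 < c" using m by (simp add: c_def)
  have shell: "real (card {s\<in>?I. rad s = j}) \<le> c" for j
  proof -
    have "card {s\<in>?I. rad s = j} \<le> card {s\<in>?I. max_norm s = int j}"
      by (rule card_mono) (auto simp: rad)
    also have "\<dots> \<le> CARD('n) * m ^ (CARD('n) - 1)" by (rule card_shell_le[OF n])
    finally show ?thesis unfolding c_def by (simp only: of_nat_le_iff)
  qed
  have fm [measurable]: "f \<in> borel_measurable (l2_borel \<nu> S)" by (rule l2_lipschitz_measurable) (rule lip)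
  note [measurable] = X_meas y_meas
  have yf: "\<bar>y s \<omega> * f (X s \<omega>)\<bar> \<le> B * b" if "\<omega> \<in> space P" for s \<omega>
    unfolding abs_mult using y_bound[OF that] bd[OF X_space[OF that]] B by (intro mult_mono) auto
  have yfi: "integrable P (\<lambda>\<omega>. y s \<omega> * f (X s \<omega>))" for s
    by (rule integrable_const_bound[where B = "B * b"]) (auto intro!: AE_I2 yf)
  have Vi: "integrable P (V s)" for s
    unfolding V_def using yfi by auto
  have V0: "(\<integral>\<omega>. V s \<omega> \<partial>P) = 0" for s
    unfolding V_def using yfi by (simp add: prob_space)
  have yfE: "\<bar>\<integral>\<omega>. y s \<omega> * f (X s \<omega>) \<partial>P\<bar> \<le> B * b" for s
  proof -
    have "\<bar>\<integral>\<omega>. y s \<omega> * f (X s \<omega>) \<partial>P\<bar> \<le> (\<integral>\<omega>. \<bar>y s \<omega> * f (X s \<omega>)\<bar> \<partial>P)"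
      by (rule integral_abs_bound)
    also have "\<dots> \<le> (\<integral>\<omega>. B * b \<partial>P)"
      using yfi by (intro integral_mono) (auto intro: yf)
    finally show ?thesis by (simp add: prob_space)
  qed
  have Vb: "\<bar>V s \<omega>\<bar> \<le> 2 * B * b" if "\<omega> \<in> space P" for s \<omega>
    using yf[OF that, of s] yfE[of s] by (simp add: V_def)
  have Ti: "integrable P T" unfolding T_def using Vi by auto
  have Tm [measurable]: "T \<in> borel_measurable P" using Ti by auto
  have T0: "(\<integral>\<omega>. T \<omega> \<partial>P) = 0" unfolding T_def using Vi by (simp add: V0)
  define M where "M k = past P \<nu> S X y k" for k
  \<comment> \<open>The start is the mean of T, which is zero; the coefficients are available from k
    = 1 on.\<close>
  define Z where "Z k = (if k = 0 then (\<lambda>_. 0) else real_cond_exp P (M k) T)" for k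
  define A where "A k \<omega> = (\<Sum>s\<in>{s\<in>?I. rad s \<le> k}. V s \<omega>)" for k \<omega>
  have ZA: "AE \<omega> in P. \<bar>Z k \<omega> - A k \<omega>\<bar> \<le> c * B * \<Lambda> * \<Phi>" for k
  proof (cases "k = 0")
    case True
    have "{s\<in>?I. rad s \<le> 0} = {}" using rad(1) by force
    hence "A 0 \<omega> = 0" for \<omega> unfolding A_def by (simp only: sum.empty)
    thus ?thesis using True c B \<Lambda> \<Phi>_nonneg by (simp add: Z_def)
  next
    case False
    interpret finite_measure_subalgebra P "M k" unfolding M_def by (rule finite_measure_subalgebra_past)
    have 1: "AE \<omega> in P. Z k \<omega> = (\<Sum>s\<in>?I. real_cond_exp P (M k) (V s) \<omega>)"
      unfolding Z_def T_def using False Vi by (simp add: real_cond_exp_sum)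
    have 2: "AE \<omega> in P. \<forall>s\<in>?I. \<bar>real_cond_exp P (M k) (V s) \<omega> - (if rad s \<le> k then V s \<omega> else 0)\<bar>
              \<le> (if rad s \<le> k then 0 else B * \<Lambda> * \<phi> (rad s - k))"
    proof (rule AE_finite_allI)
      fix s assume s: "s \<in> ?I"
      show "AE \<omega> in P. \<bar>real_cond_exp P (M k) (V s) \<omega> - (if rad s \<le> k then V s \<omega> else 0)\<bar>
              \<le> (if rad s \<le> k then 0 else B * \<Lambda> * \<phi> (rad s - k))"
      proof (cases "rad s \<le> k")
        case True
        have "V s \<in> borel_measurable (M k)" unfolding V_def M_def
          using past_measurable[OF fm, of s k] rad[OF s] True
          by (intro borel_measurable_diff) auto
        from real_cond_exp_F_meas[OF Vi this] show ?thesis using True by simp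
      next
        case ge: False
        have sl: "1 \<le> s $ l" for l using s by (auto simp: index_box_def)
        have e: "max_norm s = int (k + (rad s - k))" using rad[OF s] ge by simp
        have "AE \<omega> in P. \<bar>real_cond_exp P (M k) (\<lambda>\<omega>. y s \<omega> * f (X s \<omega>)) \<omega> - (\<integral>\<omega>. y s \<omega> * f (X s \<omega>) \<partial>P)\<bar>
             \<le> B * \<Lambda> * \<phi> (rad s - k)"
          unfolding M_def by (rule cond_exp_past_bound[OF lip \<Lambda> bd sl e]) (use False ge in auto)
        moreover have "AE \<omega> in P. real_cond_exp P (M k) (V s) \<omega>
            = real_cond_exp P (M k) (\<lambda>\<omega>. y s \<omega> * f (X s \<omega>)) \<omega>
              - real_cond_exp P (M k) (\<lambda>_. \<integral>\<omega>. y s \<omega> * f (X s \<omega>) \<partial>P) \<omega>"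
          unfolding V_def by (rule real_cond_exp_diff[OF yfi]) simp
        moreover have "AE \<omega> in P. real_cond_exp P (M k) (\<lambda>_. \<integral>\<omega>. y s \<omega> * f (X s \<omega>) \<partial>P) \<omega>
              = (\<integral>\<omega>. y s \<omega> * f (X s \<omega>) \<partial>P)"
          by (rule real_cond_exp_F_meas) auto
        ultimately show ?thesis
          by eventually_elim (use ge in auto)
      qed
    qed simp
    have 3: "(\<Sum>s\<in>?I. if rad s \<le> k then 0 else B * \<Lambda> * \<phi> (rad s - k)) \<le> c * B * \<Lambda> * \<Phi>"
    proof -
      let ?h = "\<lambda>s. if rad s \<le> k then 0 else B * \<Lambda> * \<phi> (rad s - k)"
      \<comment> \<open>Shells beyond m are empty; summing up to k + m makes the shift by k land
        exactly on {1..m}.\<close>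
      have "(\<Sum>s\<in>?I. ?h s) = (\<Sum>j\<in>{1..k+m}. \<Sum>s\<in>{s\<in>?I. rad s = j}. ?h s)"
        by (rule sum.group[symmetric]) (use rad in force)+
      also have "\<dots> \<le> (\<Sum>j\<in>{1..k+m}. c * (if j \<le> k then 0 else B * \<Lambda> * \<phi> (j - k)))"
      proof (rule sum_mono)
        fix j
        have "(\<Sum>s\<in>{s\<in>?I. rad s = j}. ?h s) = real (card {s\<in>?I. rad s = j}) * (if j \<le> k then 0 else B * \<Lambda> * \<phi> (j - k))"
          by simp
        also have "\<dots> \<le> c * (if j \<le> k then 0 else B * \<Lambda> * \<phi> (j - k))"
          using B \<Lambda> \<phi>_nonneg by (intro mult_right_mono shell) auto
        finally show "(\<Sum>s\<in>{s\<in>?I. rad s = j}. ?h s) \<le> c * (if j \<le> k then 0 else B * \<Lambda> * \<phi> (j - k))" .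
      qed
      also have "\<dots> = (\<Sum>j\<in>{k+1..k+m}. c * (B * \<Lambda> * \<phi> (j - k)))"
        by (rule sum.mono_neutral_cong_right) auto
      also have "\<dots> = (\<Sum>i\<in>{1..m}. c * (B * \<Lambda> * \<phi> i))"
        by (rule sum.reindex_bij_witness[where i = "\<lambda>i. i + k" and j = "\<lambda>j. j - k"]) auto
      also have "\<dots> = c * B * \<Lambda> * (\<Sum>i\<in>{1..m}. \<phi> i)" by (simp add: sum_distrib_left mult.assoc)
      also have "\<dots> \<le> c * B * \<Lambda> * \<Phi>" using c B \<Lambda> by (intro mult_left_mono sum_\<phi>_le) auto
      finally show ?thesis .
    qed
    show ?thesis using 1 2
    proof eventually_elim
      case (elim \<omega>)
      have "A k \<omega> = (\<Sum>s\<in>?I. if rad s \<le> k then V s \<omega> else 0)"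
        unfolding A_def by (simp add: sum.If_cases Int_def)
      hence "\<bar>Z k \<omega> - A k \<omega>\<bar> = \<bar>\<Sum>s\<in>?I. real_cond_exp P (M k) (V s) \<omega> - (if rad s \<le> k then V s \<omega> else 0)\<bar>"
        by (simp add: elim(1) sum_subtractf)
      also have "\<dots> \<le> (\<Sum>s\<in>?I. \<bar>real_cond_exp P (M k) (V s) \<omega> - (if rad s \<le> k then V s \<omega> else 0)\<bar>)"
        by (rule sum_abs)
      also have "\<dots> \<le> (\<Sum>s\<in>?I. if rad s \<le> k then 0 else B * \<Lambda> * \<phi> (rad s - k))"
        using elim(2) by (intro sum_mono) blast
      also note 3
      finally show ?case .
    qed
  qed
  have AA: "\<bar>A (Suc k) \<omega> - A k \<omega>\<bar> \<le> c * (2 * B * b)" if w: "\<omega> \<in> space P" for k \<omega>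
  proof -
    have "A (Suc k) \<omega> = A k \<omega> + (\<Sum>s\<in>{s\<in>?I. rad s = Suc k}. V s \<omega>)"
      unfolding A_def by (subst sum.union_disjoint[symmetric]) (auto intro!: sum.cong)
    hence "\<bar>A (Suc k) \<omega> - A k \<omega>\<bar> \<le> (\<Sum>s\<in>{s\<in>?I. rad s = Suc k}. \<bar>V s \<omega>\<bar>)" by simp
    also have "\<dots> \<le> (\<Sum>s\<in>{s\<in>?I. rad s = Suc k}. 2 * B * b)"
      by (rule sum_mono) (rule Vb[OF w])
    also have "\<dots> = real (card {s\<in>?I. rad s = Suc k}) * (2 * B * b)" by simp
    also have "\<dots> \<le> c * (2 * B * b)" using B b by (intro mult_right_mono shell) auto
    finally show ?thesis .
  qed
  \<comment> \<open>One shell of centred terms gives 2 c B b; comparing the martingale with A at k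
    and at k + 1 gives c B \<Lambda> \<Phi> twice.\<close>
  define a where "a = 2 * c * B * (b + \<Lambda> * \<Phi>)"
  have bp: "0 < b + \<Lambda> * \<Phi>" using b \<Lambda> \<Phi>_nonneg by (simp add: add_pos_nonneg)
  have a: "0 < a" unfolding a_def using c B bp by simp
  define \<Delta> where "\<Delta> k \<omega> = Z (Suc k) \<omega> - Z k \<omega>" for k \<omega>
  have Zm [measurable]: "Z k \<in> borel_measurable P" for k unfolding Z_def by simp
  have Dm: "\<Delta> k \<in> borel_measurable P" for k unfolding \<Delta>_def by measurable
  have Db: "AE \<omega> in P. \<bar>\<Delta> k \<omega>\<bar> \<le> a" for k
    using ZA[of k] ZA[of "Suc k"] AE_space
  proof eventually_elim
    case (elim \<omega>)
    have "\<bar>\<Delta> k \<omega>\<bar> \<le> c * (2 * B * b) + c * B * \<Lambda> * \<Phi> + c * B * \<Lambda> * \<Phi>"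
      using elim AA[OF elim(3), of k] unfolding \<Delta>_def by linarith
    thus ?case by (simp add: a_def algebra_simps)
  qed
  have tele: "(\<Sum>i<k. \<Delta> i \<omega>) = Z k \<omega>" for k \<omega>
    unfolding \<Delta>_def by (subst sum_lessThan_telescope) (simp add: Z_def)
  have Zb: "AE \<omega> in P. \<bar>Z k \<omega>\<bar> \<le> real k * a" for k
  proof -
    have "AE \<omega> in P. \<forall>i\<in>{..<k}. \<bar>\<Delta> i \<omega>\<bar> \<le> a" by (rule AE_finite_allI) (auto intro: Db)
    thus ?thesis
    proof eventually_elim
      case (elim \<omega>)
      have "\<bar>\<Sum>i<k. \<Delta> i \<omega>\<bar> \<le> (\<Sum>i<k. \<bar>\<Delta> i \<omega>\<bar>)" by (rule sum_abs)
      also have "\<dots> \<le> (\<Sum>i<k. a)" using elim by (intro sum_mono) auto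
      finally show ?case by (simp add: tele)
    qed
  qed
  \<comment> \<open>The weight W depends on the martingale up to k and is measurable for both
    \<sigma>-algebras, so both conditional expectations integrate against it to the integral of W
    T.\<close>
  have orth: "(\<integral>\<omega>. exp (l * (\<Sum>i<k. \<Delta> i \<omega>)) * \<Delta> k \<omega> \<partial>P) = 0" for k l
  proof -
    interpret S1: finite_measure_subalgebra P "M (Suc k)" unfolding M_def by (rule finite_measure_subalgebra_past)
    show ?thesis
    proof (cases "k = 0")
      case True
      thus ?thesis using S1.real_cond_exp_int(2)[OF Ti] T0 by (simp add: \<Delta>_def Z_def)
    next
      case False
      interpret S0: finite_measure_subalgebra P "M k" unfolding M_def by (rule finite_measure_subalgebra_past)
      define W where "W \<omega> = exp (l * Z k \<omega>)" for \<omega>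
      have Z0: "Z k \<in> borel_measurable (M k)" unfolding Z_def using False by simp
      have W0: "W \<in> borel_measurable (M k)" unfolding W_def using Z0 by measurable
      have W1: "W \<in> borel_measurable (M (Suc k))"
        by (rule measurable_mono[THEN subsetD, OF _ _ _ _ W0]) (auto simp: M_def past_mono)
      have Wm [measurable]: "W \<in> borel_measurable P" unfolding W_def by measurable
      have WT: "integrable P (\<lambda>\<omega>. W \<omega> * T \<omega>)"
      proof (rule Bochner_Integration.integrable_bound)
        show "integrable P (\<lambda>\<omega>. exp (\<bar>l\<bar> * (real k * a)) * T \<omega>)" using Ti by simp
        show "AE \<omega> in P. norm (W \<omega> * T \<omega>) \<le> norm (exp (\<bar>l\<bar> * (real k * a)) * T \<omega>)"
          using Zb[of k]
        proof eventually_elim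
          case (elim \<omega>)
          have "l * Z k \<omega> \<le> \<bar>l\<bar> * \<bar>Z k \<omega>\<bar>" by (simp add: abs_mult[symmetric])
          also have "\<dots> \<le> \<bar>l\<bar> * (real k * a)" using elim by (intro mult_left_mono) auto
          finally have "W \<omega> \<le> exp (\<bar>l\<bar> * (real k * a))" by (simp add: W_def)
          thus ?case by (auto simp: abs_mult W_def intro!: mult_right_mono)
        qed
      qed simp
      note R1 = S1.real_cond_exp_intg[OF WT W1 Tm] and R0 = S0.real_cond_exp_intg[OF WT W0 Tm]
      have "(\<integral>\<omega>. exp (l * (\<Sum>i<k. \<Delta> i \<omega>)) * \<Delta> k \<omega> \<partial>P)
          = (\<integral>\<omega>. W \<omega> * real_cond_exp P (M (Suc k)) T \<omega> - W \<omega> * real_cond_exp P (M k) T \<omega> \<partial>P)"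
        unfolding tele using False by (simp add: \<Delta>_def W_def Z_def right_diff_distrib)
      also have "\<dots> = 0" using R1 R0 by simp
      finally show ?thesis .
    qed
  qed
  \<comment> \<open>Every site of the box has norm at most m, so conditioning on the past up to m
    changes nothing.\<close>
  have ZT: "AE \<omega> in P. Z m \<omega> = T \<omega>"
  proof -
    interpret finite_measure_subalgebra P "M m" unfolding M_def by (rule finite_measure_subalgebra_past)
    have "T \<in> borel_measurable (M m)" unfolding T_def V_def M_def
      using past_measurable[OF fm, of _ m] rad
      by (intro borel_measurable_sum borel_measurable_diff) auto
    from real_cond_exp_F_meas[OF Ti this] show ?thesis using m by (simp add: Z_def)
  qed
  define u where "u = t * real m ^ CARD('n)"
  have u: "0 \<le> u" using t by (simp add: u_def)
  have "prob {\<omega>\<in>space P. u \<le> \<bar>T \<omega>\<bar>} = prob {\<omega>\<in>space P. u \<le> \<bar>Z m \<omega>\<bar>}"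
  proof (rule measure_eq_AE)
    show "AE \<omega> in P. (\<omega> \<in> {\<omega>\<in>space P. u \<le> \<bar>T \<omega>\<bar>}) = (\<omega> \<in> {\<omega>\<in>space P. u \<le> \<bar>Z m \<omega>\<bar>})"
      using ZT by eventually_elim simp
  qed measurable
  also have "\<dots> \<le> 2 * exp (- (u\<^sup>2 / (2 * real m * a\<^sup>2)))"
    using Azuma_tail[of m \<Delta> a u, OF Dm Db a orth _ u] m by (simp add: tele)
  \<comment> \<open>With u = t m^N and a proportional to m^(N-1), all powers of m cancel except a
    single factor m.\<close>
  also have "u\<^sup>2 / (2 * real m * a\<^sup>2) = t\<^sup>2 * real m / (8 * (real CARD('n))\<^sup>2 * B\<^sup>2 * (b + \<Lambda> * \<Phi>)\<^sup>2)"
  proof -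
    have "real m ^ CARD('n) = real m * real m ^ (CARD('n) - 1)"
      by (metis Suc_pred' power_Suc zero_less_card_finite)
    hence u2: "u = t * real m * real m ^ (CARD('n) - 1)" by (simp add: u_def)
    have alg: "(t * x * w)\<^sup>2 / (2 * x * (2 * (v * w) * B * q)\<^sup>2) = t\<^sup>2 * x / (8 * v\<^sup>2 * B\<^sup>2 * q\<^sup>2)"
      if "0 < x" "0 < w" "0 < q" "0 < v" for x w q v :: real
      using that B by (simp add: field_simps power2_eq_square)
    show ?thesis unfolding u2 a_def c_def of_nat_mult of_nat_power
      by (rule alg) (use m bp in auto)
  qed
  finally show ?thesis unfolding T_def V_def u_def .
qed

end

section \<open>Lipschitz balls\<close>

lemma lip_ballD:
  assumes x: "x \<in> lip_ball D R" and R: "0 \<le> R"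
  shows "continuous_on D x" "u \<in> D \<Longrightarrow> \<bar>x u\<bar> \<le> R"
    "u \<in> D \<Longrightarrow> v \<in> D \<Longrightarrow> \<bar>x u - x v\<bar> \<le> R * norm (u - v)"
proof -
  show "continuous_on D x" using x by (simp add: lip_ball_def)
  have le: "lip_norm D x \<le> ennreal R" using x by (simp add: lip_ball_def)
  have 1: "(SUP u\<in>D. ennreal \<bar>x u\<bar>) \<le> ennreal R"
    by (rule order_trans[OF _ le]) (simp add: lip_norm_def)
  have 2: "(SUP (u, v)\<in>{(u, v). u \<in> D \<and> v \<in> D \<and> u \<noteq> v}. ennreal (\<bar>x u - x v\<bar> / norm (u - v))) \<le> ennreal R"
    by (rule order_trans[OF _ le]) (simp add: lip_norm_def)
  show "\<bar>x u\<bar> \<le> R" if "u \<in> D"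
    using order_trans[OF SUP_upper[OF that, of "\<lambda>u. ennreal \<bar>x u\<bar>"] 1] R by simp
  show "\<bar>x u - x v\<bar> \<le> R * norm (u - v)" if uv: "u \<in> D" "v \<in> D"
  proof (cases "u = v")
    case False
    have "(\<lambda>(u, v). ennreal (\<bar>x u - x v\<bar> / norm (u - v))) (u, v) \<le> ennreal R"
      by (rule order_trans[OF SUP_upper 2]) (use uv False in auto)
    hence "\<bar>x u - x v\<bar> / norm (u - v) \<le> R" using R by simp
    thus ?thesis using False by (simp add: field_simps)
  qed simp
qed

lemma lip_ball_mono: "R \<le> R' \<Longrightarrow> lip_ball D R \<subseteq> lip_ball D R'"
  unfolding lip_ball_def using order_trans[OF _ ennreal_leI] by blast

text \<open>Negative radii are covered as well, since \<open>ennreal\<close> sends them to 0.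
  Nonemptiness of the balls is what the infimum in the rate relies on.\<close>

lemma zero_in_lip_ball: "(\<lambda>_. 0) \<in> lip_ball D R"
proof -
  have "lip_norm D (\<lambda>_. 0) \<le> 0 + 0" unfolding lip_norm_def
    by (intro add_mono SUP_least) auto
  also have "\<dots> \<le> ennreal R" by simp
  finally show ?thesis by (simp add: lip_ball_def)
qed

lemma floor_eq_imp_abs_diff_le:
  fixes a b \<delta> :: real
  assumes "\<lfloor>a / \<delta>\<rfloor> = \<lfloor>b / \<delta>\<rfloor>" "0 < \<delta>" shows "\<bar>a - b\<bar> \<le> \<delta>"
proof -
  have "\<bar>a / \<delta> - b / \<delta>\<bar> \<le> 1"
    using floor_correct[of "a / \<delta>"] floor_correct[of "b / \<delta>"] assms(1) by linarith
  moreover have "\<bar>a / \<delta> - b / \<delta>\<bar> = \<bar>a - b\<bar> / \<delta>"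
    using assms(2) by (simp add: diff_divide_distrib[symmetric] abs_divide)
  ultimately show ?thesis using assms(2) by (simp add: field_simps)
qed

lemma card_floor_interval:
  fixes a \<delta> :: real
  assumes "0 \<le> a" "0 < \<delta>"
  shows "real (card {\<lfloor>- a / \<delta>\<rfloor>..\<lfloor>a / \<delta>\<rfloor>}) \<le> 2 * a / \<delta> + 3"
proof -
  have "real (card {\<lfloor>- a / \<delta>\<rfloor>..\<lfloor>a / \<delta>\<rfloor>}) = real (nat (\<lfloor>a / \<delta>\<rfloor> - \<lfloor>- a / \<delta>\<rfloor> + 1))"
    by (simp add: algebra_simps)
  also have "\<dots> \<le> \<bar>of_int (\<lfloor>a / \<delta>\<rfloor> - \<lfloor>- a / \<delta>\<rfloor> + 1)\<bar>" by linarith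
  also have "\<dots> \<le> 2 * (a / \<delta>) + 3"
    using floor_correct[of "a / \<delta>"] floor_correct[of "- a / \<delta>"] divide_nonneg_pos[OF assms]
      minus_divide_left[of a \<delta>] unfolding of_int_diff of_int_add by linarith
  finally show ?thesis by simp
qed

text \<open>Each function is encoded by its values, rounded to multiples of \<epsilon>, at one point
  of every grid cell meeting D. Equal codes mean a difference of at most \<epsilon> at those points,
  and the oscillation of each of the two functions within a cell adds \<epsilon>. The exponent of
  the cardinality is the number of cells, its base the number of rounded values.\<close>

lemma lip_ball_cover:
  fixes D :: "(real ^ 'd) set"
  assumes D: "\<And>u i. u \<in> D \<Longrightarrow> \<bar>u $ i\<bar> \<le> A" "0 \<le> A" and R: "0 < R" and \<epsilon>: "0 < \<epsilon>"
  obtains T where "T \<subseteq> lip_ball D R" "finite T"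
    "real (card T) \<le> exp ((2 * A * real CARD('d) * R / \<epsilon> + 3) ^ CARD('d) * ln (2 * R / \<epsilon> + 3))"
    "\<And>x. x \<in> lip_ball D R \<Longrightarrow> \<exists>x'\<in>T. \<forall>u\<in>D. \<bar>x u - x' u\<bar> \<le> 3 * \<epsilon>"
proof -
  \<comment> \<open>The norm is at most the sum of the \<open>CARD('d)\<close> coordinate distances,
    so a cell of this side has diameter at most \<epsilon> / R.\<close>
  define \<delta> where "\<delta> = \<epsilon> / (R * real CARD('d))"
  have \<delta>: "0 < \<delta>" using R \<epsilon> by (simp add: \<delta>_def)
  define q where "q u = (\<chi> i. \<lfloor>u $ i / \<delta>\<rfloor>)" for u :: "real ^ 'd"
  define G where "G = {z :: int ^ 'd. \<forall>i. z $ i \<in> {\<lfloor>- A / \<delta>\<rfloor>..\<lfloor>A / \<delta>\<rfloor>}}"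
  define Q where "Q = q ` D"
  have QG: "Q \<subseteq> G"
  proof
    fix z assume "z \<in> Q"
    then obtain u where u: "u \<in> D" "z = q u" by (auto simp: Q_def)
    have "- A / \<delta> \<le> u $ i / \<delta>" "u $ i / \<delta> \<le> A / \<delta>" for i
      using D(1)[OF u(1), of i] \<delta>
        divide_right_mono[of "- A" "u $ i" \<delta>] divide_right_mono[of "u $ i" A \<delta>] by linarith+
    thus "z \<in> G" unfolding G_def u(2) q_def by (auto intro!: floor_mono)
  qed
  have Gfin: "finite G" unfolding G_def by (rule card_vec_box) simp
  have Qfin: "finite Q" using QG Gfin by (rule finite_subset)
  have "real (card Q) \<le> real (card G)" using card_mono[OF Gfin QG] by simp
  also have "real (card G) = real (card {\<lfloor>- A / \<delta>\<rfloor>..\<lfloor>A / \<delta>\<rfloor>}) ^ CARD('d)"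
    unfolding G_def by (subst card_vec_box) auto
  also have "\<dots> \<le> (2 * A / \<delta> + 3) ^ CARD('d)"
    by (intro power_mono card_floor_interval D(2) \<delta>) simp
  also have "2 * A / \<delta> = 2 * A * real CARD('d) * R / \<epsilon>" by (simp add: \<delta>_def)
  finally have Qcard: "real (card Q) \<le> (2 * A * real CARD('d) * R / \<epsilon> + 3) ^ CARD('d)" .
  \<comment> \<open>The sample point is taken in D itself, where the bounds on the functions hold;
    the centre of the cell might lie outside.\<close>
  define c where "c z = (SOME u. u \<in> D \<and> q u = z)" for z
  have c: "c z \<in> D" "q (c z) = z" if "z \<in> Q" for z
  proof -
    have "\<exists>u. u \<in> D \<and> q u = z" using that by (auto simp: Q_def)
    from someI_ex[OF this] show "c z \<in> D" "q (c z) = z" by (auto simp: c_def)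
  qed
  have cell: "norm (u - v) \<le> \<epsilon> / R" if "q u = q v" for u v
  proof -
    have "norm (u - v) \<le> (\<Sum>i\<in>UNIV. \<bar>(u - v) $ i\<bar>)" by (rule norm_le_l1_cart)
    also have "\<dots> \<le> (\<Sum>i\<in>(UNIV :: 'd set). \<delta>)"
    proof (rule sum_mono)
      fix i
      have "\<lfloor>u $ i / \<delta>\<rfloor> = \<lfloor>v $ i / \<delta>\<rfloor>" using that unfolding q_def by (metis vec_lambda_beta)
      thus "\<bar>(u - v) $ i\<bar> \<le> \<delta>" using floor_eq_imp_abs_diff_le[OF _ \<delta>] by simp
    qed
    finally show ?thesis by (simp add: \<delta>_def)
  qed
  define VS where "VS = {\<lfloor>- R / \<epsilon>\<rfloor>..\<lfloor>R / \<epsilon>\<rfloor>}"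
  define code where "code x = (\<lambda>z\<in>Q. \<lfloor>x (c z) / \<epsilon>\<rfloor>)" for x :: "'d fld"
  let ?L = "lip_ball D R"
  have code_in: "code ` ?L \<subseteq> PiE Q (\<lambda>_. VS)"
  proof (rule image_subsetI)
    fix x assume x: "x \<in> ?L"
    have "\<lfloor>x (c z) / \<epsilon>\<rfloor> \<in> VS" if z: "z \<in> Q" for z
    proof -
      have "\<bar>x (c z)\<bar> \<le> R" using lip_ballD(2)[OF x _ c(1)[OF z]] R by simp
      hence "- R / \<epsilon> \<le> x (c z) / \<epsilon>" "x (c z) / \<epsilon> \<le> R / \<epsilon>"
        using \<epsilon> divide_right_mono[of "- R" "x (c z)" \<epsilon>] divide_right_mono[of "x (c z)" R \<epsilon>] by linarith+
      thus ?thesis unfolding VS_def by (auto intro!: floor_mono)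
    qed
    thus "code x \<in> PiE Q (\<lambda>_. VS)" by (auto simp: code_def)
  qed
  have fin: "finite (PiE Q (\<lambda>_. VS))" by (intro finite_PiE Qfin) (simp add: VS_def)
  \<comment> \<open>One member of the ball for each code that occurs, so that the centres of the
    cover are again in the ball and hence in S.\<close>
  define T where "T = inv_into ?L code ` code ` ?L"
  have T: "T \<subseteq> ?L" unfolding T_def by (auto intro: inv_into_into)
  have Tfin: "finite T" unfolding T_def using finite_subset[OF code_in fin] by simp
  have lnn: "0 \<le> ln (2 * R / \<epsilon> + 3)" using R \<epsilon> by (intro ln_ge_zero) auto
  have "card T \<le> card (code ` ?L)" unfolding T_def
    by (rule card_image_le) (rule finite_subset[OF code_in fin])
  also have "\<dots> \<le> card (PiE Q (\<lambda>_. VS))" by (rule card_mono[OF fin code_in])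
  also have "\<dots> = card VS ^ card Q" by (simp add: card_PiE Qfin)
  finally have "real (card T) \<le> real (card VS ^ card Q)" by (simp only: of_nat_le_iff)
  also have "\<dots> \<le> (2 * R / \<epsilon> + 3) ^ card Q"
    unfolding of_nat_power VS_def using R by (intro power_mono card_floor_interval \<epsilon>) auto
  also have "\<dots> = exp (real (card Q) * ln (2 * R / \<epsilon> + 3))"
    using R \<epsilon> by (simp add: exp_of_nat_mult add_pos_pos)
  also have "\<dots> \<le> exp ((2 * A * real CARD('d) * R / \<epsilon> + 3) ^ CARD('d) * ln (2 * R / \<epsilon> + 3))"
    using Qcard lnn by (simp add: mult_right_mono)
  finally have Tcard: "real (card T) \<le> exp ((2 * A * real CARD('d) * R / \<epsilon> + 3) ^ CARD('d) * ln (2 * R / \<epsilon> + 3))" .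
  have cover: "\<exists>x'\<in>T. \<forall>u\<in>D. \<bar>x u - x' u\<bar> \<le> 3 * \<epsilon>" if x: "x \<in> ?L" for x
  proof -
    define x' where "x' = inv_into ?L code (code x)"
    have x': "x' \<in> T" "x' \<in> ?L" "code x' = code x"
      using x T by (auto simp: x'_def T_def f_inv_into_f)
    have "\<bar>x u - x' u\<bar> \<le> 3 * \<epsilon>" if u: "u \<in> D" for u
    proof -
      define v where "v = c (q u)"
      have z: "q u \<in> Q" using u by (simp add: Q_def)
      have v: "v \<in> D" "norm (u - v) \<le> \<epsilon> / R" using c[OF z] cell[of u v] by (auto simp: v_def)
      have lip: "\<bar>w u - w v\<bar> \<le> \<epsilon>" if "w \<in> ?L" for w
      proof -
        have "\<bar>w u - w v\<bar> \<le> R * norm (u - v)" using lip_ballD(3)[OF that _ u v(1)] R by simp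
        also have "\<dots> \<le> R * (\<epsilon> / R)" using v(2) R by (intro mult_left_mono) auto
        finally show ?thesis using R by simp
      qed
      have "code x' (q u) = code x (q u)" by (simp add: x'(3))
      hence "\<lfloor>x' v / \<epsilon>\<rfloor> = \<lfloor>x v / \<epsilon>\<rfloor>" using z by (simp add: code_def v_def)
      from floor_eq_imp_abs_diff_le[OF this \<epsilon>] lip[OF x] lip[OF x'(2)] show ?thesis by linarith
    qed
    thus ?thesis using x'(1) by blast
  qed
  show thesis by (rule that[OF T Tfin Tcard cover])
qed

section \<open>Deviations uniform over a Lipschitz ball and over the bandwidth\<close>

text \<open>
  The same box size may occur with infinitely many different radii and bandwidths along the
  sequence, so a Borel--Cantelli argument over \<open>k\<close> is not available. The deviations are bounded
  simultaneously for all \<open>h\<close> and all boxes of side at most \<open>m\<close>, and Borel--Cantelli runs over \<open>m\<close>.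
\<close>

locale kernel_field = weakly_dependent_field P \<nu> S X y B \<Phi>
  for P :: "'w measure" and \<nu> :: "(real ^ 'd) measure" and S :: "'d fld set"
    and X :: "int ^ 'n \<Rightarrow> 'w \<Rightarrow> 'd fld" and y :: "int ^ 'n \<Rightarrow> 'w \<Rightarrow> real" and B \<Phi> :: real +
  fixes \<rho> :: "'d fld \<Rightarrow> 'd fld \<Rightarrow> real" and \<kappa> :: "real \<Rightarrow> real" and Lk b :: real
  assumes \<rho>_pseudo: "pseudo_metric_on S \<rho>"
    and \<rho>_le: "\<And>x x'. x \<in> S \<Longrightarrow> x' \<in> S \<Longrightarrow> \<rho> x x' \<le> l2_dist \<nu> x x'"
    and \<kappa>_lip: "\<And>u v. 0 \<le> u \<Longrightarrow> 0 \<le> v \<Longrightarrow> \<bar>\<kappa> u - \<kappa> v\<bar> \<le> Lk * \<bar>u - v\<bar>" and Lk: "0 < Lk"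
    and \<kappa>_bound: "\<And>u. 0 \<le> u \<Longrightarrow> \<bar>\<kappa> u\<bar> \<le> b" and b: "0 < b"
    and \<kappa>_support: "\<And>u. 1 < u \<Longrightarrow> \<kappa> u = 0"
    and B_pos: "0 < B"
begin

lemma \<rho>_nonneg: "x \<in> S \<Longrightarrow> x' \<in> S \<Longrightarrow> 0 \<le> \<rho> x x'"
  and \<rho>_sym: "x \<in> S \<Longrightarrow> x' \<in> S \<Longrightarrow> \<rho> x x' = \<rho> x' x"
  and \<rho>_triangle: "x \<in> S \<Longrightarrow> x' \<in> S \<Longrightarrow> x'' \<in> S \<Longrightarrow> \<rho> x x'' \<le> \<rho> x x' + \<rho> x' x''"
  using \<rho>_pseudo unfolding pseudo_metric_on_def by blast+

lemma \<rho>_diff_le: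
  assumes "x \<in> S" "x' \<in> S" "z \<in> S" shows "\<bar>\<rho> z x - \<rho> z x'\<bar> \<le> l2_dist \<nu> x x'"
  using \<rho>_triangle[of z x x'] \<rho>_triangle[of z x' x] \<rho>_le[of x x'] \<rho>_sym[of x x'] assms by auto

lemma \<rho>_diff_le':
  assumes "x \<in> S" "z' \<in> S" "z \<in> S" shows "\<bar>\<rho> z x - \<rho> z' x\<bar> \<le> l2_dist \<nu> z z'"
  using \<rho>_diff_le[of z z' x] \<rho>_sym assms by metis

definition dev :: "nat ^ 'n \<Rightarrow> 'd fld \<Rightarrow> real \<Rightarrow> 'w \<Rightarrow> real" where
  "dev n x h \<omega> = (\<Sum>s\<in>index_box n. y s \<omega> * \<kappa> (\<rho> (X s \<omega>) x / h)
      - (\<integral>\<omega>. y s \<omega> * \<kappa> (\<rho> (X s \<omega>) x / h) \<partial>P))"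

lemma kernel_lipschitz:
  assumes "x \<in> S" "0 < h" "z \<in> S" "z' \<in> S"
  shows "\<bar>\<kappa> (\<rho> z x / h) - \<kappa> (\<rho> z' x / h)\<bar> \<le> Lk / h * l2_dist \<nu> z z'"
proof -
  have "\<bar>\<kappa> (\<rho> z x / h) - \<kappa> (\<rho> z' x / h)\<bar> \<le> Lk * \<bar>\<rho> z x / h - \<rho> z' x / h\<bar>"
    using assms \<rho>_nonneg by (intro \<kappa>_lip) auto
  also have "\<dots> = Lk / h * \<bar>\<rho> z x - \<rho> z' x\<bar>"
    using assms(2) by (simp add: diff_divide_distrib[symmetric] abs_divide)
  also have "\<dots> \<le> Lk / h * l2_dist \<nu> z z'"
    using assms Lk by (intro mult_left_mono \<rho>_diff_le') auto
  finally show ?thesis .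
qed

lemma kernel_measurable:
  assumes "x \<in> S" "0 < h"
  shows "(\<lambda>z. \<kappa> (\<rho> z x / h)) \<in> borel_measurable (l2_borel \<nu> S)"
  by (rule l2_lipschitz_measurable) (rule kernel_lipschitz[OF assms])

text \<open>Threshold and Lipschitz constant both scale like 1/h, and the bound b of the kernel is
  enlarged to b / h, which is allowed for h <= 1. The bandwidth then cancels from the
  exponent.\<close>

lemma dev_prob:
  assumes x: "x \<in> S" and h: "0 < h" "h \<le> 1" and n: "\<And>i. n $ i \<le> m" and m: "1 \<le> m" and t: "0 \<le> t"
  shows "prob {\<omega>\<in>space P. t * real m ^ CARD('n) / h \<le> \<bar>dev n x h \<omega>\<bar>}
     \<le> 2 * exp (- (t\<^sup>2 * real m / (8 * (real CARD('n))\<^sup>2 * B\<^sup>2 * (b + Lk * \<Phi>)\<^sup>2)))"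
proof -
  define f where "f z = \<kappa> (\<rho> z x / h)" for z
  have lip: "\<bar>f z - f z'\<bar> \<le> Lk / h * l2_dist \<nu> z z'" if "z \<in> S" "z' \<in> S" for z z'
    unfolding f_def by (rule kernel_lipschitz[OF x h(1) that])
  have bd: "\<bar>f z\<bar> \<le> b / h" if "z \<in> S" for z
  proof -
    have "\<bar>f z\<bar> \<le> b" unfolding f_def using \<rho>_nonneg[OF that x] h by (intro \<kappa>_bound) auto
    also have "\<dots> \<le> b / h" using h b by (simp add: field_simps)
    finally show ?thesis .
  qed
  have *: "prob {\<omega>\<in>space P. t / h * real m ^ CARD('n) \<le> \<bar>dev n x h \<omega>\<bar>}
     \<le> 2 * exp (- ((t / h)\<^sup>2 * real m / (8 * (real CARD('n))\<^sup>2 * B\<^sup>2 * (b / h + Lk / h * \<Phi>)\<^sup>2)))"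
    unfolding dev_def using concentration[OF n m lip _ bd _ B_pos, of "t / h"] h Lk b t
    unfolding f_def by simp
  have "0 < b + Lk * \<Phi>" using b Lk \<Phi>_nonneg by (simp add: add_pos_nonneg)
  moreover have "b / h + Lk / h * \<Phi> = (b + Lk * \<Phi>) / h" by (simp add: add_divide_distrib)
  ultimately have "(t / h)\<^sup>2 * real m / (8 * (real CARD('n))\<^sup>2 * B\<^sup>2 * (b / h + Lk / h * \<Phi>)\<^sup>2)
     = t\<^sup>2 * real m / (8 * (real CARD('n))\<^sup>2 * B\<^sup>2 * (b + Lk * \<Phi>)\<^sup>2)"
    using h B_pos by (simp add: power_divide)
  with * show ?thesis by simp
qed

text \<open>Centre and bandwidth are moved one after the other. If \<rho> z x exceeds h', both
  kernel values vanish; otherwise \<rho> z x / h' is at most 1, so changing the bandwidth moves the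
  argument by at most \<eta> / h. The support condition thus avoids a loss of 1/h^2.\<close>

lemma kernel_perturb:
  assumes z: "z \<in> S" "x \<in> S" "x' \<in> S" and d: "l2_dist \<nu> x x' \<le> \<eta>"
    and h: "0 < h" "h \<le> h'" "h' \<le> h + \<eta>"
  shows "\<bar>\<kappa> (\<rho> z x / h) - \<kappa> (\<rho> z x' / h')\<bar> \<le> 2 * Lk * \<eta> / h"
proof -
  have r0: "0 \<le> \<rho> z x" "0 \<le> \<rho> z x'" using \<rho>_nonneg z by auto
  have \<eta>: "0 \<le> \<eta>" using d l2_dist_nonneg[of \<nu> x x'] by linarith
  have "\<bar>\<kappa> (\<rho> z x / h) - \<kappa> (\<rho> z x / h')\<bar> \<le> Lk * \<eta> / h"
  proof (cases "h' < \<rho> z x")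
    case True
    hence "1 < \<rho> z x / h" "1 < \<rho> z x / h'" using h by (auto simp: field_simps)
    thus ?thesis using \<kappa>_support \<eta> Lk h by simp
  next
    case False
    have "\<bar>\<kappa> (\<rho> z x / h) - \<kappa> (\<rho> z x / h')\<bar> \<le> Lk * \<bar>\<rho> z x / h - \<rho> z x / h'\<bar>"
      using r0 h by (intro \<kappa>_lip) auto
    also have "\<rho> z x / h - \<rho> z x / h' = \<rho> z x / h' * ((h' - h) / h)" using h by (simp add: field_simps)
    also have "\<bar>\<dots>\<bar> \<le> 1 * (\<eta> / h)" unfolding abs_mult
    proof (rule mult_mono)
      show "\<bar>\<rho> z x / h'\<bar> \<le> 1" using False h r0 by simp
      show "\<bar>(h' - h) / h\<bar> \<le> \<eta> / h" using h by (simp add: divide_right_mono)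
    qed auto
    finally show ?thesis using Lk by simp
  qed
  moreover have "\<bar>\<kappa> (\<rho> z x / h') - \<kappa> (\<rho> z x' / h')\<bar> \<le> Lk * \<eta> / h"
  proof -
    have "\<bar>\<kappa> (\<rho> z x / h') - \<kappa> (\<rho> z x' / h')\<bar> \<le> Lk * \<bar>\<rho> z x / h' - \<rho> z x' / h'\<bar>"
      using r0 h by (intro \<kappa>_lip) auto
    also have "\<dots> = Lk * (\<bar>\<rho> z x - \<rho> z x'\<bar> / h')"
      using h by (simp add: diff_divide_distrib[symmetric] abs_divide)
    also have "\<dots> \<le> Lk * (\<eta> / h)"
      using \<rho>_diff_le[OF z(2,3,1)] d h Lk \<eta> by (intro mult_left_mono frac_le) auto
    finally show ?thesis by simp
  qed
  ultimately show ?thesis by simp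
qed

lemma integrable_y_kernel:
  assumes "x \<in> S" "0 < h"
  shows "integrable P (\<lambda>\<omega>. y s \<omega> * \<kappa> (\<rho> (X s \<omega>) x / h))"
proof (rule integrable_const_bound[where B = "B * b"])
  show "AE \<omega> in P. norm (y s \<omega> * \<kappa> (\<rho> (X s \<omega>) x / h)) \<le> B * b"
    using assms B_pos b y_bound X_space \<rho>_nonneg
    by (intro AE_I2) (auto simp: abs_mult intro!: mult_mono \<kappa>_bound)
  show "(\<lambda>\<omega>. y s \<omega> * \<kappa> (\<rho> (X s \<omega>) x / h)) \<in> borel_measurable P"
    using y_meas measurable_compose[OF X_meas kernel_measurable[OF assms]] by measurable
qed

text \<open>The constant 4 arises from the 2 of \<open>kernel_perturb\<close>, once for the sample
  term and once for its mean.\<close>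

lemma dev_perturb:
  fixes n :: "nat ^ 'n"
  assumes z: "x \<in> S" "x' \<in> S" and d: "l2_dist \<nu> x x' \<le> \<eta>"
    and h: "0 < h" "h \<le> h'" "h' \<le> h + \<eta>" and n: "\<And>i. n $ i \<le> m" and w: "\<omega> \<in> space P"
  shows "\<bar>dev n x h \<omega> - dev n x' h' \<omega>\<bar> \<le> 4 * B * Lk * \<eta> * real m ^ CARD('n) / h"
proof -
  have h': "0 < h'" using h by simp
  have \<eta>: "0 \<le> \<eta>" using d l2_dist_nonneg[of \<nu> x x'] by linarith
  have 1: "\<bar>y s \<omega> * \<kappa> (\<rho> (X s \<omega>) x / h) - y s \<omega> * \<kappa> (\<rho> (X s \<omega>) x' / h')\<bar> \<le> B * (2 * Lk * \<eta> / h)"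
    if "\<omega> \<in> space P" for s \<omega>
    unfolding right_diff_distrib[symmetric] abs_mult using that B_pos
    by (intro mult_mono y_bound kernel_perturb X_space z d h) auto
  have 2: "\<bar>(\<integral>\<omega>. y s \<omega> * \<kappa> (\<rho> (X s \<omega>) x / h) \<partial>P) - (\<integral>\<omega>. y s \<omega> * \<kappa> (\<rho> (X s \<omega>) x' / h') \<partial>P)\<bar>
       \<le> B * (2 * Lk * \<eta> / h)" for s
  proof -
    have "\<bar>(\<integral>\<omega>. y s \<omega> * \<kappa> (\<rho> (X s \<omega>) x / h) \<partial>P) - (\<integral>\<omega>. y s \<omega> * \<kappa> (\<rho> (X s \<omega>) x' / h') \<partial>P)\<bar>
        = \<bar>\<integral>\<omega>. y s \<omega> * \<kappa> (\<rho> (X s \<omega>) x / h) - y s \<omega> * \<kappa> (\<rho> (X s \<omega>) x' / h') \<partial>P\<bar>"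
      using integrable_y_kernel[OF z(1) h(1)] integrable_y_kernel[OF z(2) h'] by simp
    also have "\<dots> \<le> (\<integral>\<omega>. \<bar>y s \<omega> * \<kappa> (\<rho> (X s \<omega>) x / h) - y s \<omega> * \<kappa> (\<rho> (X s \<omega>) x' / h')\<bar> \<partial>P)"
      by (rule integral_abs_bound)
    also have "\<dots> \<le> (\<integral>\<omega>. B * (2 * Lk * \<eta> / h) \<partial>P)"
      using integrable_y_kernel[OF z(1) h(1)] integrable_y_kernel[OF z(2) h']
      by (intro integral_mono) (use 1 in auto)
    finally show ?thesis by (simp add: prob_space)
  qed
  have "\<bar>dev n x h \<omega> - dev n x' h' \<omega>\<bar> \<le> (\<Sum>s\<in>index_box n. 4 * B * Lk * \<eta> / h)"
    unfolding dev_def sum_subtractf[symmetric]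
  proof (rule order_trans[OF sum_abs], rule sum_mono)
    fix s
    show "\<bar>y s \<omega> * \<kappa> (\<rho> (X s \<omega>) x / h) - (\<integral>\<omega>. y s \<omega> * \<kappa> (\<rho> (X s \<omega>) x / h) \<partial>P)
        - (y s \<omega> * \<kappa> (\<rho> (X s \<omega>) x' / h') - (\<integral>\<omega>. y s \<omega> * \<kappa> (\<rho> (X s \<omega>) x' / h') \<partial>P))\<bar>
        \<le> 4 * B * Lk * \<eta> / h"
      using 1[OF w, of s] 2[of s] by simp
  qed
  also have "\<dots> = real (card (index_box n)) * (4 * B * Lk * \<eta> / h)" by simp
  also have "\<dots> \<le> real m ^ CARD('n) * (4 * B * Lk * \<eta> / h)"
    using card_index_box_le[OF n] B_pos Lk \<eta> h
    by (intro mult_right_mono) (auto simp: of_nat_power[symmetric] simp del: of_nat_power)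
  finally show ?thesis by (simp add: mult_ac)
qed

text \<open>Union bound over all boxes of side at most m, a grid of bandwidths and a cover of the
  ball, followed by a perturbation from the grid to general x and h.\<close>

lemma uniform_deviation:
  assumes \<nu>: "finite_measure \<nu>" "space \<nu> = D"
    and D: "\<And>u i. u \<in> D \<Longrightarrow> \<bar>u $ i\<bar> \<le> A" "0 \<le> A" and R: "0 < R" and sub: "lip_ball D R \<subseteq> S"
    and W: "sqrt (measure \<nu> D) \<le> W" "0 < W" and m: "1 \<le> m" and t: "0 < t"
  obtains bad where "bad \<in> sets P"
    "prob bad \<le> 2 * real ((m + 1) ^ CARD('n)) * (B / t + 1) *
        exp ((6 * A * real CARD('d) * R * W * B / t + 3) ^ CARD('d) * ln (6 * R * W * B / t + 3)) *
        exp (- (t\<^sup>2 * real m / (8 * (real CARD('n))\<^sup>2 * B\<^sup>2 * (b + Lk * \<Phi>)\<^sup>2)))"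
    "\<And>\<omega> n x h. \<omega> \<in> space P - bad \<Longrightarrow> (\<And>i. n $ i \<le> m) \<Longrightarrow> x \<in> lip_ball D R \<Longrightarrow> 0 < h \<Longrightarrow> h \<le> 1 \<Longrightarrow>
       \<bar>dev n x h \<omega>\<bar> \<le> (1 + 4 * Lk) * t * real m ^ CARD('n) / h"
proof -
  \<comment> \<open>At this resolution the perturbation error 4 B Lk \<eta> m^N / h is a constant
    multiple of the deviation level t m^N / h.\<close>
  define \<eta> where "\<eta> = t / B"
  have \<eta>: "0 < \<eta>" using t B_pos by (simp add: \<eta>_def)
  define \<epsilon> where "\<epsilon> = \<eta> / (3 * W)"
  have \<epsilon>: "0 < \<epsilon>" using \<eta> W by (simp add: \<epsilon>_def)
  obtain T where T: "T \<subseteq> lip_ball D R" "finite T"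
    "real (card T) \<le> exp ((2 * A * real CARD('d) * R / \<epsilon> + 3) ^ CARD('d) * ln (2 * R / \<epsilon> + 3))"
    "\<And>x. x \<in> lip_ball D R \<Longrightarrow> \<exists>x'\<in>T. \<forall>u\<in>D. \<bar>x u - x' u\<bar> \<le> 3 * \<epsilon>"
    by (rule lip_ball_cover[OF D R \<epsilon>]) blast+
  \<comment> \<open>The bandwidth grid i / q has spacing at most \<eta>. Bandwidths are rounded up,
    so the threshold at the grid point, which is proportional to 1/h', is no larger than the one at
    h.\<close>
  define q where "q = nat \<lceil>1 / \<eta>\<rceil>"
  have q: "1 / \<eta> \<le> real q" "real q \<le> 1 / \<eta> + 1" "0 < q" using \<eta> unfolding q_def
    by (linarith, smt (verit) ceiling_correct of_nat_nat of_int_0_le_iff divide_pos_pos, simp)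
  define H where "H = (\<lambda>i. real i / real q) ` {1..q}"
  define I where "I = {n :: nat ^ 'n. \<forall>i. n $ i \<in> {0..m}}"
  have I: "finite I" "card I = (m + 1) ^ CARD('n)" unfolding I_def by (subst card_vec_box; simp)+
  define E where "E = (\<lambda>(n, x, h). {\<omega>\<in>space P. t * real m ^ CARD('n) / h \<le> \<bar>dev n x h \<omega>\<bar>})"
  define J where "J = I \<times> T \<times> H"
  have Hfin: "finite H" "card H \<le> q" unfolding H_def by (auto intro: card_image_le[THEN order_trans])
  have H01: "0 < h \<and> h \<le> 1" if "h \<in> H" for h using that q by (auto simp: H_def)
  have Jfin: "finite J" unfolding J_def using I T(2) Hfin by auto
  define bad where "bad = (\<Union>j\<in>J. E j)"
  have devm: "dev n x h \<in> borel_measurable P" if "x \<in> S" "0 < h" for n x h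
    unfolding dev_def using integrable_y_kernel[OF that]
    by (intro borel_measurable_sum borel_measurable_diff borel_measurable_integrable) auto
  have Em: "E j \<in> sets P" if "j \<in> J" for j
  proof -
    obtain n x h where j: "j = (n, x, h)" by (cases j)
    have "x \<in> S" "0 < h" using that T(1) sub H01 by (auto simp: J_def j)
    note [measurable] = devm[OF this]
    show ?thesis unfolding E_def j by simp
  qed
  have 1: "bad \<in> sets P" unfolding bad_def using Em Jfin by (intro sets.finite_UN) auto
  define G where "G = exp (- (t\<^sup>2 * real m / (8 * (real CARD('n))\<^sup>2 * B\<^sup>2 * (b + Lk * \<Phi>)\<^sup>2)))"
  have "prob bad \<le> (\<Sum>j\<in>J. prob (E j))" unfolding bad_def
    using Em Jfin by (intro finite_measure_subadditive_finite) auto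
  also have "\<dots> \<le> (\<Sum>j\<in>J. 2 * G)"
  proof (rule sum_mono)
    fix j assume j: "j \<in> J"
    obtain n x h where j': "j = (n, x, h)" by (cases j)
    have "x \<in> S" "0 < h" "h \<le> 1" "\<And>i. n $ i \<le> m" using j T(1) sub H01 by (auto simp: J_def j' I_def)
    thus "prob (E j) \<le> 2 * G" unfolding E_def j' G_def using dev_prob[of x h n m t] m t by simp
  qed
  also have "\<dots> = real (card J) * (2 * G)" by simp
  also have "\<dots> = real ((m + 1) ^ CARD('n)) * (real (card H) * real (card T)) * (2 * G)"
    unfolding J_def by (simp add: card_cartesian_product I(2))
  also have "\<dots> \<le> real ((m + 1) ^ CARD('n)) * ((1 / \<eta> + 1) *
        exp ((2 * A * real CARD('d) * R / \<epsilon> + 3) ^ CARD('d) * ln (2 * R / \<epsilon> + 3))) * (2 * G)"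
    using Hfin(2) q(2) T(3) \<eta> by (intro mult_right_mono mult_left_mono mult_mono) (auto simp: G_def)
  also have "\<dots> = 2 * real ((m + 1) ^ CARD('n)) * (B / t + 1) *
        exp ((6 * A * real CARD('d) * R * W * B / t + 3) ^ CARD('d) * ln (6 * R * W * B / t + 3)) * G"
    using t B_pos W by (simp add: \<epsilon>_def \<eta>_def mult_ac)
  finally have 2: "prob bad \<le> \<dots>" .
  have 3: "\<bar>dev n x h \<omega>\<bar> \<le> (1 + 4 * Lk) * t * real m ^ CARD('n) / h"
    if w: "\<omega> \<in> space P - bad" and n: "\<And>i. n $ i \<le> m" and x: "x \<in> lip_ball D R" and h: "0 < h" "h \<le> 1"
    for \<omega> n x h
  proof -
    obtain x' where x': "x' \<in> T" "\<forall>u\<in>D. \<bar>x u - x' u\<bar> \<le> 3 * \<epsilon>" using T(4)[OF x] by blast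
    have xS: "x \<in> S" "x' \<in> S" using x x' T(1) sub by auto
    have "l2_dist \<nu> x x' \<le> sqrt (measure \<nu> (space \<nu>)) * (3 * \<epsilon>)"
      using x'(2) \<epsilon> xS S_l2 by (intro l2_dist_le_sup \<nu>) (auto simp: \<nu>(2))
    also have "\<dots> \<le> W * (3 * \<epsilon>)" using W \<epsilon> by (intro mult_right_mono) (auto simp: \<nu>(2))
    also have "\<dots> = \<eta>" using W by (simp add: \<epsilon>_def)
    finally have d: "l2_dist \<nu> x x' \<le> \<eta>" .
    define i where "i = nat \<lceil>h * real q\<rceil>"
    have i: "h * real q \<le> real i" "real i \<le> h * real q + 1" "1 \<le> i"
    proof -
      have p: "0 < h * real q" using h q by simp
      show "h * real q \<le> real i" unfolding i_def by linarith
      show "real i \<le> h * real q + 1" unfolding i_def using p by linarith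
      show "1 \<le> i" unfolding i_def using p by linarith
    qed
    have "h * real q \<le> real q" using h by (simp add: mult_left_le_one_le)
    hence iq: "i \<le> q" unfolding i_def by linarith
    define h' where "h' = real i / real q"
    have h'H: "h' \<in> H" unfolding h'_def H_def using i iq by auto
    have hh': "h \<le> h'" unfolding h'_def using i(1) q(3) by (simp add: field_simps)
    have "h' \<le> h + 1 / real q" unfolding h'_def using i(2) q(3) by (simp add: field_simps)
    also have "1 / real q \<le> \<eta>" using q \<eta> by (simp add: field_simps)
    finally have h'\<eta>: "h' \<le> h + \<eta>" by simp
    have "(n, x', h') \<in> J" using n x' h'H by (auto simp: J_def I_def)
    hence "\<omega> \<notin> E (n, x', h')" using w by (auto simp: bad_def)
    hence "\<bar>dev n x' h' \<omega>\<bar> \<le> t * real m ^ CARD('n) / h'" using w by (auto simp: E_def)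
    also have "\<dots> \<le> t * real m ^ CARD('n) / h" using hh' h t by (intro divide_left_mono) auto
    finally have a: "\<bar>dev n x' h' \<omega>\<bar> \<le> t * real m ^ CARD('n) / h" .
    have "\<bar>dev n x h \<omega> - dev n x' h' \<omega>\<bar> \<le> 4 * B * Lk * \<eta> * real m ^ CARD('n) / h"
      using w by (intro dev_perturb xS d h hh' h'\<eta> n) auto
    also have "\<dots> = 4 * Lk * t * real m ^ CARD('n) / h" using B_pos by (simp add: \<eta>_def)
    finally have "\<bar>dev n x h \<omega>\<bar> \<le> t * real m ^ CARD('n) / h + 4 * Lk * t * real m ^ CARD('n) / h"
      using a by linarith
    thus ?thesis by (simp add: add_divide_distrib[symmetric] algebra_simps)
  qed
  show thesis by (rule that[OF 1 2[unfolded G_def] 3])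
qed

end

section \<open>The mean of the kernel\<close>

text \<open>As K(1) = 0, K(v) is the integral of -K' over [v, 1]. Inserting v = U / h and exchanging
  the integrals by Tonelli turns the mean into an integral of the distribution function of U,
  without a density. Nonnegativity of the kernel comes from the same formula.\<close>

lemma (in prob_space) kernel_mean:
  fixes U :: "'a \<Rightarrow> real" and K K' :: "real \<Rightarrow> real"
  assumes U [measurable]: "U \<in> borel_measurable M" and U0: "\<And>\<omega>. \<omega> \<in> space M \<Longrightarrow> 0 \<le> U \<omega>"
    and K': "\<And>u. u \<in> {0..1} \<Longrightarrow> (K has_real_derivative K' u) (at u within {0..1})"
      "continuous_on {0..1} K'" "\<And>u. u \<in> {0..1} \<Longrightarrow> K' u \<le> 0"
    and K: "K 1 = 0" "\<And>u. 1 < u \<Longrightarrow> K u = 0" and h: "0 < h"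
    and Km: "(\<lambda>\<omega>. K (U \<omega> / h)) \<in> borel_measurable M"
  shows "integrable M (\<lambda>\<omega>. K (U \<omega> / h))"
    and "(\<lambda>u. - K' u * prob {\<omega>\<in>space M. U \<omega> \<le> h * u}) integrable_on {0..1}"
    and "(\<integral>\<omega>. K (U \<omega> / h) \<partial>M) = integral {0..1} (\<lambda>u. - K' u * prob {\<omega>\<in>space M. U \<omega> \<le> h * u})"
    and "\<And>\<omega>. \<omega> \<in> space M \<Longrightarrow> 0 \<le> K (U \<omega> / h)"
proof -
  interpret pair_sigma_finite M lborel ..
  define k where "k u = indicator {0..1} u * - K' u" for u :: real
  have [measurable]: "k \<in> borel_measurable borel"
  proof -
    have "(\<lambda>u. indicator {0..1} u *\<^sub>R - K' u) \<in> borel_measurable borel"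
      by (rule borel_measurable_continuous_on_indicator) (auto intro: continuous_intros K'(2))
    thus ?thesis by (simp add: k_def[abs_def])
  qed
  have k0: "0 \<le> k u" for u using K'(3)[of u] by (auto simp: k_def indicator_def)
  define F where "F z = prob {\<omega>\<in>space M. U \<omega> \<le> z}" for z
  have "mono F" unfolding F_def mono_def by (auto intro!: finite_measure_mono)
  hence Fm [measurable]: "F \<in> borel_measurable borel" by (rule borel_measurable_mono)
  obtain C where C: "\<And>u. u \<in> {0..1} \<Longrightarrow> \<bar>K' u\<bar> \<le> C"
  proof -
    have "bounded (K' ` {0..1})" by (intro compact_imp_bounded compact_continuous_image K'(2)) auto
    then obtain a where "\<forall>u\<in>{0..1}. \<bar>K' u\<bar> \<le> a" by (auto simp: bounded_iff)
    thus thesis by (intro that[of a]) auto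
  qed
  have C0: "0 \<le> C" using C[of 0] by auto
  have hi: "((\<lambda>u. - K' u) has_integral K v) {v..1}" if v: "v \<in> {0..1}" for v
  proof -
    have "((\<lambda>u. - K' u) has_integral (- K 1) - (- K v)) {v..1}"
    proof (rule fundamental_theorem_of_calculus)
      fix u assume u: "u \<in> {v..1}"
      have "(K has_real_derivative K' u) (at u within {v..1})"
        by (rule has_field_derivative_subset[OF K'(1)]) (use u v in auto)
      hence "((\<lambda>u. - K u) has_real_derivative - K' u) (at u within {v..1})" by (rule DERIV_minus)
      thus "((\<lambda>u. - K u) has_vector_derivative - K' u) (at u within {v..1})"
        by (simp add: has_real_derivative_iff_has_vector_derivative)
    qed (use v in auto)
    thus ?thesis using K(1) by simp
  qed
  have K0: "0 \<le> K v" if v: "0 \<le> v" for v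
  proof (cases "v \<le> 1")
    case True
    thus ?thesis using v K'(3) by (intro has_integral_nonneg[OF hi]) auto
  qed (use K in auto)
  have Kv: "ennreal (K v) = (\<integral>\<^sup>+u. ennreal (k u) * indicator {v..} u \<partial>lborel)" if v: "0 \<le> v" for v
  proof (cases "v \<le> 1")
    case True
    have "(\<integral>\<^sup>+u. ennreal (k u) * indicator {v..} u \<partial>lborel) = (\<integral>\<^sup>+u. ennreal (indicator {v..1} u * - K' u) \<partial>lborel)"
      using v by (intro nn_integral_cong) (auto simp: k_def indicator_def)
    also have "\<dots> = ennreal (K v)"
      using True v K'(3) by (intro nn_integral_has_integral_lebesgue hi) auto
    finally show ?thesis by simp
  next
    case False
    have "(\<integral>\<^sup>+u. ennreal (k u) * indicator {v..} u \<partial>lborel) = (\<integral>\<^sup>+u. 0 \<partial>(lborel :: real measure))"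
      using False by (intro nn_integral_cong) (auto simp: k_def indicator_def)
    thus ?thesis using K(2) False by simp
  qed
  show nn: "0 \<le> K (U \<omega> / h)" if "\<omega> \<in> space M" for \<omega> using U0[OF that] h by (intro K0) simp
  have set: "set_integrable lborel {0..1} (\<lambda>u. - K' u * F (h * u))"
    unfolding set_integrable_def
  proof (rule Bochner_Integration.integrable_bound)
    show "integrable lborel (\<lambda>u::real. indicator {0..1} u * C)" by simp
    have "(\<lambda>u. k u * F (h * u)) \<in> borel_measurable lborel" by measurable
    moreover have "(\<lambda>u. k u * F (h * u)) = (\<lambda>u. indicator {0..1} u *\<^sub>R (- K' u * F (h * u)))"
      by (auto simp: k_def indicator_def)
    ultimately show "(\<lambda>u. indicator {0..1} u *\<^sub>R (- K' u * F (h * u))) \<in> borel_measurable lborel" by simp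
    show "AE u in lborel. norm (indicator {0..1} u *\<^sub>R (- K' u * F (h * u))) \<le> norm (indicator {0..1} u * C)"
    proof (rule AE_I2)
      fix u :: real
      have "\<bar>K' u * F (h * u)\<bar> \<le> C * 1" if "u \<in> {0..1}"
        unfolding abs_mult using C[OF that] C0 by (intro mult_mono) (auto simp: F_def)
      thus "norm (indicator {0..1} u *\<^sub>R (- K' u * F (h * u))) \<le> norm (indicator {0..1} u * C)"
        using C0 by (auto simp: indicator_def)
    qed
  qed
  note HK = set_borel_integral_eq_integral[OF set]
  have nonneg: "0 \<le> integral {0..1} (\<lambda>u. - K' u * F (h * u))"
    using K'(3) by (intro integral_nonneg HK) (auto simp: F_def mult_nonpos_nonneg)
  have "(\<integral>\<^sup>+\<omega>. ennreal (K (U \<omega> / h)) \<partial>M) = (\<integral>\<^sup>+\<omega>. (\<integral>\<^sup>+u. ennreal (k u) * indicator {U \<omega> / h..} u \<partial>lborel) \<partial>M)"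
    using U0 h by (intro nn_integral_cong Kv) auto
  \<comment> \<open>The condition U / h <= u is written as a sign condition on h u - U, which is
    jointly measurable in both variables.\<close>
  also have "\<dots> = (\<integral>\<^sup>+\<omega>. (\<integral>\<^sup>+u. ennreal (k u) * indicator {0..} (h * u - U \<omega>) \<partial>lborel) \<partial>M)"
    using h by (intro nn_integral_cong) (auto simp: indicator_def field_simps)
  also have "\<dots> = (\<integral>\<^sup>+u. (\<integral>\<^sup>+\<omega>. ennreal (k u) * indicator {0..} (h * u - U \<omega>) \<partial>M) \<partial>lborel)"
    by (rule Fubini'[symmetric]) measurable
  also have "\<dots> = (\<integral>\<^sup>+u. ennreal (k u * F (h * u)) \<partial>lborel)"
  proof (rule nn_integral_cong)
    fix u :: real
    have "(\<integral>\<^sup>+\<omega>. ennreal (k u) * indicator {0..} (h * u - U \<omega>) \<partial>M)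
        = (\<integral>\<^sup>+\<omega>. ennreal (k u) * indicator {\<omega>\<in>space M. U \<omega> \<le> h * u} \<omega> \<partial>M)"
      by (rule nn_integral_cong) (auto simp: indicator_def)
    also have "\<dots> = ennreal (k u) * emeasure M {\<omega>\<in>space M. U \<omega> \<le> h * u}"
      by (rule nn_integral_cmult_indicator) measurable
    finally show "(\<integral>\<^sup>+\<omega>. ennreal (k u) * indicator {0..} (h * u - U \<omega>) \<partial>M) = ennreal (k u * F (h * u))"
      using k0 by (simp add: F_def emeasure_eq_measure ennreal_mult)
  qed
  also have "\<dots> = (\<integral>\<^sup>+u. ennreal (indicator {0..1} u * (- K' u * F (h * u))) \<partial>lborel)"
    by (rule nn_integral_cong) (auto simp: k_def indicator_def)
  also have "\<dots> = ennreal (integral {0..1} (\<lambda>u. - K' u * F (h * u)))"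
  proof (rule nn_integral_has_integral_lebesgue)
    show "((\<lambda>u. - K' u * F (h * u)) has_integral integral {0..1} (\<lambda>u. - K' u * F (h * u))) {0..1}"
      by (rule integrable_integral[OF HK(1)])
  qed (use K'(3) in \<open>auto simp: F_def mult_nonpos_nonneg\<close>)
  finally have nnE: "(\<integral>\<^sup>+\<omega>. ennreal (K (U \<omega> / h)) \<partial>M) = ennreal (integral {0..1} (\<lambda>u. - K' u * F (h * u)))" .
  show "integrable M (\<lambda>\<omega>. K (U \<omega> / h))"
  proof (rule integrableI_nonneg[OF Km])
    show "AE \<omega> in M. 0 \<le> K (U \<omega> / h)" by (rule AE_I2) (rule nn)
  qed (simp add: nnE)
  show "(\<lambda>u. - K' u * prob {\<omega>\<in>space M. U \<omega> \<le> h * u}) integrable_on {0..1}"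
    using HK(1) by (simp add: F_def)
  show "(\<integral>\<omega>. K (U \<omega> / h) \<partial>M) = integral {0..1} (\<lambda>u. - K' u * prob {\<omega>\<in>space M. U \<omega> \<le> h * u})"
    unfolding F_def[symmetric] using Km nnE nonneg nn
    by (subst integral_eq_nn_integral) (auto intro!: AE_I2)
qed

text \<open>Replacing \<tau> by the ratio G of small ball probabilities changes the integrand by at
  most C c pointwise on an interval of length one.\<close>

lemma kernel_integral_perturb:
  fixes K' G \<tau> :: "real \<Rightarrow> real"
  assumes i: "(\<lambda>u. - K' u * G u) integrable_on {0..1}" and M: "0 < - integral {0..1} (\<lambda>u. K' u * \<tau> u)"
    and C: "\<And>u. u \<in> {0..1} \<Longrightarrow> \<bar>K' u\<bar> \<le> C" and d: "\<And>u. u \<in> {0..1} \<Longrightarrow> \<bar>G u - \<tau> u\<bar> \<le> c"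
  shows "- integral {0..1} (\<lambda>u. K' u * \<tau> u) - C * c \<le> integral {0..1} (\<lambda>u. - K' u * G u)"
proof -
  \<comment> \<open>Integrability of the limit is read off from positivity: a nonintegrable function
    would have integral 0.\<close>
  have \<tau>i: "(\<lambda>u. K' u * \<tau> u) integrable_on {0..1}"
    using M not_integrable_integral[of "\<lambda>u. K' u * \<tau> u" "{0..1}"] by force
  have "integral {0..1} (\<lambda>u. - K' u * \<tau> u - C * c) \<le> integral {0..1} (\<lambda>u. - K' u * G u)"
  proof (rule integral_le[OF _ i])
    show "(\<lambda>u. - K' u * \<tau> u - C * c) integrable_on {0..1}"
      using integrable_neg[OF \<tau>i] by (intro integrable_diff) auto
    fix u :: real assume u: "u \<in> {0..1}"
    have "\<bar>K' u * (G u - \<tau> u)\<bar> \<le> C * c" unfolding abs_mult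
      using C[OF u] d[OF u] by (intro mult_mono) auto
    thus "- K' u * \<tau> u - C * c \<le> - K' u * G u" by (simp add: algebra_simps abs_le_iff)
  qed
  also have "integral {0..1} (\<lambda>u. - K' u * \<tau> u - C * c) = - integral {0..1} (\<lambda>u. K' u * \<tau> u) - C * c"
    using integrable_neg[OF \<tau>i] by (subst Henstock_Kurzweil_Integration.integral_diff) auto
  finally show ?thesis .
qed

section \<open>The regression model\<close>

locale functional_regression =
  fixes D :: "(real ^ 'd) set"
    and \<nu> :: "(real ^ 'd) measure"
    and e :: "nat \<Rightarrow> 'd fld"
    and S :: "'d fld set"
    and \<rho> :: "'d fld \<Rightarrow> 'd fld \<Rightarrow> real"
    and P :: "'w measure"
    and X Y \<epsilon> :: "int ^ 'n \<Rightarrow> 'w \<Rightarrow> 'd fld"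
    and \<Psi> :: "'d fld \<Rightarrow> 'd fld"
    and K K' :: "real \<Rightarrow> real"
    and r L\<^sub>\<Psi> \<delta>\<^sub>1 :: real
    and \<theta> \<theta>' :: "'d fld \<Rightarrow> nat \<Rightarrow> real \<Rightarrow> real"
    and L :: "'d fld \<Rightarrow> nat \<Rightarrow> real"
    and L\<^sub>K :: real
    and \<tau> :: "'d fld \<Rightarrow> real \<Rightarrow> real"
    and \<delta>\<^sub>6 :: real and L\<^sub>F :: "'d fld \<Rightarrow> real"
    and \<gamma> \<kappa>\<^sub>0 \<kappa>\<^sub>1 d\<^sub>0 d\<^sub>1 :: real
  assumes D: "compact D"
    and \<nu>: "finite_measure \<nu>" "sets \<nu> = sets (restrict_space borel D)"
    and e: "orthonormal_basis \<nu> e"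
    and S: "l2_subset \<nu> S" "{x. continuous_on D x} \<subseteq> S"
    and \<rho>: "pseudo_metric_on S \<rho>" "\<forall>x\<in>S. \<forall>y\<in>S. \<rho> x y \<le> l2_dist \<nu> x y"
    and P: "prob_space P"
    and X: "\<forall>s. X s \<in> P \<rightarrow>\<^sub>M l2_borel \<nu> S"
    and Y: "\<forall>s. Y s \<in> P \<rightarrow>\<^sub>M l2_borel \<nu> (l2_space \<nu>)"
    and stationary: "strictly_stationary P (l2_borel \<nu> S \<Otimes>\<^sub>M l2_borel \<nu> (l2_space \<nu>))
                       (\<lambda>s \<omega>. (X s \<omega>, Y s \<omega>))"
    and \<Psi>: "\<forall>x\<in>S. \<Psi> x \<in> l2_space \<nu>"
    and \<epsilon>: "\<forall>s. \<epsilon> s \<in> P \<rightarrow>\<^sub>M l2_borel \<nu> (l2_space \<nu>)"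
           "\<forall>s. l2_cond_mean_zero P \<nu> (\<epsilon> s) (l2_borel \<nu> S) (X s)"
    and model: "\<forall>s. AE \<omega> in P. AE u in \<nu>. Y s \<omega> u = \<Psi> (X s \<omega>) u + \<epsilon> s \<omega> u"
    and r: "0 < r" "r \<le> 1"
    and \<Psi>_hoelder: "\<forall>x\<in>S. \<forall>y\<in>S. l2_dist \<nu> (\<Psi> x) (\<Psi> y) \<le> L\<^sub>\<Psi> * l2_dist \<nu> x y powr r"
    and \<theta>: "\<forall>s. \<forall>x\<in>S. \<forall>j. cond_exp_version P
              (\<lambda>\<omega>. l2_inner \<nu> (\<Psi> (X s \<omega>)) (e j) - l2_inner \<nu> (\<Psi> x) (e j))
              (\<lambda>\<omega>. \<rho> (X s \<omega>) x) (\<theta> x j)"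
    and \<delta>\<^sub>1: "0 < \<delta>\<^sub>1"
    and \<theta>_0: "\<forall>x\<in>S. \<forall>j. \<theta> x j 0 = 0"
    and \<theta>': "\<forall>x\<in>S. \<forall>j. \<forall>u\<in>{0..\<delta>\<^sub>1}. (\<theta> x j has_real_derivative \<theta>' x j u) (at u within {0..})"
    and L: "\<forall>x\<in>S. \<forall>j. 0 < L x j"
           "\<forall>x\<in>S. \<forall>j. \<forall>u\<in>{0..\<delta>\<^sub>1}. \<bar>\<theta>' x j u - \<theta>' x j 0\<bar> \<le> L x j * u powr r"
    and \<theta>'_sum: "(SUP x\<in>S. \<Sum>j. ennreal ((\<theta>' x j 0)\<^sup>2)) < \<infinity>"
    and L_sum: "(SUP x\<in>S. \<Sum>j. ennreal ((L x j)\<^sup>2)) < \<infinity>"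
    and K_support: "\<forall>u>1. K u = 0"
    and K': "\<forall>u\<in>{0..1}. (K has_real_derivative K' u) (at u within {0..1})"
            "continuous_on {0..1} K'" "\<forall>u\<in>{0..1}. K' u \<le> 0"
    and K_lip: "\<forall>u\<in>{0..1}. \<forall>v\<in>{0..1}. \<bar>K u - K v\<bar> \<le> L\<^sub>K * \<bar>u - v\<bar>"
    and K_1: "K 1 = 0"
    and F_pos: "\<forall>x\<in>S. \<forall>z>0. 0 < small_ball P X \<rho> x z"
    and \<tau>: "uniform_limit (S \<times> {0..1}) (\<lambda>z (x, u). small_ball P X \<rho> x (z * u) / small_ball P X \<rho> x z)
              (\<lambda>(x, u). \<tau> x u) (at_right 0)"
    and M: "\<forall>x\<in>S. 0 < K 1 - integral {0..1} (\<lambda>u. K' u * \<tau> x u)"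
           "0 < (INF x\<in>S. K 1 - integral {0..1} (\<lambda>u. K' u * \<tau> x u))"
    and \<delta>\<^sub>6: "0 < \<delta>\<^sub>6"
    and F_lip: "\<forall>x\<in>S. \<forall>w. 0 < w \<and> w \<le> \<delta>\<^sub>6 \<longrightarrow>
                  (\<forall>z\<in>S. \<forall>z'\<in>S. \<forall>u\<in>{0..1}. \<forall>u'\<in>{0..1}.
                     \<bar>small_ball P X \<rho> z (w * u) / small_ball P X \<rho> x w
                       - small_ball P X \<rho> z' (w * u') / small_ball P X \<rho> x w\<bar>
                     \<le> L\<^sub>F x * (\<rho> z z' + \<bar>u - u'\<bar>))"
    and tail_const: "1 \<le> \<gamma>" "0 < \<kappa>\<^sub>0" "0 < \<kappa>\<^sub>1" "0 < d\<^sub>0" "0 < d\<^sub>1"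
    and Y_tail: "\<forall>s. \<forall>z\<ge>0. measure P {\<omega>\<in>space P. l2_norm \<nu> (Y s \<omega>) \<ge> z} \<le> \<kappa>\<^sub>0 * exp (- \<kappa>\<^sub>1 * z powr \<gamma>)"
    and Y_coord: "\<forall>s j. (\<integral>\<omega>. (l2_inner \<nu> (Y s \<omega>) (e j))\<^sup>2 \<partial>P) \<le> d\<^sub>0 * exp (- d\<^sub>1 * real j)"
    and weak_dep_Y: "(SUP j. SUP B\<in>{0<..}. \<Sum>i. weak_dep_coeff P \<nu> S X
                        (\<lambda>s \<omega>. truncate B (l2_inner \<nu> (Y s \<omega>) (e j))) (Suc i)) < \<infinity>"
    and weak_dep_1: "(\<Sum>i. weak_dep_coeff P \<nu> S X (\<lambda>s \<omega>. 1) (Suc i)) < \<infinity>"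
begin

section \<open>Consequences of the hypotheses on the model, the kernel and the small ball
  probability\<close>

sublocale prob_space P by (rule P)

abbreviation F :: "'d fld \<Rightarrow> real \<Rightarrow> real" where "F \<equiv> small_ball P X \<rho>"

lemma S_l2: "S \<subseteq> l2_space \<nu>"
  using S(1) by (simp add: l2_subset_def)

lemma space_\<nu>: "space \<nu> = D"
  using sets_eq_imp_space_eq[OF \<nu>(2)] by (simp add: space_restrict_space)

lemma X_meas [measurable]: "X s \<in> P \<rightarrow>\<^sub>M l2_borel \<nu> S"
  and Y_meas [measurable]: "Y s \<in> P \<rightarrow>\<^sub>M l2_borel \<nu> (l2_space \<nu>)"
  and \<epsilon>_meas [measurable]: "\<epsilon> s \<in> P \<rightarrow>\<^sub>M l2_borel \<nu> (l2_space \<nu>)"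
  using X Y \<epsilon> by auto

lemma X_space: "\<omega> \<in> space P \<Longrightarrow> X s \<omega> \<in> S"
  and Y_space: "\<omega> \<in> space P \<Longrightarrow> Y s \<omega> \<in> l2_space \<nu>"
  and \<epsilon>_space: "\<omega> \<in> space P \<Longrightarrow> \<epsilon> s \<omega> \<in> l2_space \<nu>"
  using measurable_space[OF X_meas] measurable_space[OF Y_meas] measurable_space[OF \<epsilon>_meas] by simp_all

lemma e_l2: "e j \<in> l2_space \<nu>" and e_norm: "l2_norm \<nu> (e j) = 1"
  using orthonormal_basisD[OF e] by auto

lemma coord_le_norm: "x \<in> l2_space \<nu> \<Longrightarrow> \<bar>l2_inner \<nu> x (e j)\<bar> \<le> l2_norm \<nu> x"
  using l2_Cauchy_Schwarz[of x \<nu> "e j"] e_l2 e_norm by simp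

abbreviation Yc :: "nat \<Rightarrow> int ^ 'n \<Rightarrow> 'w \<Rightarrow> real" where
  "Yc j s \<omega> \<equiv> l2_inner \<nu> (Y s \<omega>) (e j)"

lemma norm_Y_meas [measurable]: "(\<lambda>\<omega>. l2_norm \<nu> (Y s \<omega>)) \<in> borel_measurable P"
  and coord_Y_meas [measurable]: "(\<lambda>\<omega>. Yc j s \<omega>) \<in> borel_measurable P"
  and coord_\<epsilon>_meas [measurable]: "(\<lambda>\<omega>. l2_inner \<nu> (\<epsilon> s \<omega>) (e j)) \<in> borel_measurable P"
  using measurable_compose[OF Y_meas l2_norm_measurable]
    measurable_compose[OF Y_meas l2_inner_measurable[OF e_l2]]
    measurable_compose[OF \<epsilon>_meas l2_inner_measurable[OF e_l2]] by auto

lemma lip_ball_S: "lip_ball D R \<subseteq> S"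
  using S(2) unfolding lip_ball_def by blast

text \<open>\<open>b\<close> serves both as a Lipschitz constant and as a bound of the kernel.\<close>

definition b :: real where "b = \<bar>L\<^sub>K\<bar> + 1"

lemma b_pos: "0 < b" by (simp add: b_def)

text \<open>Arguments are clipped at 1: this does not change K, which vanishes from 1 on, and does
  not increase distances.\<close>

lemma K_lipschitz:
  assumes "0 \<le> u" "0 \<le> v" shows "\<bar>K u - K v\<bar> \<le> b * \<bar>u - v\<bar>"
proof -
  have le: "\<bar>K u - K v\<bar> \<le> b * \<bar>u - v\<bar>" if "0 \<le> u" "u \<le> v" for u v
  proof -
    define u' v' where "u' = min 1 u" and "v' = min 1 v"
    have "K w = 0" if "1 \<le> w" for w using K_support K_1 that by (cases "w = 1") auto
    hence "K u = K u'" "K v = K v'" using K_1 by (auto simp: u'_def v'_def min_def)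
    moreover have "\<bar>K u' - K v'\<bar> \<le> L\<^sub>K * \<bar>u' - v'\<bar>"
      using that by (intro K_lip[rule_format]) (auto simp: u'_def v'_def)
    moreover have "L\<^sub>K * \<bar>u' - v'\<bar> \<le> b * \<bar>u - v\<bar>"
      using that by (intro mult_mono) (auto simp: b_def u'_def v'_def)
    ultimately show ?thesis by simp
  qed
  show ?thesis using le[of u v] le[of v u] assms by (cases "u \<le> v") (auto simp: abs_minus_commute)
qed

lemma K_bound: "0 \<le> u \<Longrightarrow> \<bar>K u\<bar> \<le> b"
proof (cases "u \<le> 1")
  case True
  assume "0 \<le> u"
  hence "\<bar>K u\<bar> \<le> b * \<bar>u - 1\<bar>" using K_lipschitz[of u 1] K_1 by simp
  also have "\<dots> \<le> b * 1" using True \<open>0 \<le> u\<close> b_pos by (intro mult_left_mono) auto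
  finally show ?thesis by simp
qed (use K_support b_pos in auto)

text \<open>The coefficients of the constant field do not depend on B, so one \<Phi> serves for
  every B >= 1. The denominator can then be treated at the same level B as the truncated
  numerator.\<close>

lemma kernel_field_one:
  obtains \<Phi> where "0 \<le> \<Phi>" "\<And>B. 1 \<le> B \<Longrightarrow> kernel_field P \<nu> S X (\<lambda>s \<omega>. 1) B \<Phi> \<rho> K b b"
proof
  define \<Phi> where "\<Phi> = enn2real (\<Sum>i. weak_dep_coeff P \<nu> S X (\<lambda>s \<omega>. 1) (Suc i))"
  show "0 \<le> \<Phi>" by (simp add: \<Phi>_def)
  show "kernel_field P \<nu> S X (\<lambda>s \<omega>. 1) B \<Phi> \<rho> K b b" if "1 \<le> B" for B
    by unfold_locales
       (use that S_l2 \<rho> K_lipschitz b_pos K_bound K_support weak_dep_1 in \<open>auto simp: \<Phi>_def less_top\<close>)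
qed

text \<open>The supremum over coordinates and truncation levels gives a single \<Phi>, so the
  exponential bound has the same constants for all coordinates although the level grows with
  m.\<close>

lemma kernel_field_Y:
  obtains \<Phi> where "0 \<le> \<Phi>" "\<And>j B. 0 < B \<Longrightarrow>
    kernel_field P \<nu> S X (\<lambda>s \<omega>. truncate B (Yc j s \<omega>)) B \<Phi> \<rho> K b b"
proof
  define \<Psi>' where "\<Psi>' = (SUP j. SUP B\<in>{0<..}. \<Sum>i. weak_dep_coeff P \<nu> S X
                        (\<lambda>s \<omega>. truncate B (Yc j s \<omega>)) (Suc i))"
  define \<Phi> where "\<Phi> = enn2real \<Psi>'"
  show "0 \<le> \<Phi>" by (simp add: \<Phi>_def)
  have eq: "\<Psi>' = ennreal \<Phi>" using weak_dep_Y by (simp add: \<Phi>_def \<Psi>'_def less_top)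
  fix j :: nat and B :: real assume B: "0 < B"
  have "(\<Sum>i. weak_dep_coeff P \<nu> S X (\<lambda>s \<omega>. truncate B (Yc j s \<omega>)) (Suc i))
     \<le> (SUP B\<in>{0<..}. \<Sum>i. weak_dep_coeff P \<nu> S X (\<lambda>s \<omega>. truncate B (Yc j s \<omega>)) (Suc i))"
    using B by (intro SUP_upper) auto
  also have "\<dots> \<le> \<Psi>'" unfolding \<Psi>'_def by (rule SUP_upper) auto
  finally have le: "(\<Sum>i. weak_dep_coeff P \<nu> S X (\<lambda>s \<omega>. truncate B (Yc j s \<omega>)) (Suc i)) \<le> ennreal \<Phi>"
    by (simp add: eq)
  have tm: "(\<lambda>\<omega>. truncate B (Yc j s \<omega>)) \<in> borel_measurable P" for s
    unfolding truncate_def by measurable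
  show "kernel_field P \<nu> S X (\<lambda>s \<omega>. truncate B (Yc j s \<omega>)) B \<Phi> \<rho> K b b"
    by unfold_locales
       (use S_l2 \<rho> K_lipschitz b_pos K_bound K_support le B tm in \<open>auto simp: \<Phi>_def truncate_def\<close>)
qed

lemma \<rho>_nonneg: "x \<in> S \<Longrightarrow> x' \<in> S \<Longrightarrow> 0 \<le> \<rho> x x'"
  using \<rho>(1) unfolding pseudo_metric_on_def by blast

abbreviation kern :: "'d fld \<Rightarrow> real \<Rightarrow> int ^ 'n \<Rightarrow> 'w \<Rightarrow> real" where
  "kern x h s \<omega> \<equiv> K (\<rho> (X s \<omega>) x / h)"

lemma \<rho>_measurable:
  assumes "x \<in> S" shows "(\<lambda>z. \<rho> z x) \<in> borel_measurable (l2_borel \<nu> S)"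
proof (rule l2_lipschitz_measurable[where C = 1])
  fix z z' assume "z \<in> S" "z' \<in> S"
  obtain \<Phi> where "kernel_field P \<nu> S X (\<lambda>s \<omega>. 1) 1 \<Phi> \<rho> K b b"
    using kernel_field_one[where thesis = thesis] by (metis order_refl)
  from kernel_field.\<rho>_diff_le'[OF this assms \<open>z' \<in> S\<close> \<open>z \<in> S\<close>]
  show "\<bar>\<rho> z x - \<rho> z' x\<bar> \<le> 1 * l2_dist \<nu> z z'" by simp
qed

lemma \<rho>X_measurable: "x \<in> S \<Longrightarrow> (\<lambda>\<omega>. \<rho> (X s \<omega>) x) \<in> borel_measurable P"
  by (rule measurable_compose[OF X_meas \<rho>_measurable])

lemma kernel_measurable:
  assumes "x \<in> S" "0 < h"
  shows "(\<lambda>z. K (\<rho> z x / h)) \<in> borel_measurable (l2_borel \<nu> S)"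
proof -
  obtain \<Phi> where "kernel_field P \<nu> S X (\<lambda>s \<omega>. 1) 1 \<Phi> \<rho> K b b"
    using kernel_field_one[where thesis = thesis] by (metis order_refl)
  from kernel_field.kernel_measurable[OF this assms] show ?thesis .
qed

lemma kern_measurable: "x \<in> S \<Longrightarrow> 0 < h \<Longrightarrow> kern x h s \<in> borel_measurable P"
  by (rule measurable_compose[OF X_meas kernel_measurable])

lemma kern_bound: "x \<in> S \<Longrightarrow> 0 < h \<Longrightarrow> \<omega> \<in> space P \<Longrightarrow> \<bar>kern x h s \<omega>\<bar> \<le> b"
  using \<rho>_nonneg X_space by (intro K_bound) auto

lemma kern_integrable: "x \<in> S \<Longrightarrow> 0 < h \<Longrightarrow> integrable P (kern x h s)"
  by (rule integrable_const_bound[where B = b]) (auto intro!: AE_I2 kern_bound kern_measurable)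

lemma mult_kern_integrable:
  assumes "x \<in> S" "0 < h" "integrable P f"
  shows "integrable P (\<lambda>\<omega>. f \<omega> * kern x h s \<omega>)"
proof (rule Bochner_Integration.integrable_bound)
  show "integrable P (\<lambda>\<omega>. b * f \<omega>)" using assms(3) by simp
  show "(\<lambda>\<omega>. f \<omega> * kern x h s \<omega>) \<in> borel_measurable P"
    using assms kern_measurable by (intro borel_measurable_times) auto
  show "AE \<omega> in P. norm (f \<omega> * kern x h s \<omega>) \<le> norm (b * f \<omega>)"
    using kern_bound[OF assms(1,2)] b_pos
    by (intro AE_I2) (auto simp: abs_mult mult.commute[of b] intro!: mult_left_mono)
qed

text \<open>Stationarity for the single site 0 shifted by s, tested on a cylinder event that depends
  on the X-component alone.\<close>

lemma marginal:
  assumes x: "x \<in> S"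
  shows "prob {\<omega>\<in>space P. \<rho> (X s \<omega>) x \<le> z} = F x z"
proof -
  let ?A = "l2_borel \<nu> S \<Otimes>\<^sub>M l2_borel \<nu> (l2_space \<nu>)"
  let ?M = "PiM {0 :: int ^ 'n} (\<lambda>_. ?A)"
  define Q where "Q = {f \<in> space ?M. \<rho> (fst (f 0)) x \<le> z}"
  have "(\<lambda>f. fst (f 0)) \<in> ?M \<rightarrow>\<^sub>M l2_borel \<nu> S"
    by (rule measurable_compose[OF _ measurable_fst], rule measurable_component_singleton) simp
  note [measurable] = measurable_compose[OF this \<rho>_measurable[OF x]]
  have Q: "Q \<in> sets ?M" unfolding Q_def by measurable
  have Zm: "(\<lambda>\<omega>. \<lambda>s\<in>{0}. (X (s + t) \<omega>, Y (s + t) \<omega>)) \<in> P \<rightarrow>\<^sub>M ?M" for t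
    by (intro measurable_restrict) measurable
  have val: "measure (distr P ?M (\<lambda>\<omega>. \<lambda>s\<in>{0}. (X (s + t) \<omega>, Y (s + t) \<omega>))) Q
        = prob {\<omega>\<in>space P. \<rho> (X t \<omega>) x \<le> z}" for t
  proof -
    have "(\<lambda>\<omega>. \<lambda>s\<in>{0}. (X (s + t) \<omega>, Y (s + t) \<omega>)) -` Q \<inter> space P = {\<omega>\<in>space P. \<rho> (X t \<omega>) x \<le> z}"
      using measurable_space[OF Zm[of t]] by (auto simp: Q_def)
    thus ?thesis by (simp add: measure_distr[OF Zm Q])
  qed
  have "distr P ?M (\<lambda>\<omega>. \<lambda>s\<in>{0}. (X s \<omega>, Y s \<omega>)) = distr P ?M (\<lambda>\<omega>. \<lambda>s'\<in>{0}. (X (s' + s) \<omega>, Y (s' + s) \<omega>))"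
    using stationary unfolding strictly_stationary_def by blast
  from arg_cong[OF this, of "\<lambda>M. measure M Q"] show ?thesis
    using val[of s] val[of 0] by (simp add: small_ball_def)
qed

lemma F_le_1: "F x z \<le> 1" and F_nonneg: "0 \<le> F x z"
  by (simp_all add: small_ball_def)

lemma kern_mean:
  assumes x: "x \<in> S" and h: "0 < h"
  shows "expectation (kern x h s) = integral {0..1} (\<lambda>u. - K' u * F x (h * u))"
    and "(\<lambda>u. - K' u * F x (h * u)) integrable_on {0..1}"
    and "\<omega> \<in> space P \<Longrightarrow> 0 \<le> kern x h s \<omega>"
proof -
  note km = kernel_mean[where U = "\<lambda>\<omega>. \<rho> (X s \<omega>) x" and K = K and K' = K' and h = h,
      OF \<rho>X_measurable[OF x] \<rho>_nonneg[OF X_space x], unfolded marginal[OF x]]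
  show "expectation (kern x h s) = integral {0..1} (\<lambda>u. - K' u * F x (h * u))"
    "(\<lambda>u. - K' u * F x (h * u)) integrable_on {0..1}"
    "\<omega> \<in> space P \<Longrightarrow> 0 \<le> kern x h s \<omega>"
    using km(2,3,4) K' K_1 K_support h kern_measurable[OF x h] by auto
qed

text \<open>Divided by F x h, the mean of the kernel is the integral of -K' against F x (h u) / F x
  h, which is close to M_x uniformly in x.\<close>

lemma kern_mean_lower:
  obtains \<mu> where "0 < \<mu>" "\<forall>\<^sub>F h in at_right 0. \<forall>x\<in>S. \<forall>s. \<mu> * F x h \<le> expectation (kern x h s)"
proof -
  define \<mu> where "\<mu> = (INF x\<in>S. K 1 - integral {0..1} (\<lambda>u. K' u * \<tau> x u))"
  have \<mu>: "0 < \<mu>" using M(2) by (simp add: \<mu>_def)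
  have \<mu>_le: "\<mu> \<le> - integral {0..1} (\<lambda>u. K' u * \<tau> x u)" if "x \<in> S" for x
  proof -
    have "bdd_below ((\<lambda>x. K 1 - integral {0..1} (\<lambda>u. K' u * \<tau> x u)) ` S)"
      using M(1) by (intro bdd_belowI2[where m = 0]) (auto intro: less_imp_le)
    from cINF_lower[OF this that] show ?thesis using K_1 by (simp add: \<mu>_def)
  qed
  obtain C where C: "\<And>u. u \<in> {0..1} \<Longrightarrow> \<bar>K' u\<bar> \<le> C" and C0: "0 < C"
  proof -
    have "bounded (K' ` {0..1})" by (intro compact_imp_bounded compact_continuous_image K'(2)) auto
    then obtain a where a: "\<forall>u\<in>{0..1}. \<bar>K' u\<bar> \<le> a" by (auto simp: bounded_iff)
    show thesis by (rule that[of "\<bar>a\<bar> + 1"]) (use a in force)+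
  qed
  \<comment> \<open>With C bounding K', this accuracy loses half of \<mu> in the integral.\<close>
  have "0 < \<mu> / (2 * C)" using \<mu> C0 by simp
  from uniform_limitD[OF \<tau> this]
  have "\<forall>\<^sub>F h in at_right 0. \<forall>x\<in>S. \<forall>s. \<mu> / 2 * F x h \<le> expectation (kern x h s)"
    using eventually_at_right_less
  proof eventually_elim
    case (elim h)
    show ?case
    proof (intro ballI allI)
      fix x s assume x: "x \<in> S"
      have Fp: "0 < F x h" using F_pos x elim by auto
      have i: "(\<lambda>u. - K' u * (F x (h * u) / F x h)) integrable_on {0..1}"
        using integrable_cmul[OF kern_mean(2)[OF x elim(2)], of "inverse (F x h)"]
        by (simp add: divide_inverse mult_ac)
      have "\<mu> - C * (\<mu> / (2 * C)) \<le> - integral {0..1} (\<lambda>u. K' u * \<tau> x u) - C * (\<mu> / (2 * C))"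
        using \<mu>_le[OF x] by simp
      also have "\<dots> \<le> integral {0..1} (\<lambda>u. - K' u * (F x (h * u) / F x h))"
        by (rule kernel_integral_perturb[OF i _ C])
           (use M(1) K_1 x elim in \<open>auto simp: dist_real_def intro: less_imp_le\<close>)
      also have "\<dots> = expectation (kern x h s) / F x h"
        unfolding kern_mean(1)[OF x elim(2)] by (simp add: Henstock_Kurzweil_Integration.integral_divide)
      finally show "\<mu> / 2 * F x h \<le> expectation (kern x h s)" using Fp C0 by (simp add: field_simps)
    qed
  qed
  with \<mu> show thesis by (intro that[of "\<mu> / 2"]) auto
qed

end

text \<open>A pointwise replacement for Cauchy-Schwarz under the expectation: the free weight a
  balances a second moment against a constant or a small probability.\<close>

lemma abs_le_weighted_square: "0 < a \<Longrightarrow> \<bar>z\<bar> \<le> (a * z\<^sup>2 + 1 / a) / (2 :: real)"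
proof -
  assume a: "0 < a"
  have "0 \<le> (a * \<bar>z\<bar> - 1)\<^sup>2 / a" using a by simp
  also have "\<dots> = a * z\<^sup>2 - 2 * \<bar>z\<bar> + 1 / a" using a by (simp add: power2_eq_square field_simps)
  finally show ?thesis by simp
qed

context functional_regression
begin

subsection \<open>Bias\<close>

text \<open>Mean value inequality from \<theta>(0) = 0; on [0, 1] the power u^r is at most 1, so the
  derivative is bounded by \<bar>\<theta>'(0)\<bar> + L. This is the source of a bias linear in
  h.\<close>

lemma \<theta>_bound:
  assumes x: "x \<in> S" and u: "0 \<le> u" "u \<le> \<delta>\<^sub>1" "u \<le> 1"
  shows "\<bar>\<theta> x j u\<bar> \<le> u * (\<bar>\<theta>' x j 0\<bar> + L x j)"
proof -
  have "norm (\<theta> x j u - \<theta> x j 0) \<le> (\<bar>\<theta>' x j 0\<bar> + L x j) * norm (u - 0)"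
  proof (rule field_differentiable_bound[where S = "{0..u}" and f' = "\<theta>' x j"])
    fix z assume z: "z \<in> {0..u}"
    hence z': "z \<in> {0..\<delta>\<^sub>1}" "z \<le> 1" using u by auto
    show "(\<theta> x j has_field_derivative \<theta>' x j z) (at z within {0..u})"
      using \<theta>' x z' by (intro has_field_derivative_subset[where s = "{0..}" and t = "{0..u}"]) auto
    have "z powr r \<le> 1" using z z' r by (cases "z = 0") (auto intro: powr_le1)
    hence "L x j * z powr r \<le> L x j * 1" using L(1) x by (intro mult_left_mono) (auto intro: less_imp_le)
    moreover have "\<bar>\<theta>' x j z - \<theta>' x j 0\<bar> \<le> L x j * z powr r" using L(2) x z' by blast
    ultimately show "norm (\<theta>' x j z) \<le> \<bar>\<theta>' x j 0\<bar> + L x j" by simp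
  qed (use u in auto)
  thus ?thesis using \<theta>_0 x u by (simp add: mult.commute)
qed

lemma coord_\<epsilon>_integrable: "integrable P (\<lambda>\<omega>. l2_inner \<nu> (\<epsilon> s \<omega>) (e j))"
proof (rule Bochner_Integration.integrable_bound)
  show "integrable P (\<lambda>\<omega>. l2_norm \<nu> (\<epsilon> s \<omega>))" using \<epsilon>(2) by (auto simp: l2_cond_mean_zero_def)
  show "AE \<omega> in P. norm (l2_inner \<nu> (\<epsilon> s \<omega>) (e j)) \<le> norm (l2_norm \<nu> (\<epsilon> s \<omega>))"
    using coord_le_norm[OF \<epsilon>_space] by (intro AE_I2) simp
qed measurable

text \<open>The kernel weight is a function of X at the same site and can be pulled into the
  conditional expectation of the noise.\<close>

lemma noise_kern_mean_zero:
  assumes x: "x \<in> S" and h: "0 < h"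
  shows "(\<integral>\<omega>. l2_inner \<nu> (\<epsilon> s \<omega>) (e j) * kern x h s \<omega> \<partial>P) = 0"
proof -
  let ?V = "vimage_algebra (space P) (X s) (l2_borel \<nu> S)"
  have sub: "subalgebra P ?V" unfolding subalgebra_def
    using X_meas[of s] by (auto simp: measurable_iff_sets)
  interpret finite_measure_subalgebra P ?V by unfold_locales (rule sub)
  have km: "kern x h s \<in> borel_measurable ?V"
    by (rule measurable_compose[OF measurable_vimage_algebra1 kernel_measurable[OF x h]]) (auto simp: X_space)
  have int: "integrable P (\<lambda>\<omega>. kern x h s \<omega> * l2_inner \<nu> (\<epsilon> s \<omega>) (e j))"
    using mult_kern_integrable[OF x h coord_\<epsilon>_integrable] by (simp add: mult.commute)
  have "AE \<omega> in P. real_cond_exp P ?V (\<lambda>\<omega>'. l2_inner \<nu> (\<epsilon> s \<omega>') (e j)) \<omega> = 0"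
    using \<epsilon>(2) e_l2 unfolding l2_cond_mean_zero_def by blast
  hence "(\<integral>\<omega>. kern x h s \<omega> * real_cond_exp P ?V (\<lambda>\<omega>'. l2_inner \<nu> (\<epsilon> s \<omega>') (e j)) \<omega> \<partial>P) = 0"
    by (intro integral_eq_zero_AE) (auto elim: eventually_mono)
  thus ?thesis using real_cond_exp_intg(2)[OF int km coord_\<epsilon>_meas] by (simp add: mult.commute)
qed

text \<open>Conditioning on the distance U = \<rho>(X, x) replaces the increment of \<psi> by
  \<theta>(U), as the kernel weight depends on U alone. On the support of the kernel U is at most h,
  an event of probability F x h.\<close>

lemma signal_kern_mean:
  assumes x: "x \<in> S" and h: "0 < h" "h \<le> \<delta>\<^sub>1" "h \<le> 1"
  shows "\<bar>\<integral>\<omega>. (l2_inner \<nu> (\<Psi> (X s \<omega>)) (e j) - l2_inner \<nu> (\<Psi> x) (e j)) * kern x h s \<omega> \<partial>P\<bar>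
           \<le> b * h * (\<bar>\<theta>' x j 0\<bar> + L x j) * F x h"
proof -
  define U where "U \<omega> = \<rho> (X s \<omega>) x" for \<omega>
  define Z where "Z \<omega> = l2_inner \<nu> (\<Psi> (X s \<omega>)) (e j) - l2_inner \<nu> (\<Psi> x) (e j)" for \<omega>
  let ?V = "vimage_algebra (space P) U borel"
  have Um [measurable]: "U \<in> borel_measurable P" unfolding U_def by (rule \<rho>X_measurable[OF x])
  have U0: "0 \<le> U \<omega>" if "\<omega> \<in> space P" for \<omega> unfolding U_def by (intro \<rho>_nonneg X_space x that)
  have cv: "integrable P Z" "\<theta> x j \<in> borel_measurable borel" "AE \<omega> in P. real_cond_exp P ?V Z \<omega> = \<theta> x j (U \<omega>)"
    using \<theta> x unfolding cond_exp_version_def U_def[abs_def] Z_def[abs_def] by blast+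
  note [measurable] = cv(2)
  have sub: "subalgebra P ?V" unfolding subalgebra_def
    using Um by (auto simp: measurable_iff_sets)
  interpret finite_measure_subalgebra P ?V by unfold_locales (rule sub)
  \<comment> \<open>The kernel is controlled on the nonnegative axis; composing with max 0 makes it
    Borel on the whole line without changing its values at distances.\<close>
  have "continuous_on UNIV (\<lambda>u. K (max 0 u))"
  proof (rule continuous_onI)
    fix u \<epsilon> :: real assume \<epsilon>: "0 < \<epsilon>"
    show "\<exists>d>0. \<forall>u'\<in>UNIV. dist u' u < d \<longrightarrow> dist (K (max 0 u')) (K (max 0 u)) \<le> \<epsilon>"
    proof (intro exI conjI ballI impI)
      show "0 < \<epsilon> / b" using \<epsilon> b_pos by simp
      fix u' :: real assume u': "dist u' u < \<epsilon> / b"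
      have "\<bar>K (max 0 u') - K (max 0 u)\<bar> \<le> b * \<bar>max 0 u' - max 0 u\<bar>" by (rule K_lipschitz) auto
      also have "\<dots> \<le> b * \<bar>u' - u\<bar>" using b_pos by (intro mult_left_mono) auto
      also have "\<dots> \<le> \<epsilon>" using u' b_pos by (simp add: dist_real_def field_simps)
      finally show "dist (K (max 0 u')) (K (max 0 u)) \<le> \<epsilon>" by (simp add: dist_real_def)
    qed
  qed
  hence [measurable]: "(\<lambda>u. K (max 0 u)) \<in> borel_measurable borel" by (rule borel_measurable_continuous_onI)
  define k where "k \<omega> = K (max 0 (U \<omega> / h))" for \<omega>
  have k_eq: "k \<omega> = kern x h s \<omega>" if "\<omega> \<in> space P" for \<omega>
    using U0[OF that] h by (simp add: k_def U_def max_def)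
  have "U \<in> borel_measurable ?V" by (rule measurable_vimage_algebra1) auto
  hence km: "k \<in> borel_measurable ?V" unfolding k_def by measurable
  have kmP: "k \<in> borel_measurable P" unfolding k_def by measurable
  have Zk: "integrable P (\<lambda>\<omega>. k \<omega> * Z \<omega>)"
    using mult_kern_integrable[OF x h(1) cv(1), of s]
    by (rule Bochner_Integration.integrable_cong[THEN iffD1, rotated -1]) (auto simp: k_eq mult.commute)
  have Zm: "Z \<in> borel_measurable P" using cv(1) by auto
  have "(\<integral>\<omega>. Z \<omega> * kern x h s \<omega> \<partial>P) = (\<integral>\<omega>. k \<omega> * Z \<omega> \<partial>P)"
    by (rule Bochner_Integration.integral_cong) (auto simp: k_eq mult.commute)
  also have "\<dots> = (\<integral>\<omega>. k \<omega> * real_cond_exp P ?V Z \<omega> \<partial>P)"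
    by (rule real_cond_exp_intg(2)[OF Zk km Zm, symmetric])
  also have "\<bar>\<dots>\<bar> \<le> (\<integral>\<omega>. \<bar>k \<omega> * real_cond_exp P ?V Z \<omega>\<bar> \<partial>P)" by (rule integral_abs_bound)
  also have "\<dots> \<le> (\<integral>\<omega>. b * h * (\<bar>\<theta>' x j 0\<bar> + L x j) * indicator {\<omega>\<in>space P. U \<omega> \<le> h} \<omega> \<partial>P)"
  proof (rule integral_mono_AE)
    show "integrable P (\<lambda>\<omega>. \<bar>k \<omega> * real_cond_exp P ?V Z \<omega>\<bar>)"
      using real_cond_exp_intg(1)[OF Zk km Zm] by simp
    show "AE \<omega> in P. \<bar>k \<omega> * real_cond_exp P ?V Z \<omega>\<bar>
        \<le> b * h * (\<bar>\<theta>' x j 0\<bar> + L x j) * indicator {\<omega>\<in>space P. U \<omega> \<le> h} \<omega>"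
      using cv(3) AE_space
    proof eventually_elim
      case (elim \<omega>)
      show ?case
      proof (cases "U \<omega> \<le> h")
        case True
        have t: "0 \<le> \<bar>\<theta>' x j 0\<bar> + L x j" using L(1) x by (simp add: add_nonneg_nonneg less_imp_le)
        have "\<bar>\<theta> x j (U \<omega>)\<bar> \<le> U \<omega> * (\<bar>\<theta>' x j 0\<bar> + L x j)"
          using True h U0[OF elim(2)] by (intro \<theta>_bound x) auto
        also have "\<dots> \<le> h * (\<bar>\<theta>' x j 0\<bar> + L x j)" using True t by (intro mult_right_mono) auto
        finally have "\<bar>k \<omega>\<bar> * \<bar>\<theta> x j (U \<omega>)\<bar> \<le> b * (h * (\<bar>\<theta>' x j 0\<bar> + L x j))"
          using b_pos unfolding k_def by (intro mult_mono K_bound) auto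
        thus ?thesis using True elim by (simp add: abs_mult mult.assoc)
      next
        case False
        hence "k \<omega> = 0" using K_support h by (simp add: k_def max_def field_simps)
        thus ?thesis using False by simp
      qed
    qed
    show "integrable P (\<lambda>\<omega>. b * h * (\<bar>\<theta>' x j 0\<bar> + L x j) * indicator {\<omega>\<in>space P. U \<omega> \<le> h} \<omega>)"
      by (intro Bochner_Integration.integrable_mult_right integrable_real_indicator)
         (auto simp: emeasure_eq_measure)
  qed
  also have "\<dots> = b * h * (\<bar>\<theta>' x j 0\<bar> + L x j) * F x h"
  proof -
    have "{\<omega>\<in>space P. U \<omega> \<le> h} \<inter> space P = {\<omega>\<in>space P. U \<omega> \<le> h}" by auto
    thus ?thesis using marginal[OF x, of s h] by (simp add: U_def)
  qed
  finally show ?thesis by (simp add: Z_def)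
qed

lemma norm_Y_integrable_sq: "integrable P (\<lambda>\<omega>. (l2_norm \<nu> (Y s \<omega>))\<^sup>2)"
proof (rule integrableI_nonneg)
  define g where "g i = (real i + 1)\<^sup>2 * (\<kappa>\<^sub>0 * exp (- \<kappa>\<^sub>1 * real i))" for i :: nat
  define c where "c = 1 + 4 / \<kappa>\<^sub>1"
  have sg: "summable g"
  proof (rule summable_comparison_test')
    show "summable (\<lambda>i. \<kappa>\<^sub>0 * c\<^sup>2 * exp (- \<kappa>\<^sub>1 / 2) ^ i)"
      using tail_const by (intro summable_mult summable_geometric) simp
    fix i :: nat
    have "real i + 1 \<le> c * (1 + \<kappa>\<^sub>1 * real i / 4)"
      using tail_const by (simp add: c_def field_simps)
    also have "\<dots> \<le> c * exp (\<kappa>\<^sub>1 * real i / 4)"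
      using tail_const by (intro mult_left_mono exp_ge_add_one_self) (simp add: c_def)
    finally have "(real i + 1)\<^sup>2 \<le> (c * exp (\<kappa>\<^sub>1 * real i / 4))\<^sup>2" by (rule power_mono) simp
    also have "\<dots> = c\<^sup>2 * exp (\<kappa>\<^sub>1 * real i / 2)"
      by (simp add: power_mult_distrib exp_double[symmetric])
    finally have "g i \<le> c\<^sup>2 * exp (\<kappa>\<^sub>1 * real i / 2) * (\<kappa>\<^sub>0 * exp (- \<kappa>\<^sub>1 * real i))"
      unfolding g_def using tail_const by (intro mult_right_mono) auto
    also have "\<dots> = \<kappa>\<^sub>0 * c\<^sup>2 * (exp (\<kappa>\<^sub>1 * real i / 2) * exp (- \<kappa>\<^sub>1 * real i))" by (simp add: mult_ac)
    also have "exp (\<kappa>\<^sub>1 * real i / 2) * exp (- \<kappa>\<^sub>1 * real i) = exp (- \<kappa>\<^sub>1 / 2) ^ i"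
      by (simp add: exp_add[symmetric] exp_of_nat_mult[symmetric] mult.commute)
    finally show "norm (g i) \<le> \<kappa>\<^sub>0 * c\<^sup>2 * exp (- \<kappa>\<^sub>1 / 2) ^ i"
      using tail_const by (simp add: g_def)
  qed
  have "(\<integral>\<^sup>+\<omega>. ennreal ((l2_norm \<nu> (Y s \<omega>))\<^sup>2) \<partial>P)
     \<le> (\<integral>\<^sup>+\<omega>. (\<Sum>i. ennreal ((real i + 1)\<^sup>2) * indicator {\<omega>\<in>space P. real i \<le> l2_norm \<nu> (Y s \<omega>)} \<omega>) \<partial>P)"
  proof (rule nn_integral_mono)
    fix \<omega> assume w: "\<omega> \<in> space P"
    define i where "i = nat \<lfloor>l2_norm \<nu> (Y s \<omega>)\<rfloor>"
    have i: "real i \<le> l2_norm \<nu> (Y s \<omega>)" "l2_norm \<nu> (Y s \<omega>) \<le> real i + 1"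
      using l2_norm_nonneg[of \<nu> "Y s \<omega>"] unfolding i_def by linarith+
    let ?f = "\<lambda>i. ennreal ((real i + 1)\<^sup>2) * indicator {\<omega>\<in>space P. real i \<le> l2_norm \<nu> (Y s \<omega>)} \<omega>"
    have "ennreal ((l2_norm \<nu> (Y s \<omega>))\<^sup>2) \<le> ennreal ((real i + 1)\<^sup>2)"
      using i by (intro ennreal_leI power_mono) auto
    also have "\<dots> = sum ?f {i}" using i w by simp
    also have "\<dots> \<le> suminf ?f" by (rule sum_le_suminf) auto
    finally show "ennreal ((l2_norm \<nu> (Y s \<omega>))\<^sup>2) \<le> suminf ?f" .
  qed
  also have "\<dots> = (\<Sum>i. \<integral>\<^sup>+\<omega>. ennreal ((real i + 1)\<^sup>2) * indicator {\<omega>\<in>space P. real i \<le> l2_norm \<nu> (Y s \<omega>)} \<omega> \<partial>P)"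
    by (rule nn_integral_suminf) measurable
  also have "\<dots> \<le> (\<Sum>i. ennreal (g i))"
  proof (rule suminf_le)
    fix i :: nat
    have "(\<integral>\<^sup>+\<omega>. ennreal ((real i + 1)\<^sup>2) * indicator {\<omega>\<in>space P. real i \<le> l2_norm \<nu> (Y s \<omega>)} \<omega> \<partial>P)
       = ennreal ((real i + 1)\<^sup>2) * emeasure P {\<omega>\<in>space P. real i \<le> l2_norm \<nu> (Y s \<omega>)}"
      by (rule nn_integral_cmult_indicator) measurable
    also have "\<dots> = ennreal ((real i + 1)\<^sup>2 * prob {\<omega>\<in>space P. real i \<le> l2_norm \<nu> (Y s \<omega>)})"
      by (simp add: emeasure_eq_measure ennreal_mult)
    also have "\<dots> \<le> ennreal (g i)" unfolding g_def
    proof (intro ennreal_leI mult_left_mono)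
      have "real i powr 1 \<le> real i powr \<gamma>" if "i \<noteq> 0"
        using that tail_const by (intro powr_mono) auto
      hence "real i \<le> real i powr \<gamma>" by (cases "i = 0") auto
      hence "\<kappa>\<^sub>0 * exp (- \<kappa>\<^sub>1 * real i powr \<gamma>) \<le> \<kappa>\<^sub>0 * exp (- \<kappa>\<^sub>1 * real i)"
        using tail_const by (intro mult_left_mono) auto
      moreover have "prob {\<omega>\<in>space P. real i \<le> l2_norm \<nu> (Y s \<omega>)} \<le> \<kappa>\<^sub>0 * exp (- \<kappa>\<^sub>1 * real i powr \<gamma>)"
        using Y_tail by simp
      ultimately show "prob {\<omega>\<in>space P. real i \<le> l2_norm \<nu> (Y s \<omega>)} \<le> \<kappa>\<^sub>0 * exp (- \<kappa>\<^sub>1 * real i)" by simp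
    qed simp
    finally show "(\<integral>\<^sup>+\<omega>. ennreal ((real i + 1)\<^sup>2) * indicator {\<omega>\<in>space P. real i \<le> l2_norm \<nu> (Y s \<omega>)} \<omega> \<partial>P) \<le> ennreal (g i)" .
  qed auto
  also have "\<dots> < \<infinity>"
    using sg tail_const by (subst suminf_ennreal2) (auto simp: g_def)
  finally show "(\<integral>\<^sup>+\<omega>. ennreal ((l2_norm \<nu> (Y s \<omega>))\<^sup>2) \<partial>P) < \<infinity>" .
qed auto

lemma coord_Y_integrable_sq: "integrable P (\<lambda>\<omega>. (Yc j s \<omega>)\<^sup>2)"
proof (rule Bochner_Integration.integrable_bound[OF norm_Y_integrable_sq])
  show "AE \<omega> in P. norm ((Yc j s \<omega>)\<^sup>2) \<le> norm ((l2_norm \<nu> (Y s \<omega>))\<^sup>2)"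
    using coord_le_norm[OF Y_space] by (intro AE_I2) (auto simp: abs_le_square_iff[symmetric])
qed measurable

lemma coord_Y_integrable: "integrable P (\<lambda>\<omega>. Yc j s \<omega>)"
proof (rule square_integrable_imp_integrable)
qed (auto intro: coord_Y_integrable_sq)

text \<open>After centring at \<psi>_j(x), the noise averages out and the signal increment remains.
  The factor F x h matches the order of the mean of the kernel, so the relative bias is of order
  h.\<close>

lemma bias:
  assumes x: "x \<in> S" and h: "0 < h" "h \<le> \<delta>\<^sub>1" "h \<le> 1"
  shows "\<bar>(\<integral>\<omega>. Yc j s \<omega> * kern x h s \<omega> \<partial>P) - l2_inner \<nu> (\<Psi> x) (e j) * expectation (kern x h s)\<bar>
     \<le> b * h * (\<bar>\<theta>' x j 0\<bar> + L x j) * F x h"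
proof -
  have \<theta>i: "integrable P (\<lambda>\<omega>. l2_inner \<nu> (\<Psi> (X s \<omega>)) (e j) - l2_inner \<nu> (\<Psi> x) (e j))"
    using \<theta> x unfolding cond_exp_version_def by blast
  have eq: "AE \<omega> in P. Yc j s \<omega> - l2_inner \<nu> (\<Psi> x) (e j)
      = (l2_inner \<nu> (\<Psi> (X s \<omega>)) (e j) - l2_inner \<nu> (\<Psi> x) (e j)) + l2_inner \<nu> (\<epsilon> s \<omega>) (e j)"
    using model[rule_format, of s] AE_space
  proof eventually_elim
    case (elim \<omega>)
    note sp = \<Psi>[rule_format, OF X_space[OF elim(2), of s]] \<epsilon>_space[OF elim(2), of s]
    have "Yc j s \<omega> = l2_inner \<nu> (\<lambda>u. \<Psi> (X s \<omega>) u + \<epsilon> s \<omega> u) (e j)"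
      by (rule l2_inner_cong_AE[OF elim(1) Y_space[OF elim(2)] l2_add[OF sp] e_l2])
    thus ?case by (simp add: l2_inner_add_left[OF sp e_l2])
  qed
  have "(\<integral>\<omega>. Yc j s \<omega> * kern x h s \<omega> \<partial>P) - l2_inner \<nu> (\<Psi> x) (e j) * expectation (kern x h s)
      = (\<integral>\<omega>. (Yc j s \<omega> - l2_inner \<nu> (\<Psi> x) (e j)) * kern x h s \<omega> \<partial>P)"
    using mult_kern_integrable[OF x h(1) coord_Y_integrable] kern_integrable[OF x h(1)]
    by (simp add: left_diff_distrib)
  also have "\<dots> = (\<integral>\<omega>. (l2_inner \<nu> (\<Psi> (X s \<omega>)) (e j) - l2_inner \<nu> (\<Psi> x) (e j)) * kern x h s \<omega>
       + l2_inner \<nu> (\<epsilon> s \<omega>) (e j) * kern x h s \<omega> \<partial>P)"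
  proof (rule integral_cong_AE)
    show "AE \<omega> in P. (Yc j s \<omega> - l2_inner \<nu> (\<Psi> x) (e j)) * kern x h s \<omega>
      = (l2_inner \<nu> (\<Psi> (X s \<omega>)) (e j) - l2_inner \<nu> (\<Psi> x) (e j)) * kern x h s \<omega>
       + l2_inner \<nu> (\<epsilon> s \<omega>) (e j) * kern x h s \<omega>"
      using eq by eventually_elim (simp only: distrib_right)
    show "(\<lambda>\<omega>. (Yc j s \<omega> - l2_inner \<nu> (\<Psi> x) (e j)) * kern x h s \<omega>) \<in> borel_measurable P"
      using kern_measurable[OF x h(1)] by measurable
    show "(\<lambda>\<omega>. (l2_inner \<nu> (\<Psi> (X s \<omega>)) (e j) - l2_inner \<nu> (\<Psi> x) (e j)) * kern x h s \<omega>
       + l2_inner \<nu> (\<epsilon> s \<omega>) (e j) * kern x h s \<omega>) \<in> borel_measurable P"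
      by (intro borel_measurable_add borel_measurable_integrable
          mult_kern_integrable[OF x h(1)] \<theta>i coord_\<epsilon>_integrable)
  qed
  also have "\<dots> = (\<integral>\<omega>. (l2_inner \<nu> (\<Psi> (X s \<omega>)) (e j) - l2_inner \<nu> (\<Psi> x) (e j)) * kern x h s \<omega> \<partial>P)"
    using noise_kern_mean_zero[OF x h(1)]
      mult_kern_integrable[OF x h(1) \<theta>i] mult_kern_integrable[OF x h(1) coord_\<epsilon>_integrable] by simp
  finally show ?thesis using signal_kern_mean[OF x h] by simp
qed

subsection \<open>Truncation\<close>

lemma norm_Y_tail:
  assumes B: "1 \<le> B"
  shows "prob {\<omega>\<in>space P. B \<le> l2_norm \<nu> (Y s \<omega>)} \<le> \<kappa>\<^sub>0 * exp (- \<kappa>\<^sub>1 * B)"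
proof -
  have "B powr 1 \<le> B powr \<gamma>" using B tail_const by (intro powr_mono) auto
  hence "\<kappa>\<^sub>0 * exp (- \<kappa>\<^sub>1 * B powr \<gamma>) \<le> \<kappa>\<^sub>0 * exp (- \<kappa>\<^sub>1 * B)"
    using tail_const B by (intro mult_left_mono) auto
  moreover have "prob {\<omega>\<in>space P. B \<le> l2_norm \<nu> (Y s \<omega>)} \<le> \<kappa>\<^sub>0 * exp (- \<kappa>\<^sub>1 * B powr \<gamma>)"
    using Y_tail B by simp
  ultimately show ?thesis by simp
qed

text \<open>Chebyshev at a level that itself decays in j: its square consumes half of the decay of
  the second moment, and the other half keeps the probabilities summable.\<close>

lemma coord_Y_tail:
  "prob {\<omega>\<in>space P. exp (- d\<^sub>1 * real j / 4) \<le> \<bar>Yc j s \<omega>\<bar>} \<le> d\<^sub>0 * exp (- d\<^sub>1 / 2) ^ j"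
proof -
  have e2: "(exp (- d\<^sub>1 * real j / 4))\<^sup>2 = exp (- d\<^sub>1 * real j / 2)"
    by (simp add: exp_double[symmetric])
  have "prob {\<omega>\<in>space P. exp (- d\<^sub>1 * real j / 4) \<le> \<bar>Yc j s \<omega>\<bar>}
      \<le> prob {\<omega>\<in>space P. exp (- d\<^sub>1 * real j / 2) \<le> (Yc j s \<omega>)\<^sup>2}"
    unfolding e2[symmetric] by (intro finite_measure_mono) (auto simp: abs_le_square_iff[symmetric])
  also have "\<dots> \<le> (\<integral>\<omega>. (Yc j s \<omega>)\<^sup>2 \<partial>P) / exp (- d\<^sub>1 * real j / 2)"
    by (intro integral_Markov_inequality_measure[where A = "{}"] coord_Y_integrable_sq) auto
  also have "\<dots> \<le> d\<^sub>0 * exp (- d\<^sub>1 * real j) / exp (- d\<^sub>1 * real j / 2)"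
    using Y_coord by (intro divide_right_mono) auto
  also have "\<dots> = d\<^sub>0 * (exp (- d\<^sub>1 * real j) / exp (- d\<^sub>1 * real j / 2))" by simp
  also have "exp (- d\<^sub>1 * real j) / exp (- d\<^sub>1 * real j / 2) = exp (- d\<^sub>1 * real j / 2)"
    unfolding exp_diff[symmetric] by simp
  also have "exp (- d\<^sub>1 * real j / 2) = exp (- d\<^sub>1 / 2) ^ j"
    by (simp add: exp_of_nat_mult[symmetric] mult.commute)
  finally show ?thesis .
qed

lemma coord_Y_kern_mean:
  assumes x: "x \<in> S" and h: "0 < h"
  shows "\<bar>\<integral>\<omega>. Yc j s \<omega> * kern x h s \<omega> \<partial>P\<bar> \<le> b * (d\<^sub>0 + 1) * exp (- d\<^sub>1 * real j / 4)"
proof -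
  \<comment> \<open>Makes both summands, a times the second moment and 1 / a, of order exp (- d1 j /
    2).\<close>
  define a where "a = exp (d\<^sub>1 * real j / 2)"
  have a: "0 < a" by (simp add: a_def)
  have "\<bar>\<integral>\<omega>. Yc j s \<omega> * kern x h s \<omega> \<partial>P\<bar> \<le> (\<integral>\<omega>. \<bar>Yc j s \<omega> * kern x h s \<omega>\<bar> \<partial>P)"
    by (rule integral_abs_bound)
  also have "\<dots> \<le> (\<integral>\<omega>. b * ((a * (Yc j s \<omega>)\<^sup>2 + 1 / a) / 2) \<partial>P)"
  proof (rule integral_mono)
    show "integrable P (\<lambda>\<omega>. \<bar>Yc j s \<omega> * kern x h s \<omega>\<bar>)"
      using mult_kern_integrable[OF x h coord_Y_integrable] by simp
    show "integrable P (\<lambda>\<omega>. b * ((a * (Yc j s \<omega>)\<^sup>2 + 1 / a) / 2))"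
      using coord_Y_integrable_sq[of s j] by simp
    fix \<omega> assume "\<omega> \<in> space P"
    thus "\<bar>Yc j s \<omega> * kern x h s \<omega>\<bar> \<le> b * ((a * (Yc j s \<omega>)\<^sup>2 + 1 / a) / 2)"
      unfolding abs_mult mult.commute[of "\<bar>Yc j s \<omega>\<bar>"]
      using b_pos by (intro mult_mono kern_bound[OF x h] abs_le_weighted_square a) auto
  qed
  also have "\<dots> = b * ((a * (\<integral>\<omega>. (Yc j s \<omega>)\<^sup>2 \<partial>P) + 1 / a) / 2)"
    using coord_Y_integrable_sq[of s j] by (simp add: prob_space)
  also have "\<dots> \<le> b * ((a * (d\<^sub>0 * exp (- d\<^sub>1 * real j)) + 1 / a) / 2)"
    using b_pos a Y_coord by (intro mult_left_mono divide_right_mono add_right_mono) auto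
  also have "a * (d\<^sub>0 * exp (- d\<^sub>1 * real j)) = d\<^sub>0 * exp (- d\<^sub>1 * real j / 2)"
    by (simp add: a_def exp_add[symmetric])
  also have "1 / a = exp (- d\<^sub>1 * real j / 2)" by (simp add: a_def exp_minus inverse_eq_divide)
  also have "b * ((d\<^sub>0 * exp (- d\<^sub>1 * real j / 2) + exp (- d\<^sub>1 * real j / 2)) / 2)
      \<le> b * (d\<^sub>0 + 1) * exp (- d\<^sub>1 * real j / 4)"
  proof -
    have "exp (- d\<^sub>1 * real j / 2) \<le> exp (- d\<^sub>1 * real j / 4)" using tail_const by simp
    hence "(d\<^sub>0 + 1) * exp (- d\<^sub>1 * real j / 2) \<le> (d\<^sub>0 + 1) * exp (- d\<^sub>1 * real j / 4)"
      using tail_const by (intro mult_left_mono) auto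
    moreover have "0 \<le> (d\<^sub>0 + 1) * exp (- d\<^sub>1 * real j / 2)" using tail_const by simp
    ultimately have "(d\<^sub>0 + 1) * exp (- d\<^sub>1 * real j / 2) / 2 \<le> (d\<^sub>0 + 1) * exp (- d\<^sub>1 * real j / 4)"
      by linarith
    hence "b * ((d\<^sub>0 + 1) * exp (- d\<^sub>1 * real j / 2) / 2) \<le> b * ((d\<^sub>0 + 1) * exp (- d\<^sub>1 * real j / 4))"
      using b_pos by (intro mult_left_mono) auto
    thus ?thesis by (simp add: algebra_simps)
  qed
  finally show ?thesis .
qed

lemma truncation_kern_mean:
  assumes x: "x \<in> S" and h: "0 < h" and B: "1 \<le> B"
  shows "\<bar>(\<integral>\<omega>. Yc j s \<omega> * kern x h s \<omega> \<partial>P)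
      - (\<integral>\<omega>. truncate B (Yc j s \<omega>) * kern x h s \<omega> \<partial>P)\<bar> \<le> b * (d\<^sub>0 + \<kappa>\<^sub>0) * exp (- \<kappa>\<^sub>1 * B / 2)"
proof -
  define a where "a = exp (- \<kappa>\<^sub>1 * B / 2)"
  have a: "0 < a" by (simp add: a_def)
  define y where "y \<omega> = Yc j s \<omega>" for \<omega>
  have ym [measurable]: "y \<in> borel_measurable P" unfolding y_def by measurable
  have yi: "integrable P y" unfolding y_def by (rule coord_Y_integrable)
  have y2: "integrable P (\<lambda>\<omega>. (y \<omega>)\<^sup>2)" "(\<integral>\<omega>. (y \<omega>)\<^sup>2 \<partial>P) \<le> d\<^sub>0"
  proof -
    show "integrable P (\<lambda>\<omega>. (y \<omega>)\<^sup>2)" unfolding y_def by (rule coord_Y_integrable_sq)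
    have "(\<integral>\<omega>. (y \<omega>)\<^sup>2 \<partial>P) \<le> d\<^sub>0 * exp (- d\<^sub>1 * real j)" unfolding y_def using Y_coord by blast
    also have "\<dots> \<le> d\<^sub>0 * 1" using tail_const by (intro mult_left_mono) auto
    finally show "(\<integral>\<omega>. (y \<omega>)\<^sup>2 \<partial>P) \<le> d\<^sub>0" by simp
  qed
  have ti: "integrable P (\<lambda>\<omega>. truncate B (y \<omega>))"
    by (rule integrable_const_bound[where B = B]) (use B in \<open>auto simp: truncate_def\<close>)
  let ?E = "{\<omega>\<in>space P. B \<le> l2_norm \<nu> (Y s \<omega>)}"
  have iE: "integrable P (indicator ?E :: _ \<Rightarrow> real)"
    by (rule integrable_real_indicator) (auto simp: emeasure_eq_measure)
  have E: "?E \<inter> space P = ?E" by auto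
  have "\<bar>(\<integral>\<omega>. y \<omega> * kern x h s \<omega> \<partial>P) - (\<integral>\<omega>. truncate B (y \<omega>) * kern x h s \<omega> \<partial>P)\<bar>
     = \<bar>\<integral>\<omega>. y \<omega> * kern x h s \<omega> - truncate B (y \<omega>) * kern x h s \<omega> \<partial>P\<bar>"
    using mult_kern_integrable[OF x h yi] mult_kern_integrable[OF x h ti] by simp
  also have "\<dots> \<le> (\<integral>\<omega>. \<bar>y \<omega> * kern x h s \<omega> - truncate B (y \<omega>) * kern x h s \<omega>\<bar> \<partial>P)" by (rule integral_abs_bound)
  also have "\<dots> \<le> (\<integral>\<omega>. b * ((a * (y \<omega>)\<^sup>2 + 1 / a * indicator ?E \<omega>) / 2) \<partial>P)"
  proof (rule integral_mono)
    show "integrable P (\<lambda>\<omega>. \<bar>y \<omega> * kern x h s \<omega> - truncate B (y \<omega>) * kern x h s \<omega>\<bar>)"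
      using mult_kern_integrable[OF x h yi] mult_kern_integrable[OF x h ti] by simp
    show "integrable P (\<lambda>\<omega>. b * ((a * (y \<omega>)\<^sup>2 + 1 / a * indicator ?E \<omega>) / 2))"
      by (intro Bochner_Integration.integrable_mult_right integrable_divide
          Bochner_Integration.integrable_add y2(1) iE)
    fix \<omega> assume w: "\<omega> \<in> space P"
    have "\<bar>y \<omega> - truncate B (y \<omega>)\<bar> \<le> (a * (y \<omega>)\<^sup>2 + 1 / a * indicator ?E \<omega>) / 2"
    proof (cases "\<omega> \<in> ?E")
      case True
      have "\<bar>y \<omega> - truncate B (y \<omega>)\<bar> \<le> \<bar>y \<omega>\<bar>" using B by (auto simp: truncate_def)
      also have "\<dots> \<le> (a * (y \<omega>)\<^sup>2 + 1 / a) / 2" by (rule abs_le_weighted_square[OF a])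
      finally show ?thesis using True by simp
    next
      case False
      hence "\<bar>y \<omega>\<bar> < B" using coord_le_norm[OF Y_space[OF w], of s j] w by (auto simp: y_def)
      hence "truncate B (y \<omega>) = y \<omega>" by (auto simp: truncate_def)
      thus ?thesis using False a by simp
    qed
    hence "\<bar>y \<omega> - truncate B (y \<omega>)\<bar> * \<bar>kern x h s \<omega>\<bar> \<le> (a * (y \<omega>)\<^sup>2 + 1 / a * indicator ?E \<omega>) / 2 * b"
      using kern_bound[OF x h w] b_pos a by (intro mult_mono) auto
    thus "\<bar>y \<omega> * kern x h s \<omega> - truncate B (y \<omega>) * kern x h s \<omega>\<bar> \<le> b * ((a * (y \<omega>)\<^sup>2 + 1 / a * indicator ?E \<omega>) / 2)"
      by (simp add: left_diff_distrib[symmetric] abs_mult mult.commute)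
  qed
  also have "\<dots> = b * ((a * (\<integral>\<omega>. (y \<omega>)\<^sup>2 \<partial>P) + 1 / a * prob ?E) / 2)"
    using y2(1) iE E by simp
  also have "\<dots> \<le> b * ((a * d\<^sub>0 + 1 / a * (\<kappa>\<^sub>0 * exp (- \<kappa>\<^sub>1 * B))) / 2)"
    using b_pos a y2(2) norm_Y_tail[OF B, of s]
    by (intro mult_left_mono divide_right_mono add_mono) auto
  also have "1 / a * (\<kappa>\<^sub>0 * exp (- \<kappa>\<^sub>1 * B)) = a * \<kappa>\<^sub>0"
  proof -
    have "exp (- \<kappa>\<^sub>1 * B) = a * a" by (simp add: a_def exp_add[symmetric])
    thus ?thesis using a by simp
  qed
  also have "b * ((a * d\<^sub>0 + a * \<kappa>\<^sub>0) / 2) \<le> b * (d\<^sub>0 + \<kappa>\<^sub>0) * a"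
  proof -
    have "0 \<le> b * (d\<^sub>0 + \<kappa>\<^sub>0) * a" using b_pos a tail_const by simp
    moreover have "b * ((a * d\<^sub>0 + a * \<kappa>\<^sub>0) / 2) = b * (d\<^sub>0 + \<kappa>\<^sub>0) * a / 2" by (simp add: algebra_simps)
    ultimately show ?thesis by linarith
  qed
  finally show ?thesis unfolding y_def a_def .
qed

end

text \<open>Entropy of order m^(1/3) log m against a deviation exponent of order m^(1/2): the
  polynomial gap beats every power of m.\<close>

lemma summable_stretched_exp:
  fixes c C1 C2 :: real and N :: nat
  assumes "0 < c" "0 < C1" "0 < C2"
  shows "summable (\<lambda>m. (real m + 2) ^ N *
           exp (C1 * real m powr (1/3) * (C2 + ln (real m)) - c * real m powr (1/2)))"
proof (rule summable_comparison_test_bigo)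
  show "summable (\<lambda>m::nat. norm (1 / (real m)\<^sup>2))"
    using inverse_power_summable[of 2, where 'a = real] by (simp add: inverse_eq_divide)
  show "(\<lambda>m. (real m + 2) ^ N * exp (C1 * real m powr (1/3) * (C2 + ln (real m)) - c * real m powr (1/2)))
      \<in> O(\<lambda>m. 1 / (real m)\<^sup>2)"
    using assms by real_asymp
qed

context functional_regression
begin

subsection \<open>A uniform law for the kernel sums\<close>

text \<open>
  With \<open>m\<close> the largest side length of the box, the response is truncated at \<open>m powr \<alpha>\<close>, about
  \<open>m powr \<alpha>\<close> coordinates are kept, and the kernel sums are controlled up to \<open>m powr (- \<beta> - \<alpha>)\<close>
  on the ball of radius \<open>m powr \<beta>'\<close>; the condition on the rate forces \<open>R \<le> m powr \<beta>'\<close>. The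
  exponents are such that the metric entropy is at most of order \<open>m powr (1/3)\<close>, up to a logarithm,
  while the exponent of the deviation inequality is at least of order \<open>m powr (1/2)\<close>. This polynomial
  gap is why the powers of the logarithm in the rate are not needed.
\<close>

definition \<beta> :: real where "\<beta> = 1 / (4 * real CARD('d) + 1)"
definition \<alpha> :: real where "\<alpha> = \<beta> / 8"
definition \<beta>' :: real where "\<beta>' = \<beta> / (4 * real CARD('d))"

text \<open>The first sum is the exponent of B / t, the second that of R B / t, the base of the
  metric entropy; times d it is the exponent of the entropy, and 1 - 2 \<beta> - 4 \<alpha> is that
  of t^2 m / B^2. Since \<beta> <= 1 / 5, the last is at least 1 / 2, with equality for d =
  1.\<close>

lemma exponents:
  "0 < \<beta>" "0 < \<alpha>" "0 < \<beta>'" "\<beta> + 2 * \<alpha> \<le> 1" "\<beta>' + \<beta> + 2 * \<alpha> \<le> 1"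
  "(\<beta>' + \<beta> + 2 * \<alpha>) * real CARD('d) \<le> 1 / 3" "1 / 2 \<le> 1 - 2 * \<beta> - 4 * \<alpha>"
proof -
  define d where "d = real CARD('d)"
  have d: "1 \<le> d" by (simp add: d_def Suc_le_eq)
  show pos: "0 < \<beta>" "0 < \<alpha>" "0 < \<beta>'" by (simp_all add: \<beta>_def \<alpha>_def \<beta>'_def add_pos_pos)
  have b5: "\<beta> \<le> 1 / 5" unfolding \<beta>_def d_def[symmetric] using d by (simp add: field_simps)
  show "\<beta> + 2 * \<alpha> \<le> 1" "1 / 2 \<le> 1 - 2 * \<beta> - 4 * \<alpha>" using b5 by (auto simp: \<alpha>_def)
  have "\<beta>' \<le> \<beta>" unfolding \<beta>'_def d_def[symmetric] using d pos(1) by (simp add: field_simps)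
  thus "\<beta>' + \<beta> + 2 * \<alpha> \<le> 1" using b5 by (auto simp: \<alpha>_def)
  have "(\<beta>' + \<beta> + 2 * \<alpha>) * d = \<beta> * (1 + 5 * d) / 4"
    unfolding \<beta>'_def \<alpha>_def d_def[symmetric] using d by (simp add: field_simps)
  also have "\<dots> \<le> 1 / 3" unfolding \<beta>_def d_def[symmetric] using d by (simp add: field_simps)
  finally show "(\<beta>' + \<beta> + 2 * \<alpha>) * real CARD('d) \<le> 1 / 3" by (simp add: d_def)
qed

definition on_range :: "nat \<Rightarrow> (nat ^ 'n \<Rightarrow> 'd fld \<Rightarrow> real \<Rightarrow> bool) \<Rightarrow> bool" where
  "on_range m Q \<longleftrightarrow> (\<forall>n x h. (\<forall>i. n $ i \<le> m) \<longrightarrow> x \<in> lip_ball D (real m powr \<beta>') \<longrightarrow>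
     0 < h \<longrightarrow> h \<le> 1 \<longrightarrow> Q n x h)"

definition field_close :: "nat \<Rightarrow> (int ^ 'n \<Rightarrow> 'w \<Rightarrow> real) \<Rightarrow> 'w \<Rightarrow> bool" where
  "field_close m y \<omega> \<longleftrightarrow> on_range m (\<lambda>n x h.
     \<bar>\<Sum>s\<in>index_box n. y s \<omega> * kern x h s \<omega> - (\<integral>\<omega>. y s \<omega> * kern x h s \<omega> \<partial>P)\<bar>
       \<le> (1 + 4 * b) * real m powr (- \<beta> - \<alpha>) * real m ^ CARD('n) / h)"

text \<open>The bound q depends on \<Phi> but not on the field y, so it can be used for all retained
  coordinates at once; the weight m + 2 in the summability is reserved for their number.\<close>

lemma field_deviation:
  assumes \<Phi>: "0 \<le> \<Phi>"
  obtains q :: "nat \<Rightarrow> real" where "\<And>m. 0 \<le> q m" "summable (\<lambda>m. (real m + 2) * q m)"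
    "\<And>m y. 1 \<le> m \<Longrightarrow> kernel_field P \<nu> S X y (real m powr \<alpha>) \<Phi> \<rho> K b b \<Longrightarrow>
      \<exists>bad\<in>events. prob bad \<le> q m \<and>
        (\<forall>\<omega>\<in>space P - bad. field_close m y \<omega>)"
proof -
  define d where "d = real CARD('d)"
  have d: "1 \<le> d" by (simp add: d_def Suc_le_eq)
  obtain A where A: "\<And>u i. u \<in> D \<Longrightarrow> \<bar>u $ i\<bar> \<le> A" "0 \<le> A"
  proof -
    obtain a where "\<forall>u\<in>D. norm u \<le> a" using compact_imp_bounded[OF D] by (auto simp: bounded_iff)
    hence "\<bar>u $ i\<bar> \<le> max a 0" if "u \<in> D" for u i
      using component_le_norm_cart[of u i] that by force
    thus thesis by (rule that) auto
  qed
  define W where "W = sqrt (measure \<nu> D) + 1"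
  have W: "sqrt (measure \<nu> D) \<le> W" "0 < W" by (auto simp: W_def add_nonneg_pos)
  \<comment> \<open>Dominates the coefficients of R B / t in both the number of cells and the number
    of rounded values.\<close>
  define a where "a = 6 * A * d * W + 6 * W"
  have a: "0 < a" using A(2) W d by (auto simp: a_def intro: add_nonneg_pos)
  define c where "c = 1 / (8 * (real CARD('n))\<^sup>2 * (b + b * \<Phi>)\<^sup>2)"
  have "0 < b + b * \<Phi>" using b_pos \<Phi> by (simp add: add_pos_nonneg)
  hence c: "0 < c" by (simp add: c_def)
  define C1 where "C1 = (a + 3) ^ CARD('d)"
  define C2 where "C2 = ln (a + 3)"
  have C1: "0 < C1" "0 < C2" using a by (auto simp: C1_def C2_def)
  \<comment> \<open>The power collects at most (m + 2)^N boxes and m + 2 bandwidths.\<close>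
  define q where "q m = 2 * (real m + 2) ^ (CARD('n) + 1) *
      exp (C1 * real m powr (1/3) * (C2 + ln (real m)) - c * real m powr (1/2))" for m :: nat
  have sq: "summable (\<lambda>m. (real m + 2) * q m)"
    using summable_mult[OF summable_stretched_exp[OF c C1, of "CARD('n) + 2"], of 2]
    by (simp add: q_def mult_ac)
  have q0: "0 \<le> q m" for m by (simp add: q_def)
  have main: "\<exists>bad\<in>events. prob bad \<le> q m \<and>
        (\<forall>\<omega>\<in>space P - bad. field_close m y \<omega>)"
    if m: "1 \<le> m" and kf: "kernel_field P \<nu> S X y (real m powr \<alpha>) \<Phi> \<rho> K b b" for m y
  proof -
    interpret kf: kernel_field P \<nu> S X y "real m powr \<alpha>" \<Phi> \<rho> K b b by (rule kf)
    define B where "B = real m powr \<alpha>"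
    define t where "t = real m powr (- \<beta> - \<alpha>)"
    define R where "R = real m powr \<beta>'"
    have m0: "0 < real m" and m1: "1 \<le> real m" using m by auto
    have t: "0 < t" and R: "0 < R" and B: "0 < B" using m0 by (auto simp: t_def R_def B_def)
    have Bt: "B / t = real m powr (\<beta> + 2 * \<alpha>)"
      unfolding B_def t_def by (simp add: powr_diff[symmetric] add.commute)
    have RBt: "R * B / t = real m powr (\<beta>' + \<beta> + 2 * \<alpha>)"
      unfolding times_divide_eq_right[symmetric] Bt unfolding R_def by (simp add: powr_add[symmetric] add.assoc)
    obtain bad where bad: "bad \<in> events"
      "prob bad \<le> 2 * real ((m + 1) ^ CARD('n)) * (B / t + 1) *
        exp ((6 * A * d * R * W * B / t + 3) ^ CARD('d) * ln (6 * R * W * B / t + 3)) *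
        exp (- (t\<^sup>2 * real m / (8 * (real CARD('n))\<^sup>2 * B\<^sup>2 * (b + b * \<Phi>)\<^sup>2)))"
      "\<And>\<omega> n x h. \<omega> \<in> space P - bad \<Longrightarrow> (\<And>i. n $ i \<le> m) \<Longrightarrow> x \<in> lip_ball D R \<Longrightarrow> 0 < h \<Longrightarrow> h \<le> 1 \<Longrightarrow>
       \<bar>kf.dev n x h \<omega>\<bar> \<le> (1 + 4 * b) * t * real m ^ CARD('n) / h"
      using kf.uniform_deviation[OF \<nu>(1) space_\<nu> A R lip_ball_S W m t] unfolding B_def[symmetric] d_def[symmetric]
      by blast
    \<comment> \<open>Allows the additive constants 3 in the entropy to be absorbed into multiples
      of R B / t.\<close>
    have p1: "1 \<le> R * B / t" unfolding RBt using m1 exponents by (intro ge_one_powr_ge_zero) auto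
    have e1: "6 * A * d * R * W * B / t + 3 \<le> (a + 3) * (R * B / t)"
    proof -
      have "6 * A * d * R * W * B / t = 6 * A * d * W * (R * B / t)" by simp
      hence "6 * A * d * R * W * B / t + 3 \<le> 6 * A * d * W * (R * B / t) + 3 * (R * B / t)"
        using p1 by linarith
      also have "\<dots> \<le> a * (R * B / t) + 3 * (R * B / t)"
        unfolding a_def using p1 W by (intro add_right_mono mult_right_mono) auto
      finally show ?thesis by (simp only: distrib_right)
    qed
    have e2: "6 * R * W * B / t + 3 \<le> (a + 3) * (R * B / t)"
    proof -
      have "6 * R * W * B / t = 6 * W * (R * B / t)" by simp
      hence "6 * R * W * B / t + 3 \<le> 6 * W * (R * B / t) + 3 * (R * B / t)"
        using p1 by linarith
      also have "\<dots> \<le> a * (R * B / t) + 3 * (R * B / t)"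
        unfolding a_def using p1 W A(2) d by (intro add_right_mono mult_right_mono) auto
      finally show ?thesis by (simp only: distrib_right)
    qed
    have e0: "0 \<le> 6 * A * d * R * W * B / t" "0 \<le> 6 * R * W * B / t" using A(2) d R W B t by auto
    have "(6 * A * d * R * W * B / t + 3) ^ CARD('d) \<le> ((a + 3) * (R * B / t)) ^ CARD('d)"
      using e0 by (intro power_mono e1) auto
    also have "\<dots> = C1 * real m powr ((\<beta>' + \<beta> + 2 * \<alpha>) * d)"
      unfolding power_mult_distrib C1_def RBt using m0 by (simp add: d_def powr_powr[symmetric] powr_realpow)
    also have "\<dots> \<le> C1 * real m powr (1/3)"
      using C1 exponents m1 by (intro mult_left_mono powr_mono) (auto simp: d_def)
    finally have f1: "(6 * A * d * R * W * B / t + 3) ^ CARD('d) \<le> C1 * real m powr (1/3)" .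
    have "ln (6 * R * W * B / t + 3) \<le> ln ((a + 3) * (R * B / t))"
      using e0 e2 by (intro ln_mono) auto
    also have "\<dots> = C2 + (\<beta>' + \<beta> + 2 * \<alpha>) * ln (real m)"
      unfolding C2_def RBt using a m0 by (subst ln_mult) (auto simp: ln_powr)
    also have "\<dots> \<le> C2 + 1 * ln (real m)"
      using exponents m1 by (intro add_left_mono mult_right_mono) auto
    finally have f2: "ln (6 * R * W * B / t + 3) \<le> C2 + ln (real m)" by simp
    have f3: "B / t + 1 \<le> real m + 2"
    proof -
      have "B / t \<le> real m powr 1" unfolding Bt using exponents m1 by (intro powr_mono) auto
      thus ?thesis using m0 by simp
    qed
    have f4: "c * real m powr (1/2) \<le> t\<^sup>2 * real m / (8 * (real CARD('n))\<^sup>2 * B\<^sup>2 * (b + b * \<Phi>)\<^sup>2)"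
    proof -
      have "real m powr (1/2) \<le> real m powr (1 - 2 * \<beta> - 4 * \<alpha>)"
        using exponents m1 by (intro powr_mono) auto
      also have "\<dots> = real m powr (2 * (- \<beta> - \<alpha>) + 1 - 2 * \<alpha>)" by (simp add: algebra_simps)
      also have "\<dots> = t\<^sup>2 * real m / B\<^sup>2"
      proof -
        have "t\<^sup>2 = real m powr (2 * (- \<beta> - \<alpha>))" "B\<^sup>2 = real m powr (2 * \<alpha>)" "real m = real m powr 1"
          unfolding t_def B_def using m0 by (simp_all add: powr_power mult.commute)
        thus ?thesis by (simp only: powr_add powr_diff)
      qed
      finally have "c * real m powr (1/2) \<le> c * (t\<^sup>2 * real m / B\<^sup>2)" using c by (intro mult_left_mono) auto
      also have "\<dots> = t\<^sup>2 * real m / (8 * (real CARD('n))\<^sup>2 * B\<^sup>2 * (b + b * \<Phi>)\<^sup>2)"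
        by (simp add: c_def)
      finally show ?thesis .
    qed
    have g0: "0 \<le> ln (6 * R * W * B / t + 3)" using e0 by (intro ln_ge_zero) auto
    note bad(2)
    also have "2 * real ((m + 1) ^ CARD('n)) * (B / t + 1) *
        exp ((6 * A * d * R * W * B / t + 3) ^ CARD('d) * ln (6 * R * W * B / t + 3)) *
        exp (- (t\<^sup>2 * real m / (8 * (real CARD('n))\<^sup>2 * B\<^sup>2 * (b + b * \<Phi>)\<^sup>2)))
      \<le> 2 * (real m + 2) ^ CARD('n) * (real m + 2) *
        exp (C1 * real m powr (1/3) * (C2 + ln (real m))) * exp (- (c * real m powr (1/2)))"
    proof (intro mult_mono)
      show "real ((m + 1) ^ CARD('n)) \<le> (real m + 2) ^ CARD('n)"
        unfolding of_nat_power by (intro power_mono) auto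
      show "exp ((6 * A * d * R * W * B / t + 3) ^ CARD('d) * ln (6 * R * W * B / t + 3))
        \<le> exp (C1 * real m powr (1/3) * (C2 + ln (real m)))"
        using f1 f2 g0 C1 by (auto intro!: mult_mono)
    qed (use f3 f4 B t in auto)
    also have "\<dots> = q m"
    proof -
      have "2 * u ^ k * u * exp v * exp (- w) = 2 * u ^ (k + 1) * exp (v - w)" for u v w :: real and k :: nat
        by (simp add: exp_diff exp_minus divide_inverse mult_ac)
      thus ?thesis unfolding q_def by blast
    qed
    finally have "prob bad \<le> q m" .
    moreover have "field_close m y \<omega>" if "\<omega> \<in> space P - bad" for \<omega>
      unfolding field_close_def on_range_def using bad(3)[OF that] by (simp add: R_def t_def kf.dev_def)
    ultimately show ?thesis using bad(1) by blast
  qed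
  show thesis by (rule that[OF q0 sq main])
qed

definition devK :: "nat ^ 'n \<Rightarrow> 'd fld \<Rightarrow> real \<Rightarrow> 'w \<Rightarrow> real" where
  "devK n x h \<omega> = (\<Sum>s\<in>index_box n. kern x h s \<omega> - expectation (kern x h s))"

definition devY :: "nat \<Rightarrow> nat ^ 'n \<Rightarrow> 'd fld \<Rightarrow> real \<Rightarrow> 'w \<Rightarrow> real" where
  "devY j n x h \<omega> = (\<Sum>s\<in>index_box n. Yc j s \<omega> * kern x h s \<omega>
      - (\<integral>\<omega>. Yc j s \<omega> * kern x h s \<omega> \<partial>P))"

lemma index_box_subset: "(\<And>i. n $ i \<le> m) \<Longrightarrow> index_box n \<subseteq> index_box (\<chi> i. m)"
  unfolding index_box_def by (auto intro: order_trans)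

lemma card_index_box_real_le: "(\<And>i. (n :: nat ^ 'n) $ i \<le> m) \<Longrightarrow> real (card (index_box n)) \<le> real m ^ CARD('n)"
  using card_index_box_le[of n m] by (simp add: of_nat_power[symmetric] del: of_nat_power)

text \<open>No cancellation is used: for high coordinates the sample values are tiny on the good
  event and the means are tiny by the decay of second moments, at the same rate exp (- d1 j /
  4).\<close>

lemma devY_large_coord:
  assumes x: "x \<in> S" and h: "0 < h" and n: "\<And>i. n $ i \<le> m" and w: "\<omega> \<in> space P"
    and y: "\<And>s. s \<in> index_box n \<Longrightarrow> \<bar>Yc j s \<omega>\<bar> \<le> exp (- d\<^sub>1 * real j / 4)"
  shows "\<bar>devY j n x h \<omega>\<bar> \<le> b * (d\<^sub>0 + 2) * exp (- d\<^sub>1 * real j / 4) * real m ^ CARD('n)"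
proof -
  have "\<bar>devY j n x h \<omega>\<bar> \<le> (\<Sum>s\<in>index_box n. b * (d\<^sub>0 + 2) * exp (- d\<^sub>1 * real j / 4))"
    unfolding devY_def
  proof (rule order_trans[OF sum_abs], rule sum_mono)
    fix s assume s: "s \<in> index_box n"
    have "\<bar>Yc j s \<omega> * kern x h s \<omega>\<bar> \<le> exp (- d\<^sub>1 * real j / 4) * b"
      unfolding abs_mult by (intro mult_mono y s kern_bound x h w) auto
    moreover note coord_Y_kern_mean[OF x h, of s j]
    moreover have "exp (- d\<^sub>1 * real j / 4) * b + b * (d\<^sub>0 + 1) * exp (- d\<^sub>1 * real j / 4)
        = b * (d\<^sub>0 + 2) * exp (- d\<^sub>1 * real j / 4)" by (simp add: algebra_simps)
    ultimately show "\<bar>Yc j s \<omega> * kern x h s \<omega>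
        - (\<integral>\<omega>. Yc j s \<omega> * kern x h s \<omega> \<partial>P)\<bar> \<le> b * (d\<^sub>0 + 2) * exp (- d\<^sub>1 * real j / 4)"
      by linarith
  qed
  also have "\<dots> = real (card (index_box n)) * (b * (d\<^sub>0 + 2) * exp (- d\<^sub>1 * real j / 4))" by simp
  also have "\<dots> \<le> real m ^ CARD('n) * (b * (d\<^sub>0 + 2) * exp (- d\<^sub>1 * real j / 4))"
    using b_pos tail_const by (intro mult_right_mono card_index_box_real_le n) auto
  finally show ?thesis by (simp add: mult_ac)
qed

text \<open>On the event that all norms are at most B the sample sum is not affected by truncation;
  only the mean changes, by an exponentially small amount.\<close>

lemma devY_small_coord:
  assumes x: "x \<in> S" and h: "0 < h" and n: "\<And>i. n $ i \<le> m" and w: "\<omega> \<in> space P" and B: "1 \<le> B"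
    and Y: "\<And>s. s \<in> index_box n \<Longrightarrow> l2_norm \<nu> (Y s \<omega>) \<le> B"
    and dev: "\<bar>\<Sum>s\<in>index_box n. truncate B (Yc j s \<omega>) * kern x h s \<omega>
      - (\<integral>\<omega>. truncate B (Yc j s \<omega>) * kern x h s \<omega> \<partial>P)\<bar> \<le> c"
  shows "\<bar>devY j n x h \<omega>\<bar> \<le> c + b * (d\<^sub>0 + \<kappa>\<^sub>0) * exp (- \<kappa>\<^sub>1 * B / 2) * real m ^ CARD('n)"
proof -
  define E where "E s = (\<integral>\<omega>. Yc j s \<omega> * kern x h s \<omega> \<partial>P)
      - (\<integral>\<omega>. truncate B (Yc j s \<omega>) * kern x h s \<omega> \<partial>P)" for s
  have "devY j n x h \<omega> = (\<Sum>s\<in>index_box n. (truncate B (Yc j s \<omega>) * kern x h s \<omega>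
      - (\<integral>\<omega>. truncate B (Yc j s \<omega>) * kern x h s \<omega> \<partial>P)) - E s)"
    unfolding devY_def
  proof (rule sum.cong)
    fix s assume s: "s \<in> index_box n"
    have "\<bar>Yc j s \<omega>\<bar> \<le> B" using coord_le_norm[OF Y_space[OF w], of s j] Y[OF s] by simp
    hence "truncate B (Yc j s \<omega>) = Yc j s \<omega>" by (auto simp: truncate_def)
    thus "Yc j s \<omega> * kern x h s \<omega> - (\<integral>\<omega>. Yc j s \<omega> * kern x h s \<omega> \<partial>P)
       = (truncate B (Yc j s \<omega>) * kern x h s \<omega>
      - (\<integral>\<omega>. truncate B (Yc j s \<omega>) * kern x h s \<omega> \<partial>P)) - E s" by (simp add: E_def)
  qed simp
  also have "\<dots> = (\<Sum>s\<in>index_box n. truncate B (Yc j s \<omega>) * kern x h s \<omega>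
      - (\<integral>\<omega>. truncate B (Yc j s \<omega>) * kern x h s \<omega> \<partial>P)) - (\<Sum>s\<in>index_box n. E s)"
    by (rule sum_subtractf)
  finally have "\<bar>devY j n x h \<omega>\<bar> \<le> c + \<bar>\<Sum>s\<in>index_box n. E s\<bar>" using dev by linarith
  also have "\<bar>\<Sum>s\<in>index_box n. E s\<bar> \<le> (\<Sum>s\<in>index_box n. b * (d\<^sub>0 + \<kappa>\<^sub>0) * exp (- \<kappa>\<^sub>1 * B / 2))"
    unfolding E_def by (rule order_trans[OF sum_abs], rule sum_mono) (rule truncation_kern_mean[OF x h B])
  also have "\<dots> = real (card (index_box n)) * (b * (d\<^sub>0 + \<kappa>\<^sub>0) * exp (- \<kappa>\<^sub>1 * B / 2))" by simp
  also have "\<dots> \<le> real m ^ CARD('n) * (b * (d\<^sub>0 + \<kappa>\<^sub>0) * exp (- \<kappa>\<^sub>1 * B / 2))"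
    using b_pos tail_const by (intro mult_right_mono card_index_box_real_le n) auto
  finally show ?thesis by (simp add: mult_ac)
qed

lemma norm_Y_event:
  assumes B: "1 \<le> B" and I: "finite I"
  obtains bad where "bad \<in> events" "prob bad \<le> real (card I) * (\<kappa>\<^sub>0 * exp (- \<kappa>\<^sub>1 * B))"
    "\<And>\<omega> s. \<omega> \<in> space P - bad \<Longrightarrow> s \<in> I \<Longrightarrow> l2_norm \<nu> (Y s \<omega>) \<le> B"
proof
  define bad where "bad = (\<Union>s\<in>I. {\<omega>\<in>space P. B \<le> l2_norm \<nu> (Y s \<omega>)})"
  show "bad \<in> events" unfolding bad_def using I by (intro sets.finite_UN) auto
  have "prob bad \<le> (\<Sum>s\<in>I. prob {\<omega>\<in>space P. B \<le> l2_norm \<nu> (Y s \<omega>)})"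
    unfolding bad_def using I by (intro finite_measure_subadditive_finite) auto
  also have "\<dots> \<le> (\<Sum>s\<in>I. \<kappa>\<^sub>0 * exp (- \<kappa>\<^sub>1 * B))" by (intro sum_mono norm_Y_tail B)
  finally show "prob bad \<le> real (card I) * (\<kappa>\<^sub>0 * exp (- \<kappa>\<^sub>1 * B))" by simp
  show "l2_norm \<nu> (Y s \<omega>) \<le> B" if "\<omega> \<in> space P - bad" "s \<in> I" for \<omega> s
    using that by (auto simp: bad_def)
qed

text \<open>Infinitely many coordinates are handled in one event, which costs a geometric series
  starting at J.\<close>

lemma coord_Y_event:
  assumes I: "finite I"
  obtains bad where "bad \<in> events"
    "prob bad \<le> real (card I) * (d\<^sub>0 / (1 - exp (- d\<^sub>1 / 2)) * exp (- d\<^sub>1 / 2) ^ J)"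
    "\<And>\<omega> s j. \<omega> \<in> space P - bad \<Longrightarrow> s \<in> I \<Longrightarrow> J \<le> j \<Longrightarrow> \<bar>Yc j s \<omega>\<bar> \<le> exp (- d\<^sub>1 * real j / 4)"
proof
  define x where "x = exp (- d\<^sub>1 / 2)"
  have x: "0 < x" "x < 1" using tail_const by (auto simp: x_def)
  define E where "E s j = {\<omega>\<in>space P. exp (- d\<^sub>1 * real j / 4) \<le> \<bar>Yc j s \<omega>\<bar>}" for s j
  have Em: "E s j \<in> events" for s j unfolding E_def by measurable
  define bad where "bad = (\<Union>s\<in>I. \<Union>i. E s (i + J))"
  show "bad \<in> events" unfolding bad_def using I Em by (intro sets.finite_UN sets.countable_UN) auto
  have le: "prob (E s (i + J)) \<le> d\<^sub>0 * x ^ J * x ^ i" for s i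
    using coord_Y_tail[of "i + J" s] unfolding E_def x_def by (simp add: power_add mult_ac)
  have geo: "summable (\<lambda>i. d\<^sub>0 * x ^ J * x ^ i)" using x by (intro summable_mult summable_geometric) auto
  have sm: "summable (\<lambda>i. prob (E s (i + J)))" for s
    by (rule summable_comparison_test'[OF geo]) (use le in auto)
  have one: "prob (\<Union>i. E s (i + J)) \<le> d\<^sub>0 / (1 - x) * x ^ J" for s
  proof -
    have "prob (\<Union>i. E s (i + J)) \<le> (\<Sum>i. prob (E s (i + J)))"
      using Em sm by (intro finite_measure_subadditive_countably) auto
    also have "\<dots> \<le> (\<Sum>i. d\<^sub>0 * x ^ J * x ^ i)" by (rule suminf_le[OF le sm geo])
    also have "\<dots> = d\<^sub>0 * x ^ J * (1 / (1 - x))"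
      using x by (subst suminf_mult) (auto simp: suminf_geometric)
    finally show ?thesis by (simp add: mult_ac)
  qed
  have "prob bad \<le> (\<Sum>s\<in>I. prob (\<Union>i. E s (i + J)))"
    unfolding bad_def using I Em by (intro finite_measure_subadditive_finite) auto
  also have "\<dots> \<le> (\<Sum>s\<in>I. d\<^sub>0 / (1 - x) * x ^ J)" by (intro sum_mono one)
  finally show "prob bad \<le> real (card I) * (d\<^sub>0 / (1 - exp (- d\<^sub>1 / 2)) * exp (- d\<^sub>1 / 2) ^ J)" by (simp add: x_def)
  show "\<bar>Yc j s \<omega>\<bar> \<le> exp (- d\<^sub>1 * real j / 4)"
    if w: "\<omega> \<in> space P - bad" and s: "s \<in> I" and j: "J \<le> j" for \<omega> s j
  proof -
    have "\<omega> \<notin> E s (j - J + J)" using w s unfolding bad_def by blast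
    thus ?thesis using w j by (auto simp: E_def)
  qed
qed

end

lemma summable_power_stretched_exp:
  fixes c a :: real and N :: nat
  assumes "0 < c" "0 < a"
  shows "summable (\<lambda>m. real m ^ N * exp (- c * real m powr a))"
proof (rule summable_comparison_test_bigo)
  show "summable (\<lambda>m::nat. norm (1 / (real m)\<^sup>2))"
    using inverse_power_summable[of 2, where 'a = real] by (simp add: inverse_eq_divide)
  show "(\<lambda>m. real m ^ N * exp (- c * real m powr a)) \<in> O(\<lambda>m. 1 / (real m)\<^sup>2)"
    using assms by real_asymp
qed

lemma eventually_stretched_exp_le:
  fixes c a p :: real
  assumes "0 < c" "0 < a" "0 < p"
  shows "\<forall>\<^sub>F m in sequentially. exp (- c * real m powr a) \<le> real m powr (- p)"
  using assms by real_asymp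

context functional_regression
begin

definition coords_close :: "nat \<Rightarrow> 'w \<Rightarrow> bool" where
  "coords_close m \<omega> \<longleftrightarrow> on_range m (\<lambda>n x h.
     \<bar>devK n x h \<omega>\<bar> \<le> (1 + 4 * b) * real m powr (- \<beta> - \<alpha>) * real m ^ CARD('n) / h \<and>
     (\<forall>j. real j < real m powr \<alpha> \<longrightarrow> \<bar>devY j n x h \<omega>\<bar> \<le>
        (1 + 4 * b) * real m powr (- \<beta> - \<alpha>) * real m ^ CARD('n) / h
          + b * (d\<^sub>0 + \<kappa>\<^sub>0) * exp (- \<kappa>\<^sub>1 * real m powr \<alpha> / 2) * real m ^ CARD('n)) \<and>
     (\<forall>j. real m powr \<alpha> \<le> real j \<longrightarrow> \<bar>devY j n x h \<omega>\<bar> \<le>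
        b * (d\<^sub>0 + 2) * exp (- d\<^sub>1 * real j / 4) * real m ^ CARD('n)))"

text \<open>The square sum over coordinates is the form in which Parseval's identity consumes the
  deviations.\<close>

definition uniformly_close :: "real \<Rightarrow> nat \<Rightarrow> 'w \<Rightarrow> bool" where
  "uniformly_close C m \<omega> \<longleftrightarrow> on_range m (\<lambda>n x h.
     \<bar>devK n x h \<omega>\<bar> \<le> C * real m powr (- \<beta>) * real m ^ CARD('n) / h \<and>
     summable (\<lambda>j. (devY j n x h \<omega>)\<^sup>2) \<and>
     (\<Sum>j. (devY j n x h \<omega>)\<^sup>2) \<le> (C * real m powr (- \<beta>) * real m ^ CARD('n) / h)\<^sup>2)"

text \<open>Four sources of failure are united: the denominator, the retained truncated coordinates,
  an untypically large response, and the remaining coordinates. All are indexed by m alone and have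
  summable probabilities.\<close>

lemma uniform_event:
  obtains Q :: "nat \<Rightarrow> real" where "summable Q"
    "\<And>m. 1 \<le> m \<Longrightarrow> \<exists>bad\<in>events. prob bad \<le> Q m \<and>
       (\<forall>\<omega>\<in>space P - bad. coords_close m \<omega>)"
proof -
  obtain \<Phi>1 where \<Phi>1: "0 \<le> \<Phi>1" "\<And>B. 1 \<le> B \<Longrightarrow> kernel_field P \<nu> S X (\<lambda>s \<omega>. 1) B \<Phi>1 \<rho> K b b"
    by (rule kernel_field_one) blast
  obtain \<Phi>2 where \<Phi>2: "0 \<le> \<Phi>2" "\<And>j B. 0 < B \<Longrightarrow>
    kernel_field P \<nu> S X (\<lambda>s \<omega>. truncate B (Yc j s \<omega>)) B \<Phi>2 \<rho> K b b"
    by (rule kernel_field_Y) blast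
  obtain q1 where q1: "\<And>m. 0 \<le> q1 m" "summable (\<lambda>m. (real m + 2) * q1 m)"
    "\<And>m y. 1 \<le> m \<Longrightarrow> kernel_field P \<nu> S X y (real m powr \<alpha>) \<Phi>1 \<rho> K b b \<Longrightarrow>
      \<exists>bad\<in>events. prob bad \<le> q1 m \<and>
        (\<forall>\<omega>\<in>space P - bad. field_close m y \<omega>)"
    by (rule field_deviation[OF \<Phi>1(1)]) blast
  obtain q2 where q2: "\<And>m. 0 \<le> q2 m" "summable (\<lambda>m. (real m + 2) * q2 m)"
    "\<And>m y. 1 \<le> m \<Longrightarrow> kernel_field P \<nu> S X y (real m powr \<alpha>) \<Phi>2 \<rho> K b b \<Longrightarrow>
      \<exists>bad\<in>events. prob bad \<le> q2 m \<and>
        (\<forall>\<omega>\<in>space P - bad. field_close m y \<omega>)"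
    by (rule field_deviation[OF \<Phi>2(1)]) blast
  define x0 where "x0 = exp (- d\<^sub>1 / 2)"
  have x0: "0 < x0" "x0 < 1" using tail_const by (auto simp: x0_def)
  define Q where "Q m = (real m + 2) * q1 m + (real m + 2) * q2 m
      + \<kappa>\<^sub>0 * (real m ^ CARD('n) * exp (- \<kappa>\<^sub>1 * real m powr \<alpha>))
      + d\<^sub>0 / (1 - x0) * (real m ^ CARD('n) * exp (- (d\<^sub>1 / 2) * real m powr \<alpha>))" for m
  have sQ: "summable Q" unfolding Q_def
    using q1(2) q2(2) tail_const exponents
    by (intro summable_add summable_mult summable_power_stretched_exp) auto
  have main: "\<exists>bad\<in>events. prob bad \<le> Q m \<and>
       (\<forall>\<omega>\<in>space P - bad. coords_close m \<omega>)"
    if m: "1 \<le> m" for m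
  proof -
    define B where "B = real m powr \<alpha>"
    define cc where "cc = (1 + 4 * b) * real m powr (- \<beta> - \<alpha>) * real m ^ CARD('n)"
    have B: "1 \<le> B" unfolding B_def using m exponents by (intro ge_one_powr_ge_zero) auto
    \<comment> \<open>Thus j < J is equivalent to j < B, and J <= m + 2 turns the bound for one
      coordinate into the weighted bound that is summable.\<close>
    define J where "J = nat \<lceil>B\<rceil>"
    have J: "B \<le> real J" unfolding J_def by linarith
    have Jm: "real J \<le> real m + 2"
    proof -
      have "B \<le> real m powr 1" unfolding B_def using m exponents by (intro powr_mono) auto
      hence "B \<le> real m" using m by simp
      thus ?thesis unfolding J_def using B by linarith
    qed
    obtain badK where badK: "badK \<in> events" "prob badK \<le> q1 m"
      "\<And>\<omega>. \<omega> \<in> space P - badK \<Longrightarrow> field_close m (\<lambda>s \<omega>. 1) \<omega>"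
      using q1(3)[OF m \<Phi>1(2)[OF B[unfolded B_def]]] by blast
    have "\<exists>bad. bad \<in> events \<and> prob bad \<le> q2 m \<and>
        (\<forall>\<omega>\<in>space P - bad. field_close m (\<lambda>s \<omega>. truncate B (Yc j s \<omega>)) \<omega>)" for j
      using q2(3)[OF m \<Phi>2(2)[of "real m powr \<alpha>" j]] m unfolding B_def Bex_def by simp
    then obtain badY where badY: "\<And>j. badY j \<in> events" "\<And>j. prob (badY j) \<le> q2 m"
       "\<And>j \<omega>. \<omega> \<in> space P - badY j \<Longrightarrow> field_close m (\<lambda>s \<omega>. truncate B (Yc j s \<omega>)) \<omega>"
      by metis
    define I where "I = index_box (\<chi> i. m :: nat ^ 'n)"
    have I: "finite I" "real (card I) \<le> real m ^ CARD('n)"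
      unfolding I_def by (simp, rule card_index_box_real_le) simp
    obtain badN where badN: "badN \<in> events" "prob badN \<le> real (card I) * (\<kappa>\<^sub>0 * exp (- \<kappa>\<^sub>1 * B))"
      "\<And>\<omega> s. \<omega> \<in> space P - badN \<Longrightarrow> s \<in> I \<Longrightarrow> l2_norm \<nu> (Y s \<omega>) \<le> B"
      by (rule norm_Y_event[OF B I(1)]) blast
    obtain badC where badC: "badC \<in> events" "prob badC \<le> real (card I) * (d\<^sub>0 / (1 - x0) * x0 ^ J)"
      "\<And>\<omega> s j. \<omega> \<in> space P - badC \<Longrightarrow> s \<in> I \<Longrightarrow> J \<le> j \<Longrightarrow> \<bar>Yc j s \<omega>\<bar> \<le> exp (- d\<^sub>1 * real j / 4)"
      unfolding x0_def by (rule coord_Y_event[OF I(1)]) blast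
    define bad where "bad = badK \<union> (\<Union>j\<in>{..<J}. badY j) \<union> badN \<union> badC"
    have bad: "bad \<in> events" unfolding bad_def using badK badY badN badC by auto
    have "prob (\<Union>j\<in>{..<J}. badY j) \<le> (\<Sum>j<J. prob (badY j))"
      using badY(1) by (intro finite_measure_subadditive_finite) auto
    also have "\<dots> \<le> (\<Sum>j<J. q2 m)" by (intro sum_mono badY)
    also have "\<dots> = real J * q2 m" by simp
    also have "\<dots> \<le> (real m + 2) * q2 m" using Jm q2(1) by (intro mult_right_mono) auto
    finally have pY: "prob (\<Union>j\<in>{..<J}. badY j) \<le> (real m + 2) * q2 m" .
    have "1 * q1 m \<le> (real m + 2) * q1 m" using q1(1) by (intro mult_right_mono) auto
    hence pK: "prob badK \<le> (real m + 2) * q1 m" using badK(2) by simp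
    have "real (card I) * (\<kappa>\<^sub>0 * exp (- \<kappa>\<^sub>1 * B)) \<le> real m ^ CARD('n) * (\<kappa>\<^sub>0 * exp (- \<kappa>\<^sub>1 * B))"
      using I tail_const by (intro mult_right_mono) auto
    hence pN: "prob badN \<le> \<kappa>\<^sub>0 * (real m ^ CARD('n) * exp (- \<kappa>\<^sub>1 * real m powr \<alpha>))"
      using badN(2) unfolding B_def by (simp add: mult_ac)
    have "x0 ^ J = exp (- (d\<^sub>1 / 2) * real J)" unfolding x0_def by (simp add: exp_of_nat_mult[symmetric] mult.commute)
    also have "\<dots> \<le> exp (- (d\<^sub>1 / 2) * B)" using J tail_const by simp
    finally have "real (card I) * (d\<^sub>0 / (1 - x0) * x0 ^ J) \<le> real m ^ CARD('n) * (d\<^sub>0 / (1 - x0) * exp (- (d\<^sub>1 / 2) * B))"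
      using I tail_const x0 by (intro mult_mono mult_left_mono) auto
    hence pC: "prob badC \<le> d\<^sub>0 / (1 - x0) * (real m ^ CARD('n) * exp (- (d\<^sub>1 / 2) * real m powr \<alpha>))"
      using badC(2) unfolding B_def by (simp add: mult_ac)
    have "prob bad \<le> prob badK + prob (\<Union>j\<in>{..<J}. badY j) + prob badN + prob badC"
    proof -
      have "(\<Union>j\<in>{..<J}. badY j) \<in> events" using badY(1) by auto
      thus ?thesis unfolding bad_def using badK badN badC
        by (intro order_trans[OF measure_Un_le] add_mono order_refl) auto
    qed
    hence "prob bad \<le> Q m" using pK pY pN pC unfolding Q_def by linarith
    moreover have "\<bar>devK n x h \<omega>\<bar> \<le> cc / h \<and>
         (\<forall>j. real j < B \<longrightarrow> \<bar>devY j n x h \<omega>\<bar> \<le> cc / h + b * (d\<^sub>0 + \<kappa>\<^sub>0) * exp (- \<kappa>\<^sub>1 * B / 2) * real m ^ CARD('n)) \<and>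
         (\<forall>j. B \<le> real j \<longrightarrow> \<bar>devY j n x h \<omega>\<bar> \<le> b * (d\<^sub>0 + 2) * exp (- d\<^sub>1 * real j / 4) * real m ^ CARD('n))"
      if w: "\<omega> \<in> space P - bad" and n: "\<forall>i. n $ i \<le> m" and x: "x \<in> lip_ball D (real m powr \<beta>')"
        and h: "0 < h" "h \<le> 1" for \<omega> n x h
    proof (intro conjI allI impI)
      have xS: "x \<in> S" using x lip_ball_S by blast
      have sub: "index_box n \<subseteq> I" unfolding I_def using n by (intro index_box_subset) simp
      show "\<bar>devK n x h \<omega>\<bar> \<le> cc / h"
        using badK(3)[of \<omega>] w n x h
        by (auto simp: devK_def bad_def field_close_def on_range_def cc_def)
      fix j :: nat
      show "\<bar>devY j n x h \<omega>\<bar> \<le> cc / h + b * (d\<^sub>0 + \<kappa>\<^sub>0) * exp (- \<kappa>\<^sub>1 * B / 2) * real m ^ CARD('n)"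
        if j: "real j < B"
      proof (rule devY_small_coord[OF xS h(1) _ _ B])
        have "j < J" using j J by linarith
        hence "\<omega> \<in> space P - badY j" using w by (auto simp: bad_def)
        thus "\<bar>\<Sum>s\<in>index_box n. truncate B (Yc j s \<omega>) * kern x h s \<omega>
             - (\<integral>\<omega>. truncate B (Yc j s \<omega>) * kern x h s \<omega> \<partial>P)\<bar> \<le> cc / h"
          using badY(3)[of \<omega> j] n x h unfolding field_close_def on_range_def cc_def by simp
      qed (use w n sub badN(3)[of \<omega>] in \<open>auto simp: bad_def\<close>)
      show "\<bar>devY j n x h \<omega>\<bar> \<le> b * (d\<^sub>0 + 2) * exp (- d\<^sub>1 * real j / 4) * real m ^ CARD('n)"
        if j: "B \<le> real j"
      proof (rule devY_large_coord[OF xS h(1)])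
        have "J \<le> j" using j unfolding J_def by linarith
        thus "\<bar>Yc j s \<omega>\<bar> \<le> exp (- d\<^sub>1 * real j / 4)" if "s \<in> index_box n" for s
          using badC(3)[of \<omega> s j] w sub that by (auto simp: bad_def)
      qed (use w n in auto)
    qed
    ultimately show ?thesis using bad unfolding cc_def B_def coords_close_def on_range_def by blast
  qed
  show thesis by (rule that[OF sQ main])
qed

text \<open>Borel-Cantelli over m, then square summation. About m^\<alpha> coordinates of size
  m^(-\<beta>-\<alpha>) have square sum m^(-2\<beta>-\<alpha>); the other coordinates form a
  geometric tail, exponentially small in m^\<alpha>.\<close>

lemma uniform_law:
  obtains C where "0 < C"
    "AE \<omega> in P. \<forall>\<^sub>F m in sequentially. uniformly_close C m \<omega>"
proof -
  obtain Q :: "nat \<Rightarrow> real" where Q: "summable Q"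
    "\<And>m. 1 \<le> m \<Longrightarrow> \<exists>bad\<in>events. prob bad \<le> Q m \<and>
       (\<forall>\<omega>\<in>space P - bad. coords_close m \<omega>)"
    by (rule uniform_event) blast
  \<comment> \<open>The events are available from m = 1 on, so the sequence is shifted by
    one.\<close>
  have "\<forall>m. \<exists>bad. bad \<in> events \<and> prob bad \<le> Q (Suc m) \<and> (\<forall>\<omega>\<in>space P - bad. coords_close (Suc m) \<omega>)"
    using Q(2)[of "Suc _"] by fastforce
  then obtain bad where bad: "\<And>m. bad m \<in> events" "\<And>m. prob (bad m) \<le> Q (Suc m)"
    "\<And>m \<omega>. \<omega> \<in> space P - bad m \<Longrightarrow> coords_close (Suc m) \<omega>"
    by metis
  have "AE \<omega> in P. \<forall>\<^sub>F m in sequentially. \<omega> \<in> space P - bad m"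
  proof (rule borel_cantelli_AE1)
    have "summable (\<lambda>m. Q (Suc m))" using Q(1) by (simp add: summable_Suc_iff)
    thus "summable (\<lambda>m. prob (bad m))"
      by (rule summable_comparison_test') (use bad(2) in auto)
  qed (use bad(1) in \<open>auto simp: emeasure_eq_measure\<close>)
  hence G: "AE \<omega> in P. \<forall>\<^sub>F m in sequentially. coords_close m \<omega>"
  proof eventually_elim
    case (elim \<omega>)
    hence "\<forall>\<^sub>F m in sequentially. coords_close (Suc m) \<omega>" by eventually_elim (rule bad(3))
    thus ?case by (rule eventually_sequentially_Suc[THEN iffD1])
  qed
  define x0 where "x0 = exp (- d\<^sub>1 / 2)"
  have x0: "0 < x0" "x0 < 1" using tail_const by (auto simp: x0_def)
  define c1 where "c1 = (1 + 4 * b) + b * (d\<^sub>0 + \<kappa>\<^sub>0)"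
  define c2 where "c2 = b * (d\<^sub>0 + 2)"
  \<comment> \<open>As C >= 1, C <= C^2, so the same constant dominates the linear bound for the
    denominator and the squared bound for the coordinates.\<close>
  define C where "C = 1 + (1 + 4 * b) + 2 * c1\<^sup>2 + c2\<^sup>2 / (1 - x0)"
  have cnn: "0 \<le> 2 * c1\<^sup>2" "0 \<le> c2\<^sup>2 / (1 - x0)" using x0 by auto
  have C1: "1 \<le> C" unfolding C_def using cnn b_pos by linarith
  have CC: "2 * c1\<^sup>2 + c2\<^sup>2 / (1 - x0) \<le> C\<^sup>2"
  proof -
    have "2 * c1\<^sup>2 + c2\<^sup>2 / (1 - x0) \<le> C" unfolding C_def using b_pos by simp
    also have "\<dots> \<le> C * C" using C1 by (simp add: mult_le_cancel_left1)
    finally show ?thesis by (simp add: power2_eq_square)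
  qed
  have ev1: "\<forall>\<^sub>F m in sequentially. exp (- (\<kappa>\<^sub>1 / 2) * real m powr \<alpha>) \<le> real m powr (- (\<beta> + \<alpha>))"
    using tail_const exponents by (intro eventually_stretched_exp_le) auto
  have ev2: "\<forall>\<^sub>F m in sequentially. exp (- (d\<^sub>1 / 2) * real m powr \<alpha>) \<le> real m powr (- (2 * \<beta>))"
    using tail_const exponents by (intro eventually_stretched_exp_le) auto
  have "AE \<omega> in P. \<forall>\<^sub>F m in sequentially. uniformly_close C m \<omega>"
    using G
  proof eventually_elim
    case (elim \<omega>)
    show ?case using elim ev1 ev2 eventually_ge_at_top[of 1]
    proof eventually_elim
      case (elim m)
      have m1: "1 \<le> real m" using elim(4) by simp
      define t where "t = real m powr (- \<beta> - \<alpha>)"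
      define B where "B = real m powr \<alpha>"
      define J where "J = nat \<lceil>B\<rceil>"
      have B1: "1 \<le> B" unfolding B_def using m1 exponents by (intro ge_one_powr_ge_zero) auto
      have J: "B \<le> real J" "real J \<le> 2 * B" unfolding J_def using B1 by linarith+
      show ?case unfolding uniformly_close_def on_range_def
      proof (intro allI impI)
        fix n :: "nat ^ 'n" and x h
        assume a: "\<forall>i. n $ i \<le> m" "x \<in> lip_ball D (real m powr \<beta>')" "0 < h" "h \<le> (1::real)"
        note g = elim(1)[unfolded coords_close_def on_range_def, rule_format, OF a(1)[rule_format] a(2-4)]
        define T where "T = real m ^ CARD('n) / h"
        \<comment> \<open>As h <= 1, error terms without the factor 1/h are absorbed into T.\<close>
        have T0: "0 \<le> T" and mT: "real m ^ CARD('n) \<le> T"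
          unfolding T_def using a by (auto simp: field_simps mult_left_le_one_le)
        have t0: "0 \<le> t" by (simp add: t_def)
        have gK: "\<bar>devK n x h \<omega>\<bar> \<le> (1 + 4 * b) * t * T" using g by (simp add: t_def T_def)
        have gS: "\<bar>devY j n x h \<omega>\<bar> \<le> c1 * t * T" if j: "j < J" for j
        proof -
          have "real j < B" using j unfolding J_def by linarith
          hence "\<bar>devY j n x h \<omega>\<bar> \<le> (1 + 4 * b) * t * T
              + b * (d\<^sub>0 + \<kappa>\<^sub>0) * exp (- \<kappa>\<^sub>1 * real m powr \<alpha> / 2) * real m ^ CARD('n)"
            using g unfolding B_def t_def T_def by (simp del: times_divide_eq_left)
          also have "\<dots> \<le> (1 + 4 * b) * t * T + b * (d\<^sub>0 + \<kappa>\<^sub>0) * t * T"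
            using elim(2) mT t0 b_pos tail_const
            by (intro add_left_mono mult_mono mult_left_mono) (auto simp: t_def)
          finally show ?thesis by (simp add: c1_def distrib_right)
        qed
        have gL: "(devY j n x h \<omega>)\<^sup>2 \<le> c2\<^sup>2 * x0 ^ j * T\<^sup>2" if j: "J \<le> j" for j
        proof -
          have "B \<le> real j" using j J by linarith
          hence "\<bar>devY j n x h \<omega>\<bar> \<le> c2 * exp (- d\<^sub>1 * real j / 4) * real m ^ CARD('n)"
            using g unfolding B_def c2_def by blast
          also have "\<dots> \<le> c2 * exp (- d\<^sub>1 * real j / 4) * T"
            using mT b_pos tail_const by (intro mult_left_mono) (auto simp: c2_def)
          finally have "\<bar>devY j n x h \<omega>\<bar>\<^sup>2 \<le> (c2 * exp (- d\<^sub>1 * real j / 4) * T)\<^sup>2"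
            by (rule power_mono) simp
          also have "\<dots> = c2\<^sup>2 * (exp (- d\<^sub>1 * real j / 4))\<^sup>2 * T\<^sup>2" by (simp add: power_mult_distrib)
          also have "(exp (- d\<^sub>1 * real j / 4))\<^sup>2 = x0 ^ j"
            unfolding x0_def by (simp add: exp_double[symmetric] exp_of_nat_mult[symmetric] mult.commute)
          finally show ?thesis by simp
        qed
        have geo: "summable (\<lambda>j. c2\<^sup>2 * x0 ^ j * T\<^sup>2)"
          using x0 by (intro summable_mult summable_mult2 summable_geometric) auto
        have sm: "summable (\<lambda>j. (devY j n x h \<omega>)\<^sup>2)"
          by (rule summable_comparison_test'[OF geo, of J]) (use gL in auto)
        have tail: "(\<Sum>i. (devY (i + J) n x h \<omega>)\<^sup>2) \<le> c2\<^sup>2 / (1 - x0) * real m powr (- (2 * \<beta>)) * T\<^sup>2"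
        proof -
          have "(\<Sum>i. (devY (i + J) n x h \<omega>)\<^sup>2) \<le> (\<Sum>i. c2\<^sup>2 * x0 ^ (i + J) * T\<^sup>2)"
            by (intro suminf_le summable_ignore_initial_segment[OF sm] summable_ignore_initial_segment[OF geo] gL) simp
          also have "\<dots> = (\<Sum>i. (c2\<^sup>2 * x0 ^ J * T\<^sup>2) * x0 ^ i)" by (simp add: power_add mult_ac)
          also have "\<dots> = (c2\<^sup>2 * x0 ^ J * T\<^sup>2) * (1 / (1 - x0))"
            using x0 by (subst suminf_mult) (auto simp: suminf_geometric)
          also have "\<dots> = c2\<^sup>2 / (1 - x0) * x0 ^ J * T\<^sup>2" by simp
          also have "\<dots> \<le> c2\<^sup>2 / (1 - x0) * real m powr (- (2 * \<beta>)) * T\<^sup>2"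
          proof -
            have "x0 ^ J = exp (- (d\<^sub>1 / 2) * real J)" unfolding x0_def by (simp add: exp_of_nat_mult[symmetric] mult.commute)
            also have "\<dots> \<le> exp (- (d\<^sub>1 / 2) * B)" using J tail_const by simp
            also have "\<dots> \<le> real m powr (- (2 * \<beta>))" unfolding B_def by (rule elim(3))
            finally show ?thesis using cnn by (intro mult_right_mono mult_left_mono) auto
          qed
          finally show ?thesis .
        qed
        have head: "(\<Sum>j<J. (devY j n x h \<omega>)\<^sup>2) \<le> 2 * c1\<^sup>2 * real m powr (- (2 * \<beta>)) * T\<^sup>2"
        proof -
          have "(\<Sum>j<J. (devY j n x h \<omega>)\<^sup>2) \<le> (\<Sum>j<J. (c1 * t * T)\<^sup>2)"
          proof (rule sum_mono)
            fix j assume "j \<in> {..<J}"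
            hence "\<bar>devY j n x h \<omega>\<bar> \<le> c1 * t * T" using gS by simp
            hence "\<bar>devY j n x h \<omega>\<bar>\<^sup>2 \<le> (c1 * t * T)\<^sup>2" by (rule power_mono) simp
            thus "(devY j n x h \<omega>)\<^sup>2 \<le> (c1 * t * T)\<^sup>2" by simp
          qed
          also have "\<dots> = real J * (t\<^sup>2 * (c1\<^sup>2 * T\<^sup>2))" by (simp add: power_mult_distrib mult_ac)
          also have "\<dots> \<le> (2 * B) * (t\<^sup>2 * (c1\<^sup>2 * T\<^sup>2))" using J by (intro mult_right_mono) auto
          also have "\<dots> = 2 * c1\<^sup>2 * (B * t\<^sup>2) * T\<^sup>2" by (simp add: mult_ac)
          also have "\<dots> \<le> 2 * c1\<^sup>2 * real m powr (- (2 * \<beta>)) * T\<^sup>2"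
          proof -
            have "B * t\<^sup>2 = real m powr (\<alpha> + 2 * (- \<beta> - \<alpha>))"
            proof -
              have "t\<^sup>2 = real m powr (2 * (- \<beta> - \<alpha>))" unfolding t_def using m1 by (simp add: powr_power mult.commute)
              thus ?thesis unfolding B_def by (simp only: powr_add)
            qed
            \<comment> \<open>The margin \<alpha> in the deviation level enters squared and
              outweighs the number of coordinates.\<close>
            also have "\<dots> \<le> real m powr (- (2 * \<beta>))" using m1 exponents by (intro powr_mono) auto
            finally show ?thesis by (intro mult_right_mono mult_left_mono) auto
          qed
          finally show ?thesis .
        qed
        have "(\<Sum>j. (devY j n x h \<omega>)\<^sup>2) = (\<Sum>i. (devY (i + J) n x h \<omega>)\<^sup>2) + (\<Sum>j<J. (devY j n x h \<omega>)\<^sup>2)"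
          by (rule suminf_split_initial_segment[OF sm])
        also have "\<dots> \<le> (2 * c1\<^sup>2 + c2\<^sup>2 / (1 - x0)) * (real m powr (- (2 * \<beta>)) * T\<^sup>2)"
          using head tail by (simp only: distrib_right mult.assoc)
        also have "\<dots> \<le> C\<^sup>2 * (real m powr (- (2 * \<beta>)) * T\<^sup>2)" by (intro mult_right_mono CC) auto
        also have "\<dots> = (C * real m powr (- \<beta>) * T)\<^sup>2"
          using m1 by (simp add: power_mult_distrib powr_power mult.commute)
        finally have fin: "(\<Sum>j. (devY j n x h \<omega>)\<^sup>2) \<le> (C * real m powr (- \<beta>) * T)\<^sup>2" .
        have "(1 + 4 * b) * t * T \<le> C * real m powr (- \<beta>) * T"
        proof (intro mult_right_mono mult_mono T0)
          show "1 + 4 * b \<le> C" unfolding C_def using cnn by linarith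
          show "t \<le> real m powr (- \<beta>)" unfolding t_def using m1 exponents by (intro powr_mono) auto
        qed (use t0 C1 in auto)
        with gK sm fin show "\<bar>devK n x h \<omega>\<bar> \<le> C * real m powr (- \<beta>) * real m ^ CARD('n) / h \<and>
          summable (\<lambda>j. (devY j n x h \<omega>)\<^sup>2) \<and>
          (\<Sum>j. (devY j n x h \<omega>)\<^sup>2) \<le> (C * real m powr (- \<beta>) * real m ^ CARD('n) / h)\<^sup>2"
          by (simp add: T_def)
      qed
    qed
  qed
  thus thesis using C1 by (intro that[of C]) auto
qed

end

lemma summable_of_ennreal_suminf_le:
  fixes a :: "nat \<Rightarrow> real"
  assumes le: "(\<Sum>j. ennreal (a j)) \<le> ennreal C" and a: "\<And>j. 0 \<le> a j" and C: "0 \<le> C"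
  shows "summable a" "(\<Sum>j. a j) \<le> C"
proof -
  have part: "(\<Sum>j<k. a j) \<le> C" for k
  proof -
    have "ennreal (\<Sum>j<k. a j) = (\<Sum>j<k. ennreal (a j))" using a by (simp add: sum_ennreal)
    also have "\<dots> \<le> (\<Sum>j. ennreal (a j))" by (rule sum_le_suminf) auto
    also note le
    finally show ?thesis using C by simp
  qed
  show s: "summable a" by (rule summableI_nonneg_bounded[OF a part])
  show "(\<Sum>j. a j) \<le> C" by (rule suminf_le_const[OF s part])
qed

text \<open>The sum of two Landau terms is to be an exact equality: A takes as much of s as C a
  allows, and what is left lies between 0 and C' c.\<close>

lemma bigo_decomposition:
  fixes s :: "nat \<Rightarrow> ennreal" and a c :: "nat \<Rightarrow> real"
  assumes le: "\<forall>\<^sub>F k in sequentially. s k \<le> ennreal (C * a k + C' * c k) \<and> 0 \<le> a k \<and> 0 \<le> c k"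
    and C: "0 \<le> C" "0 \<le> C'"
  shows "\<exists>A\<in>O(a). \<exists>B\<in>O(c). \<forall>\<^sub>F k in sequentially. s k = ennreal (A k + B k)"
proof (intro bexI)
  define A where "A k = min (enn2real (s k)) (C * a k)" for k
  define B where "B k = enn2real (s k) - A k" for k
  have fin: "s k = ennreal (enn2real (s k)) \<and> enn2real (s k) \<le> C * a k + C' * c k"
    if "s k \<le> ennreal (C * a k + C' * c k) \<and> 0 \<le> a k \<and> 0 \<le> c k" for k
  proof -
    have "0 \<le> C * a k + C' * c k" using that C by simp
    thus ?thesis using that by (auto intro!: enn2real_leI simp: less_top[symmetric] ennreal_enn2real_if top_unique)
  qed
  show "\<forall>\<^sub>F k in sequentially. s k = ennreal (A k + B k)"
    using le by eventually_elim (use fin in \<open>simp add: B_def\<close>)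
  show "A \<in> O(a)"
  proof (rule bigoI[of _ C])
    show "\<forall>\<^sub>F k in sequentially. norm (A k) \<le> C * norm (a k)"
      using le by eventually_elim (use C in \<open>auto simp: A_def min_def\<close>)
  qed
  show "B \<in> O(c)"
  proof (rule bigoI[of _ C'])
    show "\<forall>\<^sub>F k in sequentially. norm (B k) \<le> C' * norm (c k)"
      using le
    proof eventually_elim
      case (elim k)
      hence "0 \<le> C' * c k" using C by simp
      thus ?case using fin[OF elim] elim by (auto simp: A_def B_def min_def abs_of_nonneg)
    qed
  qed
qed

context functional_regression
begin

subsection \<open>Positivity of the small ball probability on Lipschitz balls\<close>

text \<open>Otherwise there are functions in the ball with F tending to 0. By Arzela-Ascoli a
  subsequence converges uniformly to some continuous g, which lies in S and has F g h > 0; Lipschitz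
  continuity of F in the centre contradicts this.\<close>

lemma small_ball_bounded_below:
  assumes h: "0 < h" "h \<le> \<delta>\<^sub>6" and R: "0 \<le> R"
  obtains c where "0 < c" "\<And>x. x \<in> lip_ball D R \<Longrightarrow> c \<le> F x h"
proof -
  have "\<exists>c>0. \<forall>x\<in>lip_ball D R. c \<le> F x h"
  proof (rule ccontr)
    assume neg: "\<not> (\<exists>c>0. \<forall>x\<in>lip_ball D R. c \<le> F x h)"
    have "\<forall>i::nat. \<exists>x. x \<in> lip_ball D R \<and> F x h < 1 / (real i + 1)"
    proof
      fix i :: nat
      have "0 < 1 / (real i + 1)" by simp
      thus "\<exists>x. x \<in> lip_ball D R \<and> F x h < 1 / (real i + 1)" using neg by (meson not_le)
    qed
    then obtain x where x: "\<And>i::nat. x i \<in> lip_ball D R" "\<And>i. F (x i) h < 1 / (real i + 1)" by metis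
    obtain g k where g: "continuous_on D g" "strict_mono (k :: nat \<Rightarrow> nat)"
      "\<And>\<epsilon>. 0 < \<epsilon> \<Longrightarrow> \<exists>N. \<forall>i u. i \<ge> N \<and> u \<in> D \<longrightarrow> norm (x (k i) u - g u) < \<epsilon>"
    proof (rule Arzela_Ascoli[of D x R])
      show "compact D" by (rule D)
      show "norm (x i u) \<le> R" if "u \<in> D" for i u using lip_ballD(2)[OF x(1) R that] by simp
      show "\<exists>d>0. \<forall>i v. v \<in> D \<and> norm (u - v) < d \<longrightarrow> norm (x i u - x i v) < \<epsilon>" if u: "u \<in> D" "0 < \<epsilon>" for u \<epsilon>
      proof (intro exI conjI allI impI)
        show "0 < \<epsilon> / (R + 1)" using u R by simp
        fix i v assume v: "v \<in> D \<and> norm (u - v) < \<epsilon> / (R + 1)"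
        have "\<bar>x i u - x i v\<bar> \<le> R * norm (u - v)" using lip_ballD(3)[OF x(1) R u(1)] v by blast
        also have "\<dots> \<le> (R + 1) * norm (u - v)" by (intro mult_right_mono) auto
        also have "\<dots> < \<epsilon>" using v R by (simp add: field_simps)
        finally show "norm (x i u - x i v) < \<epsilon>" by simp
      qed
    qed blast
    have gS: "g \<in> S" using g(1) S(2) by blast
    define G where "G = F g h"
    have G: "0 < G" unfolding G_def using F_pos gS h by blast
    define W where "W = sqrt (measure \<nu> D) + 1"
    have W: "0 < W" by (simp add: W_def add_nonneg_pos)
    \<comment> \<open>Makes the Lipschitz bound at g, normalised by F g h, at most 1 / 2, so F along
      the subsequence stays above half of F g h.\<close>
    define \<epsilon> where "\<epsilon> = 1 / (2 * (\<bar>L\<^sub>F g\<bar> + 1) * W)"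
    have \<epsilon>: "0 < \<epsilon>" using W by (simp add: \<epsilon>_def add_nonneg_pos)
    obtain N where N: "\<And>i u. i \<ge> N \<Longrightarrow> u \<in> D \<Longrightarrow> norm (x (k i) u - g u) < \<epsilon>" using g(3)[OF \<epsilon>] by blast
    obtain N' :: nat where N': "2 / G < real N'" using reals_Archimedean2 by blast
    have N'0: "0 < real N'" using N' divide_pos_pos[of 2 G] G by linarith
    define i where "i = max N N'"
    have xS: "x (k i) \<in> S" using x(1) lip_ball_S by blast
    have "\<rho> (x (k i)) g \<le> l2_dist \<nu> (x (k i)) g" using \<rho>(2) xS gS by blast
    also have "\<dots> \<le> sqrt (measure \<nu> (space \<nu>)) * \<epsilon>"
      using xS gS S_l2 \<epsilon> N[of i] by (intro l2_dist_le_sup \<nu>) (auto simp: space_\<nu> i_def intro: less_imp_le)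
    also have "\<dots> \<le> W * \<epsilon>" unfolding W_def space_\<nu> using \<epsilon> by (intro mult_right_mono) auto
    finally have \<rho>le: "\<rho> (x (k i)) g \<le> W * \<epsilon>" .
    have "\<bar>F (x (k i)) (h * 1) / G - F g (h * 1) / G\<bar> \<le> L\<^sub>F g * (\<rho> (x (k i)) g + \<bar>1 - 1\<bar>)"
      unfolding G_def using h by (intro F_lip[rule_format] gS xS) auto
    also have "\<dots> \<le> (\<bar>L\<^sub>F g\<bar> + 1) * (W * \<epsilon>)"
      using \<rho>le \<rho>_nonneg[OF xS gS] by (intro mult_mono) auto
    also have "\<dots> = 1 / 2" using W by (simp add: \<epsilon>_def add_nonneg_pos)
    finally have "\<bar>F (x (k i)) (h * 1) / G - F g (h * 1) / G\<bar> \<le> 1 / 2" .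
    moreover have "F g (h * 1) / G = 1" using G by (simp add: G_def)
    ultimately have "F (x (k i)) h / G \<ge> 1 / 2" unfolding mult_1_right by linarith
    hence "G / 2 \<le> F (x (k i)) h" using G by (simp add: field_simps)
    also have "\<dots> < 1 / (real (k i) + 1)" by (rule x(2))
    also have "\<dots> \<le> 1 / real N'"
    proof -
      have "N' \<le> k i" using strict_mono_imp_increasing[OF g(2), of i] by (simp add: i_def)
      thus ?thesis using N'0 by (intro divide_left_mono) auto
    qed
    finally have "G / 2 < 1 / real N'" .
    hence "real N' * G < 2" using N'0 by (simp add: field_simps)
    thus False using N' G by (simp add: field_simps)
  qed
  thus thesis using that by blast
qed

text \<open>Probabilities are at most 1, so F^2 <= F: this links the squared infimum in the rate to
  the first power of F by which the error is divided.\<close>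

lemma INF_small_ball:
  assumes h: "0 < h" "h \<le> \<delta>\<^sub>6" and R: "0 \<le> R"
  shows "0 < (INF x\<in>lip_ball D R. (F x h)\<^sup>2)"
    and "x \<in> lip_ball D R \<Longrightarrow> (INF x\<in>lip_ball D R. (F x h)\<^sup>2) \<le> F x h"
    and "(INF x\<in>lip_ball D R. (F x h)\<^sup>2) \<le> 1"
proof -
  have ne: "lip_ball D R \<noteq> {}" using zero_in_lip_ball by blast
  obtain c where c: "0 < c" "\<And>x. x \<in> lip_ball D R \<Longrightarrow> c \<le> F x h" using small_ball_bounded_below[OF assms] by blast
  have "c\<^sup>2 \<le> (INF x\<in>lip_ball D R. (F x h)\<^sup>2)"
    using c by (intro cINF_greatest ne power_mono) auto
  thus "0 < (INF x\<in>lip_ball D R. (F x h)\<^sup>2)" using c(1) by (meson less_le_trans zero_less_power)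
  have bdd: "bdd_below ((\<lambda>x. (F x h)\<^sup>2) ` lip_ball D R)" by (rule bdd_belowI2[where m = 0]) simp
  have le: "(INF x\<in>lip_ball D R. (F x h)\<^sup>2) \<le> F x h" if "x \<in> lip_ball D R" for x
  proof -
    have "(INF x\<in>lip_ball D R. (F x h)\<^sup>2) \<le> (F x h)\<^sup>2" by (rule cINF_lower[OF bdd that])
    also have "\<dots> \<le> F x h * 1" unfolding power2_eq_square by (intro mult_left_mono F_le_1 F_nonneg)
    finally show ?thesis by simp
  qed
  thus "x \<in> lip_ball D R \<Longrightarrow> (INF x\<in>lip_ball D R. (F x h)\<^sup>2) \<le> F x h" .
  show "(INF x\<in>lip_ball D R. (F x h)\<^sup>2) \<le> 1"
    using le[OF zero_in_lip_ball] F_le_1 by (rule order_trans)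
qed

subsection \<open>The estimation error\<close>

lemma bias_constant:
  obtains C where "0 \<le> C"
    "\<And>x. x \<in> S \<Longrightarrow> summable (\<lambda>j. (b * (\<bar>\<theta>' x j 0\<bar> + L x j))\<^sup>2)"
    "\<And>x. x \<in> S \<Longrightarrow> (\<Sum>j. (b * (\<bar>\<theta>' x j 0\<bar> + L x j))\<^sup>2) \<le> C\<^sup>2"
proof -
  define c1 where "c1 = enn2real (SUP x\<in>S. \<Sum>j. ennreal ((\<theta>' x j 0)\<^sup>2))"
  define c2 where "c2 = enn2real (SUP x\<in>S. \<Sum>j. ennreal ((L x j)\<^sup>2))"
  have c: "0 \<le> c1" "0 \<le> c2" by (auto simp: c1_def c2_def)
  have e1: "(SUP x\<in>S. \<Sum>j. ennreal ((\<theta>' x j 0)\<^sup>2)) = ennreal c1" using \<theta>'_sum by (simp add: c1_def less_top)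
  have e2: "(SUP x\<in>S. \<Sum>j. ennreal ((L x j)\<^sup>2)) = ennreal c2" using L_sum by (simp add: c2_def less_top)
  have s1: "summable (\<lambda>j. (\<theta>' x j 0)\<^sup>2)" "(\<Sum>j. (\<theta>' x j 0)\<^sup>2) \<le> c1" if x: "x \<in> S" for x
  proof -
    have "(\<Sum>j. ennreal ((\<theta>' x j 0)\<^sup>2)) \<le> ennreal c1" unfolding e1[symmetric] by (rule SUP_upper[OF x])
    from summable_of_ennreal_suminf_le[OF this _ c(1)]
    show "summable (\<lambda>j. (\<theta>' x j 0)\<^sup>2)" "(\<Sum>j. (\<theta>' x j 0)\<^sup>2) \<le> c1" by auto
  qed
  have s2: "summable (\<lambda>j. (L x j)\<^sup>2)" "(\<Sum>j. (L x j)\<^sup>2) \<le> c2" if x: "x \<in> S" for x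
  proof -
    have "(\<Sum>j. ennreal ((L x j)\<^sup>2)) \<le> ennreal c2" unfolding e2[symmetric] by (rule SUP_upper[OF x])
    from summable_of_ennreal_suminf_le[OF this _ c(2)]
    show "summable (\<lambda>j. (L x j)\<^sup>2)" "(\<Sum>j. (L x j)\<^sup>2) \<le> c2" by auto
  qed
  define C where "C = 1 + 2 * b\<^sup>2 * (c1 + c2)"
  have C: "1 \<le> C" using c by (simp add: C_def)
  have le: "(b * (\<bar>\<theta>' x j 0\<bar> + L x j))\<^sup>2 \<le> 2 * b\<^sup>2 * ((\<theta>' x j 0)\<^sup>2 + (L x j)\<^sup>2)" for x j
  proof -
    have "(\<bar>\<theta>' x j 0\<bar> + L x j)\<^sup>2 \<le> 2 * ((\<theta>' x j 0)\<^sup>2 + (L x j)\<^sup>2)"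
      using sum_squares_bound[of "\<bar>\<theta>' x j 0\<bar>" "L x j"] by (simp add: power2_sum)
    hence "b\<^sup>2 * (\<bar>\<theta>' x j 0\<bar> + L x j)\<^sup>2 \<le> b\<^sup>2 * (2 * ((\<theta>' x j 0)\<^sup>2 + (L x j)\<^sup>2))"
      by (intro mult_left_mono) auto
    thus ?thesis by (simp only: power_mult_distrib mult.assoc mult.left_commute)
  qed
  have s3: "summable (\<lambda>j. 2 * b\<^sup>2 * ((\<theta>' x j 0)\<^sup>2 + (L x j)\<^sup>2))" if "x \<in> S" for x
    using s1(1)[OF that] s2(1)[OF that] by (intro summable_mult summable_add)
  have sm: "summable (\<lambda>j. (b * (\<bar>\<theta>' x j 0\<bar> + L x j))\<^sup>2)" if "x \<in> S" for x
    by (rule summable_comparison_test'[OF s3[OF that]]) (use le in auto)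
  have "(\<Sum>j. (b * (\<bar>\<theta>' x j 0\<bar> + L x j))\<^sup>2) \<le> C\<^sup>2" if x: "x \<in> S" for x
  proof -
    have "(\<Sum>j. (b * (\<bar>\<theta>' x j 0\<bar> + L x j))\<^sup>2) \<le> (\<Sum>j. 2 * b\<^sup>2 * ((\<theta>' x j 0)\<^sup>2 + (L x j)\<^sup>2))"
      by (rule suminf_le[OF le sm[OF x] s3[OF x]])
    also have "\<dots> = 2 * b\<^sup>2 * ((\<Sum>j. (\<theta>' x j 0)\<^sup>2) + (\<Sum>j. (L x j)\<^sup>2))"
      using s1(1)[OF x] s2(1)[OF x] by (simp add: suminf_mult suminf_add summable_add)
    also have "\<dots> \<le> 2 * b\<^sup>2 * (c1 + c2)" using s1(2)[OF x] s2(2)[OF x] by (intro mult_left_mono add_mono) auto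
    also have "\<dots> \<le> C" by (simp add: C_def)
    also have "\<dots> \<le> C * C" using C by (simp add: mult_le_cancel_left1)
    finally show ?thesis by (simp add: power2_eq_square)
  qed
  with sm show thesis using C by (intro that[of C]) auto
qed

lemma Psi_bound:
  assumes "0 < R\<^sub>0"
  obtains C where "0 \<le> C" "\<And>R x. R\<^sub>0 \<le> R \<Longrightarrow> x \<in> lip_ball D R \<Longrightarrow> l2_norm \<nu> (\<Psi> x) \<le> C * R ^ (4 * CARD('d))"
proof -
  define z :: "'d fld" where "z = (\<lambda>_. 0)"
  have z: "z \<in> S" using zero_in_lip_ball[of D 0] lip_ball_S unfolding z_def by blast
  define W where "W = sqrt (measure \<nu> D)"
  have W: "0 \<le> W" by (simp add: W_def)
  define C0 where "C0 = l2_norm \<nu> (\<Psi> z) + \<bar>L\<^sub>\<Psi>\<bar> * (W * R\<^sub>0) powr r"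
  define C where "C = C0 / R\<^sub>0 ^ (4 * CARD('d))"
  have C0: "0 \<le> C0" by (simp add: C0_def)
  have "l2_norm \<nu> (\<Psi> x) \<le> C * R ^ (4 * CARD('d))" if R: "R\<^sub>0 \<le> R" and x: "x \<in> lip_ball D R" for R x
  proof -
    have R0: "0 < R" using R assms by simp
    have xS: "x \<in> S" using x lip_ball_S by blast
    define q where "q = (R / R\<^sub>0) ^ (4 * CARD('d))"
    have R1: "1 \<le> R / R\<^sub>0" using R assms by simp
    have q1: "1 \<le> q" unfolding q_def by (rule one_le_power[OF R1])
    have "l2_dist \<nu> x z \<le> sqrt (measure \<nu> (space \<nu>)) * R"
      using xS z S_l2 R0 lip_ballD(2)[OF x] by (intro l2_dist_le_sup \<nu>) (auto simp: z_def space_\<nu>)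
    hence d: "l2_dist \<nu> x z \<le> W * R" by (simp add: W_def space_\<nu>)
    have "l2_norm \<nu> (\<Psi> x) \<le> l2_norm \<nu> (\<Psi> z) + l2_dist \<nu> (\<Psi> x) (\<Psi> z)"
      using l2_norm_diff_le[of "\<Psi> x" \<nu> "\<Psi> z"] \<Psi> xS z by auto
    also have "l2_dist \<nu> (\<Psi> x) (\<Psi> z) \<le> L\<^sub>\<Psi> * l2_dist \<nu> x z powr r" using \<Psi>_hoelder xS z by blast
    also have "\<dots> \<le> \<bar>L\<^sub>\<Psi>\<bar> * (W * R) powr r"
      using d r by (intro mult_mono powr_mono2) auto
    also have "(W * R) powr r = (W * R\<^sub>0) powr r * (R / R\<^sub>0) powr r"
      using W R0 assms by (subst powr_mult[symmetric]) auto
    also have "\<bar>L\<^sub>\<Psi>\<bar> * ((W * R\<^sub>0) powr r * (R / R\<^sub>0) powr r) \<le> \<bar>L\<^sub>\<Psi>\<bar> * ((W * R\<^sub>0) powr r * q)"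
    proof (intro mult_left_mono)
      have "1 \<le> CARD('d)" by (simp add: Suc_le_eq)
      hence "r \<le> real (4 * CARD('d))" using r by linarith
      hence "(R / R\<^sub>0) powr r \<le> (R / R\<^sub>0) powr real (4 * CARD('d))"
        using R1 by (intro powr_mono) auto
      also have "\<dots> = q" unfolding q_def using R1 by (intro powr_realpow) linarith
      finally show "(R / R\<^sub>0) powr r \<le> q" .
    qed auto
    also have "l2_norm \<nu> (\<Psi> z) + \<dots> \<le> l2_norm \<nu> (\<Psi> z) * q + \<bar>L\<^sub>\<Psi>\<bar> * ((W * R\<^sub>0) powr r * q)"
      using mult_left_mono[OF q1, of "l2_norm \<nu> (\<Psi> z)"] by simp
    also have "\<dots> = C0 * q" by (simp add: C0_def distrib_right)
    also have "\<dots> = C * R ^ (4 * CARD('d))" by (simp add: C_def q_def power_divide)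
    finally show ?thesis by simp
  qed
  thus thesis using C0 assms by (intro that[of C]) (auto simp: C_def)
qed

text \<open>Purely deterministic for fixed \<omega>. Multiplying the error by the kernel sum A
  avoids the random denominator; its coordinates are then numerator deviation, minus denominator
  deviation times \<psi>_j, plus bias, and Parseval sums the squares.\<close>

lemma error_bound:
  fixes n :: "nat ^ 'n"
  assumes x: "x \<in> S" and w: "\<omega> \<in> space P" and h: "0 < h" "h \<le> \<delta>\<^sub>1" "h \<le> 1"
    and I: "I = real (card (index_box n))" "0 < I"
    and \<mu>: "0 < \<mu>" "\<And>s. \<mu> * F x h \<le> expectation (kern x h s)"
    and K: "\<bar>devK n x h \<omega>\<bar> \<le> k" "k \<le> \<mu> / 2 * (I * F x h)"
    and Ysum: "summable (\<lambda>j. (devY j n x h \<omega>)\<^sup>2)" "(\<Sum>j. (devY j n x h \<omega>)\<^sup>2) \<le> k\<^sup>2"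
    and C: "0 \<le> C" "summable (\<lambda>j. (b * (\<bar>\<theta>' x j 0\<bar> + L x j))\<^sup>2)"
      "(\<Sum>j. (b * (\<bar>\<theta>' x j 0\<bar> + L x j))\<^sup>2) \<le> C\<^sup>2"
  shows "l2_dist \<nu> (Psi_hat P X Y \<rho> K n h \<omega> x) (\<Psi> x)
      \<le> 4 / \<mu> * ((1 + l2_norm \<nu> (\<Psi> x)) * (k / (I * F x h)) + C * h)"
proof -
  have Fp: "0 < F x h" using F_pos x h by blast
  have k0: "0 \<le> k" using K(1) by linarith
  define A where "A = (\<Sum>s\<in>index_box n. kern x h s \<omega>)"
  define EA where "EA = (\<Sum>s\<in>index_box n. expectation (kern x h s))"
  have A_eq: "A = devK n x h \<omega> + EA" by (simp add: A_def EA_def devK_def sum_subtractf)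
  have "(\<Sum>s\<in>index_box n. \<mu> * F x h) \<le> EA" unfolding EA_def by (intro sum_mono \<mu>)
  hence "\<mu> * (I * F x h) \<le> EA" by (simp add: I mult_ac)
  \<comment> \<open>The deviation k is at most half of the lower bound for the mean, so the random
    denominator keeps the other half.\<close>
  hence A_ge: "\<mu> / 2 * (I * F x h) \<le> A" using A_eq K by linarith
  have IF: "0 < I * F x h" using I Fp by simp
  have A0: "0 < A" using A_ge mult_pos_pos[OF _ IF, of "\<mu> / 2"] \<mu>(1) by linarith
  define v where "v u = Psi_hat P X Y \<rho> K n h \<omega> x u - \<Psi> x u" for u
  have v_eq: "v = (\<lambda>u. inverse A * (\<Sum>s\<in>index_box n. kern x h s \<omega> * Y s \<omega> u) - \<Psi> x u)"
  proof
    fix u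
    \<comment> \<open>The common normalisation by the number of sites and F x h cancels, both being
      positive.\<close>
    have "Psi_hat P X Y \<rho> K n h \<omega> x u = (\<Sum>s\<in>index_box n. Y s \<omega> u * kern x h s \<omega>) / A"
      unfolding Psi_hat_def g_hat_def f_hat_def A_def[symmetric] I(1)[symmetric]
      using I(2) Fp A0 by simp
    also have "\<dots> = inverse A * (\<Sum>s\<in>index_box n. kern x h s \<omega> * Y s \<omega> u)"
      by (simp add: divide_inverse mult.commute)
    finally show "v u = inverse A * (\<Sum>s\<in>index_box n. kern x h s \<omega> * Y s \<omega> u) - \<Psi> x u" by (simp add: v_def)
  qed
  have \<Psi>x: "\<Psi> x \<in> l2_space \<nu>" using \<Psi> x by blast
  have sum_l2: "(\<lambda>u. \<Sum>s\<in>index_box n. kern x h s \<omega> * Y s \<omega> u) \<in> l2_space \<nu>"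
    by (intro l2_sum l2_scale Y_space w)
  have v_l2: "v \<in> l2_space \<nu>" unfolding v_eq by (intro l2_diff l2_scale sum_l2 \<Psi>x)
  define \<psi> where "\<psi> j = l2_inner \<nu> (\<Psi> x) (e j)" for j
  define bj where "bj j = b * (\<bar>\<theta>' x j 0\<bar> + L x j)" for j
  have coord: "l2_inner \<nu> v (e j) = inverse A * (\<Sum>s\<in>index_box n. kern x h s \<omega> * Yc j s \<omega>) - \<psi> j" for j
    unfolding v_eq \<psi>_def
    by (subst l2_inner_diff_left[OF l2_scale[OF sum_l2] \<Psi>x e_l2], subst l2_inner_scale_left,
        subst l2_inner_sum_left) (auto simp: l2_scale Y_space w e_l2 l2_inner_scale_left)
  define E where "E j = (\<Sum>s\<in>index_box n. (\<integral>\<omega>. Yc j s \<omega> * kern x h s \<omega> \<partial>P) - \<psi> j * expectation (kern x h s))" for j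
  have Av: "A * l2_inner \<nu> v (e j) = devY j n x h \<omega> - devK n x h \<omega> * \<psi> j + E j" for j
  proof -
    have "A * l2_inner \<nu> v (e j) = (\<Sum>s\<in>index_box n. kern x h s \<omega> * Yc j s \<omega>) - A * \<psi> j"
      unfolding coord using A0 by (simp add: right_diff_distrib)
    also have "\<dots> = (\<Sum>s\<in>index_box n. Yc j s \<omega> * kern x h s \<omega>) - devK n x h \<omega> * \<psi> j - EA * \<psi> j"
    proof -
      have "A * \<psi> j = devK n x h \<omega> * \<psi> j + EA * \<psi> j" unfolding A_eq by (rule distrib_right)
      moreover have "(\<Sum>s\<in>index_box n. kern x h s \<omega> * Yc j s \<omega>)
          = (\<Sum>s\<in>index_box n. Yc j s \<omega> * kern x h s \<omega>)"
        by (rule sum.cong) (auto simp: mult.commute)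
      ultimately show ?thesis by linarith
    qed
    finally show ?thesis
      unfolding E_def devY_def EA_def by (simp add: sum_subtractf sum_distrib_left sum_distrib_right mult.commute)
  qed
  have Eb: "\<bar>E j\<bar> \<le> I * h * F x h * bj j" for j
  proof -
    have "\<bar>E j\<bar> \<le> (\<Sum>s\<in>index_box n. b * h * (\<bar>\<theta>' x j 0\<bar> + L x j) * F x h)"
      unfolding E_def \<psi>_def by (rule order_trans[OF sum_abs], rule sum_mono) (rule bias[OF x h])
    thus ?thesis by (simp add: I bj_def mult_ac)
  qed
  have sq3: "(p - q + s)\<^sup>2 \<le> 3 * (p\<^sup>2 + q\<^sup>2 + s\<^sup>2)" for p q s :: real
  proof -
    have "0 \<le> (p + q)\<^sup>2 + (p - s)\<^sup>2 + (q + s)\<^sup>2" by simp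
    thus ?thesis by (simp add: power2_eq_square algebra_simps)
  qed
  have Av2: "A\<^sup>2 * (l2_inner \<nu> v (e j))\<^sup>2 \<le> 3 * ((devY j n x h \<omega>)\<^sup>2 + k\<^sup>2 * (\<psi> j)\<^sup>2 + (I * h * F x h)\<^sup>2 * (bj j)\<^sup>2)" for j
  proof -
    have "A\<^sup>2 * (l2_inner \<nu> v (e j))\<^sup>2 = (devY j n x h \<omega> - devK n x h \<omega> * \<psi> j + E j)\<^sup>2"
      by (simp add: Av[symmetric] power_mult_distrib)
    also have "\<dots> \<le> 3 * ((devY j n x h \<omega>)\<^sup>2 + (devK n x h \<omega> * \<psi> j)\<^sup>2 + (E j)\<^sup>2)" by (rule sq3)
    also have "(devK n x h \<omega> * \<psi> j)\<^sup>2 \<le> k\<^sup>2 * (\<psi> j)\<^sup>2"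
      unfolding power_mult_distrib using K(1) k0 by (intro mult_right_mono) (auto simp: abs_le_square_iff[symmetric])
    also have "(E j)\<^sup>2 \<le> (I * h * F x h)\<^sup>2 * (bj j)\<^sup>2"
    proof -
      have "\<bar>E j\<bar>\<^sup>2 \<le> (I * h * F x h * bj j)\<^sup>2" by (intro power_mono Eb) simp
      thus ?thesis by (simp add: power_mult_distrib)
    qed
    finally show ?thesis by simp
  qed
  note Pv = Parseval[OF e v_l2] and P\<Psi> = Parseval[OF e \<Psi>x, folded \<psi>_def]
  have s\<psi>: "summable (\<lambda>j. (\<psi> j)\<^sup>2)" "(\<Sum>j. (\<psi> j)\<^sup>2) = (l2_norm \<nu> (\<Psi> x))\<^sup>2"
    using P\<Psi> by (auto simp: sums_iff)
  have sb: "summable (\<lambda>j. (bj j)\<^sup>2)" "(\<Sum>j. (bj j)\<^sup>2) \<le> C\<^sup>2" using C by (auto simp: bj_def)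
  define z where "z = k + k * l2_norm \<nu> (\<Psi> x) + I * h * F x h * C"
  have "A\<^sup>2 * (l2_norm \<nu> v)\<^sup>2 = (\<Sum>j. A\<^sup>2 * (l2_inner \<nu> v (e j))\<^sup>2)"
    using Pv by (simp add: sums_iff suminf_mult)
  also have "\<dots> \<le> (\<Sum>j. 3 * ((devY j n x h \<omega>)\<^sup>2 + k\<^sup>2 * (\<psi> j)\<^sup>2 + (I * h * F x h)\<^sup>2 * (bj j)\<^sup>2))"
    using Pv Ysum(1) s\<psi>(1) sb(1) by (intro suminf_le Av2 summable_mult summable_add) (auto simp: sums_iff)
  also have "\<dots> = 3 * ((\<Sum>j. (devY j n x h \<omega>)\<^sup>2) + k\<^sup>2 * (\<Sum>j. (\<psi> j)\<^sup>2) + (I * h * F x h)\<^sup>2 * (\<Sum>j. (bj j)\<^sup>2))"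
    using Ysum(1) s\<psi>(1) sb(1)
    by (simp add: suminf_mult suminf_add[symmetric] summable_add summable_mult)
  also have "\<dots> \<le> 3 * (k\<^sup>2 + (k * l2_norm \<nu> (\<Psi> x))\<^sup>2 + (I * h * F x h * C)\<^sup>2)"
    unfolding s\<psi>(2) power_mult_distrib[symmetric] using Ysum(2) sb(2)
    by (intro mult_left_mono add_mono) (auto simp: power_mult_distrib intro!: mult_left_mono)
  also have "\<dots> \<le> (2 * z)\<^sup>2"
  proof -
    have "3 * (p\<^sup>2 + q\<^sup>2 + s\<^sup>2) \<le> (2 * (p + q + s))\<^sup>2" if "0 \<le> p" "0 \<le> q" "0 \<le> s" for p q s :: real
    proof -
      have "0 \<le> p * q" "0 \<le> p * s" "0 \<le> q * s" using that by auto
      thus ?thesis by (simp add: power2_eq_square algebra_simps)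
    qed
    thus ?thesis unfolding z_def using k0 I h Fp C by simp
  qed
  finally have "(A * l2_norm \<nu> v)\<^sup>2 \<le> (2 * z)\<^sup>2" by (simp add: power_mult_distrib)
  moreover have z0: "0 \<le> z" unfolding z_def using k0 I h Fp C by simp
  ultimately have "A * l2_norm \<nu> v \<le> 2 * z" using power2_le_imp_le[of "A * l2_norm \<nu> v" "2 * z"] by simp
  moreover have "\<mu> / 2 * (I * F x h) * l2_norm \<nu> v \<le> A * l2_norm \<nu> v" by (intro mult_right_mono A_ge) auto
  ultimately have "l2_norm \<nu> v * (\<mu> / 2 * (I * F x h)) \<le> 2 * z" by (simp add: mult_ac)
  hence "l2_norm \<nu> v \<le> 2 * z / (\<mu> / 2 * (I * F x h))"
    using \<mu>(1) IF by (subst pos_le_divide_eq) auto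
  also have "\<dots> = 4 / \<mu> * (z / (I * F x h))" by simp
  also have "z / (I * F x h) = (1 + l2_norm \<nu> (\<Psi> x)) * (k / (I * F x h)) + C * h"
    using I(2) Fp unfolding z_def by (simp add: field_simps)
  finally show ?thesis unfolding l2_dist_def v_def .
qed

text \<open>From 3 sites on, the logarithm is at least 1 since 3 > e, and |I|^(1/N) is at most the
  longest side. Solving for R^(4d) is the form in which the rate bounds both the radius and the
  error.\<close>

lemma unif_rate_ge:
  fixes n :: "nat ^ 'n"
  assumes n: "\<And>i. n $ i \<le> m" and m: "1 \<le> m" and I: "3 \<le> card (index_box n)"
    and h: "0 < h" "h \<le> \<delta>\<^sub>6" and R: "0 < R"
  shows "R ^ (4 * CARD('d)) \<le> unif_rate P X \<rho> D n R h * (real m powr \<beta> * (INF x\<in>lip_ball D R. (F x h)\<^sup>2) * h)"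
proof -
  define I where "I = real (card (index_box n))"
  define J where "J = (INF x\<in>lip_ball D R. (F x h)\<^sup>2)"
  define c where "c = I powr (1 / real CARD('n) * (1 / real (4 * CARD('d) + 1)))"
  have J: "0 < J" unfolding J_def by (rule INF_small_ball(1)) (use h R in auto)
  have I3: "3 \<le> I" using assms(3) by (simp add: I_def)
  have m0: "0 < real m" using m by simp
  have c0: "0 < c" using I3 by (simp add: c_def)
  have "exp 1 \<le> I" using I3 exp_le by linarith
  hence ln1: "1 \<le> ln I" using I3 by (subst ln_ge_iff) auto
  have "c \<le> (real m ^ CARD('n)) powr (1 / real CARD('n) * (1 / real (4 * CARD('d) + 1)))"
    unfolding c_def using card_index_box_real_le[OF n] I3 by (intro powr_mono2) (auto simp: I_def)
  also have "\<dots> = real m powr \<beta>"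
    using m0 by (simp add: powr_realpow[symmetric] powr_powr \<beta>_def add.commute)
  finally have cm: "c \<le> real m powr \<beta>" .
  have rate: "unif_rate P X \<rho> D n R h = R ^ (4 * CARD('d)) * ln I ^ 8 / (c * J * h)"
    by (simp add: unif_rate_def I_def J_def c_def)
  have "R ^ (4 * CARD('d)) * (c * J * h) \<le> (R ^ (4 * CARD('d)) * ln I ^ 8) * (real m powr \<beta> * J * h)"
    using R J h c0 cm one_le_power[OF ln1, of 8] by (intro mult_mono) auto
  hence "R ^ (4 * CARD('d)) \<le> (R ^ (4 * CARD('d)) * ln I ^ 8) * (real m powr \<beta> * J * h) / (c * J * h)"
    using c0 J h by (subst pos_le_divide_eq) auto
  thus ?thesis unfolding rate J_def[symmetric] by simp
qed

section \<open>Combination of the pathwise error bound with the asymptotics of box, radius and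
  bandwidth\<close>

theorem uniform_rate_of_convergence:
  fixes n :: "nat \<Rightarrow> nat ^ 'n" and R h :: "nat \<Rightarrow> real" and l :: ereal
  assumes n: "converges_to_infinity n"
    and R: "(\<lambda>k. ereal (R k)) \<longlonglongrightarrow> l" "0 < l"
    and h: "\<forall>k. 0 < h k" "h \<longlonglongrightarrow> 0"
    and rate: "(\<lambda>k. unif_rate P X \<rho> D (n k) (R k) (h k)) \<longlonglongrightarrow> 0"
  shows "AE \<omega> in P. \<exists>A\<in>O(\<lambda>k. unif_rate P X \<rho> D (n k) (R k) (h k)). \<exists>B\<in>O(\<lambda>k. h k powr r).
           \<forall>\<^sub>F k in sequentially.
             (SUP x\<in>lip_ball D (R k). ennreal (l2_dist \<nu> (Psi_hat P X Y \<rho> K (n k) (h k) \<omega> x) (\<Psi> x)))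
             = ennreal (A k + B k)"
proof -
  define d4 where "d4 = 4 * CARD('d)"
  define a where "a k = unif_rate P X \<rho> D (n k) (R k) (h k)" for k
  define m where "m k = Max (range (\<lambda>i. n k $ i))" for k
  have nm: "n k $ i \<le> m k" for k i unfolding m_def by (rule Max_ge) auto
  have m_inf: "filterlim m at_top sequentially"
  proof (rule filterlim_at_top_mono)
    show "filterlim (\<lambda>k. n k $ undefined) at_top sequentially"
      using n by (simp add: converges_to_infinity_def)
  qed (simp add: nm)
  obtain R\<^sub>0 where R0: "0 < R\<^sub>0" "\<forall>\<^sub>F k in sequentially. R\<^sub>0 < R k"
  proof -
    obtain z where z: "0 < ereal z" "ereal z < l" using ereal_dense2[OF R(2)] by blast
    from order_tendstoD(1)[OF R(1) z(2)] z(1) show thesis by (intro that[of z]) auto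
  qed
  \<comment> \<open>The aspect ratio is bounded below, so every side is at least c m and the box has
    at least (c m)^N sites.\<close>
  obtain c where c: "0 < c"
    "\<forall>\<^sub>F k in sequentially. c < real (Min (range (\<lambda>i. n k $ i))) / real (m k)"
  proof -
    have "0 < liminf (\<lambda>k. ereal (real (Min (range (\<lambda>i. n k $ i))) / real (m k)))"
      using n by (simp add: converges_to_infinity_def m_def)
    then obtain z where z: "0 < ereal z"
      "ereal z < liminf (\<lambda>k. ereal (real (Min (range (\<lambda>i. n k $ i))) / real (m k)))"
      using ereal_dense2 by blast
    from less_LiminfD[OF z(2)] z(1) show thesis by (intro that[of z]) auto
  qed
  obtain C where C: "0 < C" and law:
    "AE \<omega> in P. \<forall>\<^sub>F m in sequentially. uniformly_close C m \<omega>"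
    by (rule uniform_law)
  obtain \<mu> where \<mu>: "0 < \<mu>" "\<forall>\<^sub>F h in at_right 0. \<forall>x\<in>S. \<forall>s. \<mu> * F x h \<le> expectation (kern x h s)"
    by (rule kern_mean_lower)
  obtain Cb where Cb: "0 \<le> Cb"
    "\<And>x. x \<in> S \<Longrightarrow> summable (\<lambda>j. (b * (\<bar>\<theta>' x j 0\<bar> + L x j))\<^sup>2)"
    "\<And>x. x \<in> S \<Longrightarrow> (\<Sum>j. (b * (\<bar>\<theta>' x j 0\<bar> + L x j))\<^sup>2) \<le> Cb\<^sup>2"
    by (rule bias_constant) blast
  obtain C\<Psi> where C\<Psi>: "0 \<le> C\<Psi>"
    "\<And>R x. R\<^sub>0 \<le> R \<Longrightarrow> x \<in> lip_ball D R \<Longrightarrow> l2_norm \<nu> (\<Psi> x) \<le> C\<Psi> * R ^ (4 * CARD('d))"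
    by (rule Psi_bound[OF R0(1)]) blast
  define Cc where "Cc = C / c ^ CARD('n)"
  have Cc: "0 < Cc" using C c by (simp add: Cc_def)
  define C3 where "C3 = 4 / \<mu> * (Cc / R\<^sub>0 ^ d4 + C\<Psi> * Cc)"
  define C4 where "C4 = 4 / \<mu> * Cb"
  have C34: "0 \<le> C3" "0 \<le> C4" using \<mu>(1) Cc R0(1) C\<Psi>(1) Cb(1) by (auto simp: C3_def C4_def)
  have h_right: "filterlim h (at_right 0) sequentially"
  proof -
    have "h k \<in> {0<..} \<and> h k \<noteq> 0" for k using h(1)[rule_format, of k] by auto
    thus ?thesis unfolding filterlim_at using h(2) by simp
  qed
  have ev_h: "\<forall>\<^sub>F k in sequentially. h k < \<delta>" if "0 < \<delta>" for \<delta>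
    using order_tendstoD(2)[OF h(2) that] .
  have ev_\<mu>: "\<forall>\<^sub>F k in sequentially. \<forall>x\<in>S. \<forall>s. \<mu> * F x (h k) \<le> expectation (kern x (h k) s)"
    by (rule eventually_compose_filterlim[OF \<mu>(2) h_right])
  \<comment> \<open>Ensures c m >= 3 and therefore at least 3 sites.\<close>
  have ev_m: "\<forall>\<^sub>F k in sequentially. real (nat \<lceil>3 / c\<rceil>) + 1 \<le> real (m k)"
  proof -
    have "\<forall>\<^sub>F k in sequentially. nat \<lceil>3 / c\<rceil> + 1 \<le> m k"
      using m_inf by (simp add: filterlim_at_top)
    thus ?thesis by eventually_elim linarith
  qed
  \<comment> \<open>Below 1 the rate forces R <= m^\<beta>'; below the second value the deviation of
    the denominator is at most half of its mean.\<close>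
  have "0 < min 1 (\<mu> / 2 / (Cc / R\<^sub>0 ^ d4))" using \<mu>(1) Cc R0(1) by simp
  from order_tendstoD(2)[OF rate this]
  have ev_a: "\<forall>\<^sub>F k in sequentially. a k < 1 \<and> a k < \<mu> / 2 / (Cc / R\<^sub>0 ^ d4)" by (simp add: a_def)
  show ?thesis using law AE_space
  proof eventually_elim
    case (elim \<omega>)
    note w = elim(2)
    have ev_law: "\<forall>\<^sub>F k in sequentially. uniformly_close C (m k) \<omega>"
      by (rule eventually_compose_filterlim[OF elim(1) m_inf])
    have "\<forall>\<^sub>F k in sequentially.
       (SUP x\<in>lip_ball D (R k). ennreal (l2_dist \<nu> (Psi_hat P X Y \<rho> K (n k) (h k) \<omega> x) (\<Psi> x)))
         \<le> ennreal (C3 * a k + C4 * h k powr r) \<and> 0 \<le> a k \<and> 0 \<le> h k powr r"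
      using ev_law R0(2) c(2) ev_\<mu> ev_m ev_a ev_h[OF zero_less_one] ev_h[OF \<delta>\<^sub>1] ev_h[OF \<delta>\<^sub>6]
    proof eventually_elim
      case (elim k)
      define M where "M = real (m k)"
      define I where "I = real (card (index_box (n k)))"
      define J where "J = (INF x\<in>lip_ball D (R k). (F x (h k))\<^sup>2)"
      have hk: "0 < h k" "h k \<le> \<delta>\<^sub>1" "h k \<le> 1" "h k \<le> \<delta>\<^sub>6" using h elim by auto
      have Rk: "0 < R k" "R\<^sub>0 \<le> R k" using R0(1) elim by auto
      have M: "1 \<le> M" "3 \<le> c * M"
      proof -
        show "1 \<le> M" using elim(5) unfolding M_def by linarith
        have "3 / c \<le> M" using elim(5) unfolding M_def by linarith
        thus "3 \<le> c * M" using c(1) by (simp add: field_simps)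
      qed
      have ni: "c * M \<le> real (n k $ i)" for i
      proof -
        have "c * M < real (Min (range (\<lambda>i. n k $ i)))" using elim(3) M(1) by (simp add: M_def field_simps)
        also have "\<dots> \<le> real (n k $ i)" by (simp add: Min_le)
        finally show ?thesis by simp
      qed
      have I_ge: "(c * M) ^ CARD('n) \<le> I"
      proof -
        have "(\<Prod>i\<in>(UNIV :: 'n set). c * M) \<le> (\<Prod>i\<in>UNIV. real (n k $ i))"
          using ni M(2) by (intro prod_mono) auto
        thus ?thesis by (simp add: I_def card_index_box)
      qed
          have I3: "3 \<le> I"
      proof -
        have "(c * M) ^ 1 \<le> (c * M) ^ CARD('n)" using M(2) by (intro power_increasing) (auto simp: Suc_le_eq)
        thus ?thesis using I_ge M(2) by simp
      qed
      have J: "0 < J" "J \<le> 1" and JF: "x \<in> lip_ball D (R k) \<Longrightarrow> J \<le> F x (h k)" for x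
        unfolding J_def using INF_small_ball[OF hk(1,4), of "R k"] Rk by auto
      have Ra: "R k ^ d4 \<le> a k * (M powr \<beta> * J * h k)"
        unfolding a_def M_def J_def d4_def
        by (rule unif_rate_ge) (use nm M I3 hk Rk in \<open>auto simp: M_def I_def\<close>)
      have Mp: "0 < M powr \<beta>" using M by simp
      have a0: "0 \<le> a k"
      proof (rule ccontr)
        assume "\<not> 0 \<le> a k"
        hence "a k * (M powr \<beta> * J * h k) < 0" using Mp J hk by (intro mult_neg_pos) auto
        moreover have "0 < R k ^ d4" using Rk by simp
        ultimately show False using Ra by linarith
      qed
      \<comment> \<open>The rate, the squared infimum and the bandwidth are all at most 1, leaving
        m^\<beta> = (m^\<beta>')^(4d).\<close>
      have "R k ^ d4 \<le> 1 * (M powr \<beta> * 1 * 1)"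
        using Ra elim(6) J hk a0 by (elim order_trans) (intro mult_mono, auto)
      also have "\<dots> = (M powr \<beta>') ^ d4"
        using M by (simp add: powr_power \<beta>'_def d4_def)
      finally have RM: "R k \<le> M powr \<beta>'"
        using power_strict_mono[of "M powr \<beta>'" "R k" d4] by (force simp: d4_def)
      define q where "q = C * M powr (- \<beta>) * M ^ CARD('n) / h k"
      \<comment> \<open>Bounds the relative deviation q / (I F x h) for every x in the ball; the
        powers m^N cancel against the lower bound for the number of sites.\<close>
      define \<kappa> where "\<kappa> = Cc / (M powr \<beta> * J * h k)"
      have q0: "0 \<le> q" using C M hk by (simp add: q_def)
      have \<kappa>0: "0 \<le> \<kappa>" using Cc Mp J hk by (simp add: \<kappa>_def)
      have \<kappa>R: "\<kappa> * R k ^ d4 \<le> Cc * a k"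
      proof -
        have "\<kappa> * R k ^ d4 \<le> \<kappa> * (a k * (M powr \<beta> * J * h k))" by (intro mult_left_mono Ra \<kappa>0)
        thus ?thesis using Mp J hk by (simp add: \<kappa>_def)
      qed
      \<comment> \<open>The radius is bounded away from zero, so the term without the factor R^(4d)
        is of the order of the rate as well.\<close>
      have \<kappa>a: "\<kappa> \<le> Cc / R\<^sub>0 ^ d4 * a k"
      proof -
        have "\<kappa> * R\<^sub>0 ^ d4 \<le> \<kappa> * R k ^ d4" using Rk R0(1) by (intro mult_left_mono power_mono \<kappa>0) auto
        thus ?thesis using \<kappa>R R0(1) by (simp add: field_simps)
      qed
      have "l2_dist \<nu> (Psi_hat P X Y \<rho> K (n k) (h k) \<omega> x) (\<Psi> x) \<le> C3 * a k + C4 * h k powr r"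
        if x: "x \<in> lip_ball D (R k)" for x
      proof -
        have xS: "x \<in> S" using x lip_ball_S by blast
        have x': "x \<in> lip_ball D (real (m k) powr \<beta>')" using x lip_ball_mono[OF RM] by (auto simp: M_def)
        have Fp: "0 < F x (h k)" using J(1) JF[OF x] by linarith
        have IF: "0 < I * F x (h k)" using I3 Fp by simp
        have q\<kappa>: "q / (I * F x (h k)) \<le> \<kappa>"
        proof -
          have "q / (I * F x (h k)) \<le> q / ((c * M) ^ CARD('n) * J)"
            using I_ge JF[OF x] J M q0 c(1) I3 by (intro divide_left_mono mult_mono mult_pos_pos) auto
          also have "\<dots> = \<kappa>"
            using M c(1) hk J unfolding q_def \<kappa>_def Cc_def
            by (simp add: power_mult_distrib powr_minus field_simps)
          finally show ?thesis .
        qed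
        have "q / (I * F x (h k)) \<le> \<mu> / 2"
        proof -
          have "Cc / R\<^sub>0 ^ d4 * a k \<le> \<mu> / 2"
            using elim(6) Cc R0(1) by (simp add: field_simps)
          thus ?thesis using q\<kappa> \<kappa>a by linarith
        qed
        hence q\<mu>: "q \<le> \<mu> / 2 * (I * F x (h k))" using IF by (simp only: pos_divide_le_eq)
        note lw = elim(1)[unfolded uniformly_close_def on_range_def, rule_format, OF nm x' hk(1,3), folded M_def, folded q_def]
        have "l2_dist \<nu> (Psi_hat P X Y \<rho> K (n k) (h k) \<omega> x) (\<Psi> x)
            \<le> 4 / \<mu> * ((1 + l2_norm \<nu> (\<Psi> x)) * (q / (I * F x (h k))) + Cb * h k)"
          by (rule error_bound[OF xS w hk(1-3) I_def _ \<mu>(1) _ _ q\<mu> _ _ Cb(1) Cb(2,3)[OF xS]])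
             (use lw I3 elim(4) xS in auto)
        also have "\<dots> \<le> 4 / \<mu> * ((1 + C\<Psi> * R k ^ d4) * \<kappa> + Cb * h k powr r)"
        proof (intro mult_left_mono add_mono mult_mono)
          show "l2_norm \<nu> (\<Psi> x) \<le> C\<Psi> * R k ^ d4" unfolding d4_def by (rule C\<Psi>(2)[OF Rk(2) x])
          have "h k powr 1 \<le> h k powr r" using hk r by (intro powr_mono') auto
          thus "h k \<le> h k powr r" using hk by simp
        qed (use q\<kappa> C\<Psi>(1) Rk Cb(1) \<mu>(1) q0 IF hk in auto)
        also have "\<dots> = 4 / \<mu> * (\<kappa> + C\<Psi> * (\<kappa> * R k ^ d4)) + C4 * h k powr r"
          by (simp add: C4_def algebra_simps)
        also have "\<dots> \<le> 4 / \<mu> * (Cc / R\<^sub>0 ^ d4 * a k + C\<Psi> * (Cc * a k)) + C4 * h k powr r"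
          using \<kappa>a \<kappa>R C\<Psi>(1) \<mu>(1) by (intro add_right_mono mult_left_mono add_mono) auto
        also have "\<dots> = C3 * a k + C4 * h k powr r" by (simp add: C3_def algebra_simps)
        finally show ?thesis .
      qed
      hence "(SUP x\<in>lip_ball D (R k). ennreal (l2_dist \<nu> (Psi_hat P X Y \<rho> K (n k) (h k) \<omega> x) (\<Psi> x)))
          \<le> ennreal (C3 * a k + C4 * h k powr r)"
        by (intro SUP_least ennreal_leI)
      thus ?case using a0 by simp
    qed
    from bigo_decomposition[OF this C34] show ?case unfolding a_def .
  qed
qed

end

theorem theorem4p4:
  fixes D :: "(real ^ 'd) set"
    and \<nu> :: "(real ^ 'd) measure"
    and e :: "nat \<Rightarrow> 'd fld"
    and S :: "'d fld set"
    and \<rho> :: "'d fld \<Rightarrow> 'd fld \<Rightarrow> real"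
    and P :: "'w measure"
    and X Y \<epsilon> :: "int ^ 'n \<Rightarrow> 'w \<Rightarrow> 'd fld"
    and \<Psi> :: "'d fld \<Rightarrow> 'd fld"
    and K K' :: "real \<Rightarrow> real"
    and r L\<^sub>\<Psi> \<delta>\<^sub>1 :: real
    and \<theta> \<theta>' :: "'d fld \<Rightarrow> nat \<Rightarrow> real \<Rightarrow> real"
    and L :: "'d fld \<Rightarrow> nat \<Rightarrow> real"
    and L\<^sub>K :: real
    and \<tau> :: "'d fld \<Rightarrow> real \<Rightarrow> real"
    and \<delta>\<^sub>6 :: real and L\<^sub>F :: "'d fld \<Rightarrow> real"
    and \<gamma> \<kappa>\<^sub>0 \<kappa>\<^sub>1 d\<^sub>0 d\<^sub>1 :: real
    and \<eta> \<eta>' :: "'d fld \<Rightarrow> real \<Rightarrow> real"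
    and \<delta>\<^sub>8 C\<^sub>8 C\<^sub>8' :: real
    and n :: "nat \<Rightarrow> nat ^ 'n"
    and R h :: "nat \<Rightarrow> real"
    and l :: ereal
  defines "F \<equiv> small_ball P X \<rho>"
  assumes D: "convex D" "compact D"
    and \<nu>: "finite_measure \<nu>" "sets \<nu> = sets (restrict_space borel D)"
    and e: "orthonormal_basis \<nu> e"
    and S: "l2_subset \<nu> S" "{x. continuous_on D x} \<subseteq> S"
    and \<rho>: "pseudo_metric_on S \<rho>" "\<forall>x\<in>S. \<forall>y\<in>S. \<rho> x y \<le> l2_dist \<nu> x y"
    and P: "prob_space P"
    and X: "\<forall>s. X s \<in> P \<rightarrow>\<^sub>M l2_borel \<nu> S"
    and Y: "\<forall>s. Y s \<in> P \<rightarrow>\<^sub>M l2_borel \<nu> (l2_space \<nu>)"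
    and stationary: "strictly_stationary P (l2_borel \<nu> S \<Otimes>\<^sub>M l2_borel \<nu> (l2_space \<nu>))
                       (\<lambda>s \<omega>. (X s \<omega>, Y s \<omega>))"
    and \<Psi>: "\<forall>x\<in>S. \<Psi> x \<in> l2_space \<nu>"
    and \<epsilon>: "\<forall>s. \<epsilon> s \<in> P \<rightarrow>\<^sub>M l2_borel \<nu> (l2_space \<nu>)"
           "\<forall>s. l2_cond_mean_zero P \<nu> (\<epsilon> s) (l2_borel \<nu> S) (X s)"
    and model: "\<forall>s. AE \<omega> in P. AE u in \<nu>. Y s \<omega> u = \<Psi> (X s \<omega>) u + \<epsilon> s \<omega> u"
    \<comment> \<open>(1)\<close>
    and r: "0 < r" "r \<le> 1"
    and \<Psi>_hoelder: "\<forall>x\<in>S. \<forall>y\<in>S. l2_dist \<nu> (\<Psi> x) (\<Psi> y) \<le> L\<^sub>\<Psi> * l2_dist \<nu> x y powr r"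
    and \<theta>: "\<forall>s. \<forall>x\<in>S. \<forall>j. cond_exp_version P
              (\<lambda>\<omega>. l2_inner \<nu> (\<Psi> (X s \<omega>)) (e j) - l2_inner \<nu> (\<Psi> x) (e j))
              (\<lambda>\<omega>. \<rho> (X s \<omega>) x) (\<theta> x j)"
    and \<delta>\<^sub>1: "0 < \<delta>\<^sub>1"
    and \<theta>_0: "\<forall>x\<in>S. \<forall>j. \<theta> x j 0 = 0"
    and \<theta>': "\<forall>x\<in>S. \<forall>j. \<forall>u\<in>{0..\<delta>\<^sub>1}. (\<theta> x j has_real_derivative \<theta>' x j u) (at u within {0..})"
    and L: "\<forall>x\<in>S. \<forall>j. 0 < L x j"
           "\<forall>x\<in>S. \<forall>j. \<forall>u\<in>{0..\<delta>\<^sub>1}. \<bar>\<theta>' x j u - \<theta>' x j 0\<bar> \<le> L x j * u powr r"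
    and \<theta>'_sum: "(SUP x\<in>S. \<Sum>j. ennreal ((\<theta>' x j 0)\<^sup>2)) < \<infinity>"
    and L_sum: "(SUP x\<in>S. \<Sum>j. ennreal ((L x j)\<^sup>2)) < \<infinity>"
    \<comment> \<open>(2), (3)\<close>
    and K_support: "\<forall>u>1. K u = 0"
    and K': "\<forall>u\<in>{0..1}. (K has_real_derivative K' u) (at u within {0..1})"
            "continuous_on {0..1} K'" "\<forall>u\<in>{0..1}. K' u \<le> 0"
    and K_lip: "\<forall>u\<in>{0..1}. \<forall>v\<in>{0..1}. \<bar>K u - K v\<bar> \<le> L\<^sub>K * \<bar>u - v\<bar>"
    and K_1: "K 1 = 0"
    \<comment> \<open>(4)\<close>
    and F_pos: "\<forall>x\<in>S. \<forall>z>0. 0 < F x z"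
    and \<tau>: "\<forall>x\<in>S. \<forall>u\<in>{0..1}. ((\<lambda>z. F x (z * u) / F x z) \<longlongrightarrow> \<tau> x u) (at_right 0)"
           "uniform_limit (S \<times> {0..1}) (\<lambda>z (x, u). F x (z * u) / F x z) (\<lambda>(x, u). \<tau> x u) (at_right 0)"
    \<comment> \<open>(5)\<close>
    and M: "\<forall>x\<in>S. 0 < K 1 - integral {0..1} (\<lambda>u. K' u * \<tau> x u)"
           "0 < (INF x\<in>S. K 1 - integral {0..1} (\<lambda>u. K' u * \<tau> x u))"
    \<comment> \<open>(6)\<close>
    and \<delta>\<^sub>6: "0 < \<delta>\<^sub>6"
    and F_lip: "\<forall>x\<in>S. \<forall>w. 0 < w \<and> w \<le> \<delta>\<^sub>6 \<longrightarrow>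
                  (\<forall>z\<in>S. \<forall>z'\<in>S. \<forall>u\<in>{0..1}. \<forall>u'\<in>{0..1}.
                     \<bar>F z (w * u) / F x w - F z' (w * u') / F x w\<bar> \<le> L\<^sub>F x * (\<rho> z z' + \<bar>u - u'\<bar>))"
    \<comment> \<open>(7)\<close>
    and tail_const: "1 \<le> \<gamma>" "0 < \<kappa>\<^sub>0" "0 < \<kappa>\<^sub>1" "0 < d\<^sub>0" "0 < d\<^sub>1"
    and Y_tail: "\<forall>s. \<forall>z\<ge>0. measure P {\<omega>\<in>space P. l2_norm \<nu> (Y s \<omega>) \<ge> z} \<le> \<kappa>\<^sub>0 * exp (- \<kappa>\<^sub>1 * z powr \<gamma>)"
    and Y_coord: "\<forall>s j. (\<integral>\<omega>. (l2_inner \<nu> (Y s \<omega>) (e j))\<^sup>2 \<partial>P) \<le> d\<^sub>0 * exp (- d\<^sub>1 * real j)"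
    \<comment> \<open>(8)\<close>
    and \<eta>: "\<forall>s. \<forall>x\<in>S. cond_exp_version P (\<lambda>\<omega>. l2_norm \<nu> (Y s \<omega>)) (\<lambda>\<omega>. \<rho> (X s \<omega>) x) (\<eta> x)"
    and \<eta>_0: "\<forall>\<^sub>F b in at_top. \<forall>x\<in>S. Linf_norm \<nu> x \<le> ennreal b \<longrightarrow> \<bar>\<eta> x 0\<bar> \<le> C\<^sub>8 * b powr r"
    and \<delta>\<^sub>8: "0 < \<delta>\<^sub>8"
    and \<eta>': "\<forall>x\<in>S. \<forall>u\<in>{0..\<delta>\<^sub>8}. (\<eta> x has_real_derivative \<eta>' x u) (at u within {0..})"
            "\<forall>x\<in>S. \<forall>u\<in>{0..\<delta>\<^sub>8}. \<bar>\<eta>' x u\<bar> \<le> C\<^sub>8'"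
    \<comment> \<open>(9)\<close>
    and weak_dep_Y: "(SUP j. SUP B\<in>{0<..}. \<Sum>i. weak_dep_coeff P \<nu> S X
                        (\<lambda>s \<omega>. truncate B (l2_inner \<nu> (Y s \<omega>) (e j))) (Suc i)) < \<infinity>"
    and weak_dep_1: "(\<Sum>i. weak_dep_coeff P \<nu> S X (\<lambda>s \<omega>. 1) (Suc i)) < \<infinity>"
    \<comment> \<open>sampling scheme, radii and bandwidths\<close>
    and n: "converges_to_infinity n"
    and R: "(\<lambda>k. ereal (R k)) \<longlonglongrightarrow> l" "0 < l"
    and h: "\<forall>k. 0 < h k" "h \<longlonglongrightarrow> 0"
    and rate: "(\<lambda>k. unif_rate P X \<rho> D (n k) (R k) (h k)) \<longlonglongrightarrow> 0"
  shows "AE \<omega> in P. \<exists>A\<in>O(\<lambda>k. unif_rate P X \<rho> D (n k) (R k) (h k)). \<exists>B\<in>O(\<lambda>k. h k powr r).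
           \<forall>\<^sub>F k in sequentially.
             (SUP x\<in>lip_ball D (R k). ennreal (l2_dist \<nu> (Psi_hat P X Y \<rho> K (n k) (h k) \<omega> x) (\<Psi> x)))
             = ennreal (A k + B k)"
proof -
  interpret functional_regression D \<nu> e S \<rho> P X Y \<epsilon> \<Psi> K K' r L\<^sub>\<Psi> \<delta>\<^sub>1 \<theta> \<theta>' L L\<^sub>K \<tau> \<delta>\<^sub>6 L\<^sub>F \<gamma> \<kappa>\<^sub>0 \<kappa>\<^sub>1 d\<^sub>0 d\<^sub>1
    by (rule functional_regression.intro) (fact assms[unfolded F_def])+
  show ?thesis by (rule uniform_rate_of_convergence[OF n R h rate])
qed

end
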